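(* Let $a>0$. Let $\mathsf S=(s_k)_{k\in I}$ and $\mathsf S'=(t_k)_{k\in I}$ be temporal multisequences in $[0,\infty)$, indexed by the same countable set $I$, each with bounded unit-cell multiplicity. If \[\sup_{k\in I}|\omega(t_k)-\omega(s_k)|<\infty,\qquad \omega(s)=\sqrt{8s+4},\] then $\{T_a^{s_k}k_0\}_{k\in I}$ is a frame for $K_a$ if and only if $\{T_a^{t_k}k_0\}_{k\in I}$ is a frame for $K_a$. In particular, the conclusion holds if, for some $D\ge0$, \[|t_k-s_k|\le D\sqrt{1+s_k},\qquad k\in I.\]
   Context: $H^2$ is the Hardy space on the unit disk, $M_z$ is multiplication by $z$, and $P_K$ denotes orthogonal projection onto a closed subspace $K$. For $a>0$: $\theta_a(z)=\exp\left(-a\frac{1+z}{1-z}\right)$, $K_a=H^2\ominus\theta_aH^2$, $T_a=P_{K_a}M_z|_{K_a}$, $k_0=P_{K_a}1$. The spectrum of $T_a$ is $\{1\}$. Real powers are $T_a^s=\exp(s\operatorname{Log}T_a)$, $s\in\mathbb R$, via the holomorphic functional calculus, where $\operatorname{Log}$ is the holomorphic logarithm near $1$ with $\operatorname{Log}1=0$. An indexed family $\{f_k\}_{k\in I}$ in a Hilbert space $\mathcal H$ is a frame if there are $0<A\le B<\infty$ with $A\|h\|^2\le\sum_{k\in I}|\langle h,f_k\rangle|^2\le B\|h\|^2$ for all $h\in\mathcal H$. A temporal multisequence is a family of points in $[0,\infty)$ indexed by a countable set, repetitions counted. $(s_k)_{k\in I}$ has bounded unit-cell multiplicity if $\sup_{n\in\mathbb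 N_0}\#\{k\in I:s_k\in[n,n+1)\}<\infty$, where $\mathbb N_0=\{0,1,2,\dots\}$. *)

theory Defs
  imports "HOL-Complex_Analysis.Complex_Analysis"
begin

section \<open>The Hardy space on the unit disk\<close>

definition taylor_coeff :: "(complex \<Rightarrow> complex) \<Rightarrow> nat \<Rightarrow> complex" where
  "taylor_coeff f n = (deriv ^^ n) f 0 / fact n"

text \<open>Functions on the disk are represented by total functions that vanish off the disk, so that
  equality in the Hardy space is equality of functions.\<close>

definition hardy2 :: "(complex \<Rightarrow> complex) set" where
  "hardy2 = {f. f holomorphic_on ball 0 1 \<and> (\<forall>z. z \<notin> ball 0 1 \<longrightarrow> f z = 0) \<and>
                summable (\<lambda>n. (norm (taylor_coeff f n))\<^sup>2)}"

definition hinner :: "(complex \<Rightarrow> complex) \<Rightarrow> (complex \<Rightarrow> complex) \<Rightarrow> complex" where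
  "hinner f g = (\<Sum>n. taylor_coeff f n * cnj (taylor_coeff g n))"

definition hnorm :: "(complex \<Rightarrow> complex) \<Rightarrow> real" where
  "hnorm f = sqrt (Re (hinner f f))"

definition hone :: "complex \<Rightarrow> complex" where
  "hone z = (if z \<in> ball 0 1 then 1 else 0)"

definition Mz :: "(complex \<Rightarrow> complex) \<Rightarrow> complex \<Rightarrow> complex" where
  "Mz f z = z * f z"

definition hproj :: "(complex \<Rightarrow> complex) set \<Rightarrow> (complex \<Rightarrow> complex) \<Rightarrow> complex \<Rightarrow> complex" where
  "hproj K f = (THE g. g \<in> K \<and> (\<forall>h\<in>K. hinner (\<lambda>z. f z - g z) h = 0))"

section \<open>Holomorphic functional calculus on a closed subspace\<close>

definition resolvent ::
    "(complex \<Rightarrow> complex) set \<Rightarrow> ((complex \<Rightarrow> complex) \<Rightarrow> complex \<Rightarrow> complex) \<Rightarrow> complex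
      \<Rightarrow> (complex \<Rightarrow> complex) \<Rightarrow> complex \<Rightarrow> complex" where
  "resolvent K T \<zeta> = inv_into K (\<lambda>f z. \<zeta> * f z - T f z)"

text \<open>The Riesz--Dunford integral of \<open>\<phi>(\<zeta>) (\<zeta> - T)\<^sup>-\<^sup>1 h / (2\<pi>i)\<close> along \<open>\<gamma>\<close>. The vector-valued integral
  is written weakly, as the element of \<open>K\<close> representing the scalar contour integrals. The path
  \<open>\<gamma>\<close> is meant to wind once around the spectrum of \<open>T\<close> inside the domain of \<open>\<phi>\<close>.\<close>

definition holo_calc ::
    "(complex \<Rightarrow> complex) set \<Rightarrow> ((complex \<Rightarrow> complex) \<Rightarrow> complex \<Rightarrow> complex) \<Rightarrow> (real \<Rightarrow> complex)
      \<Rightarrow> (complex \<Rightarrow> complex) \<Rightarrow> (complex \<Rightarrow> complex) \<Rightarrow> complex \<Rightarrow> complex" where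
  "holo_calc K T \<gamma> \<phi> h =
     (THE g. g \<in> K \<and> (\<forall>u\<in>K. hinner g u =
        contour_integral \<gamma> (\<lambda>\<zeta>. \<phi> \<zeta> * hinner (resolvent K T \<zeta> h) u) / (2 * of_real pi * \<i>)))"

section \<open>The model space and the compressed shift\<close>

definition theta :: "real \<Rightarrow> complex \<Rightarrow> complex" where
  "theta a z = exp (- of_real a * ((1 + z) / (1 - z)))"

definition model_space :: "real \<Rightarrow> (complex \<Rightarrow> complex) set" where
  "model_space a = {f \<in> hardy2. \<forall>g\<in>hardy2. hinner f (\<lambda>z. theta a z * g z) = 0}"

definition comp_shift :: "real \<Rightarrow> (complex \<Rightarrow> complex) \<Rightarrow> complex \<Rightarrow> complex" where
  "comp_shift a f = hproj (model_space a) (Mz f)"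

definition kzero :: "real \<Rightarrow> complex \<Rightarrow> complex" where
  "kzero a = hproj (model_space a) hone"

text \<open>The compressed shift has spectrum \<open>{1}\<close>, so the circle of radius \<open>1/2\<close> about \<open>1\<close> is an
  admissible contour: it surrounds the spectrum and the closed disk it bounds lies in the domain
  of the principal logarithm \<open>Ln\<close>.\<close>

definition comp_shift_power :: "real \<Rightarrow> real \<Rightarrow> (complex \<Rightarrow> complex) \<Rightarrow> complex \<Rightarrow> complex" where
  "comp_shift_power a s =
     holo_calc (model_space a) (comp_shift a) (circlepath 1 (1/2)) (\<lambda>\<zeta>. exp (of_real s * Ln \<zeta>))"

section \<open>Frames and temporal multisequences\<close>

definition hframe :: "(complex \<Rightarrow> complex) set \<Rightarrow> 'i set \<Rightarrow> ('i \<Rightarrow> complex \<Rightarrow> complex) \<Rightarrow> bool" where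
  "hframe K I f \<longleftrightarrow> (\<forall>k\<in>I. f k \<in> K) \<and>
     (\<exists>A B. 0 < A \<and> A \<le> B \<and>
        (\<forall>h\<in>K. (\<lambda>k. (norm (hinner h (f k)))\<^sup>2) summable_on I \<and>
               A * (hnorm h)\<^sup>2 \<le> (\<Sum>\<^sub>\<infinity>k\<in>I. (norm (hinner h (f k)))\<^sup>2) \<and>
               (\<Sum>\<^sub>\<infinity>k\<in>I. (norm (hinner h (f k)))\<^sup>2) \<le> B * (hnorm h)\<^sup>2))"

definition temporal_multiseq :: "'i set \<Rightarrow> ('i \<Rightarrow> real) \<Rightarrow> bool" where
  "temporal_multiseq I s \<longleftrightarrow> countable I \<and> (\<forall>k\<in>I. 0 \<le> s k)"

definition bounded_cell_mult :: "'i set \<Rightarrow> ('i \<Rightarrow> real) \<Rightarrow> bool" where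
  "bounded_cell_mult I s \<longleftrightarrow>
     (\<exists>M::nat. \<forall>n::nat. finite {k\<in>I. s k \<in> {real n..<real n + 1}} \<and>
                        card {k\<in>I. s k \<in> {real n..<real n + 1}} \<le> M)"

definition omega :: "real \<Rightarrow> real" where
  "omega s = sqrt (8 * s + 4)"

end

theory Submission
  imports Defs "HOL-Real_Asymp.Real_Asymp"
begin

text \<open>
  Write \<open>c\<close> for the Taylor coefficients of \<open>h \<in> K\<^sub>a\<close> and \<open>\<Delta>\<close> for the forward difference. The adjoint
  of \<open>T\<^sub>a\<close> is the backward shift \<open>1 + \<Delta>\<close>, so expanding \<open>T\<^sub>a\<^sup>s\<close> about \<open>1\<close> gives
  \<open>\<langle>h, T\<^sub>a\<^sup>s k\<^sub>0\<rangle> = \<Sum>\<^sub>j (s choose j) \<Delta>\<^sup>j c\<^sub>0\<close>: sampling along the orbit is sampling the Newton interpolant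
  of the coefficients (\<open>comp_shift_power_kzero\<close>). Since \<open>\<Sum>\<^sub>n |c\<^sub>n|\<^sup>2 = \<parallel>h\<parallel>\<^sup>2\<close>, the frame property
  asks whether the samples at the \<open>s\<^sub>k\<close> control the samples at the integers.

  In the model \<open>L\<^sup>2(0,a)\<close> of \<open>K\<^sub>a\<close> the number \<open>c\<^sub>n\<close> is a coefficient against the Laguerre function
  \<open>e\<^sup>-\<^sup>x L\<^sub>n(2x)\<close>, which behaves like a Bessel function of \<open>\<omega>(n) sqrt x\<close>. The interpolant is thus band
  limited in the variable \<open>\<omega>(s)\<close>, or \<open>sqrt s\<close>. Bounded multiplicity per unit of \<open>s\<close> prevents the
  points from clustering, and the answer has the form of the Logvinenko--Sereda theorem: the orbit is
  a frame if and only if, for some length \<open>L\<close>, all far enough intervals \<open>[L i, L (i + 1))\<close> contain at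
  least \<open>\<gamma> i\<close> of the points \<open>sqrt s\<^sub>k\<close> (\<open>sqrt_dense\<close>). This condition is insensitive to bounded
  displacements of \<open>\<omega>\<close> (\<open>sqrt_dense_perturb\<close>), whence the theorem.

  Density suffices (\<open>dense_imp_lower_frame\<close>) because of the Bernstein inequalities
  \<open>\<Sum>\<^sub>n (n + 1)\<dots>(n + m) |\<Delta>\<^sup>m c\<^sub>n|\<^sup>2 \<le> (2a)\<^sup>m \<parallel>h\<parallel>\<^sup>2\<close> (\<open>bernstein_partial\<close>), which express Bessel's
  inequality for the Laguerre functions of order \<open>m\<close>. They make the interpolant on an interval of
  bounded \<open>sqrt s\<close>-length superexponentially close, on average, to polynomials of degree \<open>m\<close>, while a
  discrete Remez inequality (\<open>discrete_remez\<close>) bounds a polynomial by its values at the sampling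
  points with a constant that is only exponential in \<open>m\<close>.

  Density is necessary (\<open>lower_frame_imp_dense\<close>) because the projections of the monomials \<open>z\<^sup>N\<close> are
  localized near \<open>sqrt N\<close>: the matrix of the projection onto \<open>K\<^sub>a\<close> obeys a Christoffel--Darboux
  formula (\<open>model_kern_christoffel_darboux\<close>), and the sizes of its entries follow from an energy argument for
  the Laguerre recurrence at \<open>x = a\<close> (\<open>osc_energy_asymptotics\<close>).

  All this takes place on sequences. The same matrix provides the Riesz representation of functionals
  on \<open>K\<^sub>a\<close> (\<open>model_seqs_riesz\<close>), from which the projections, resolvents and powers are obtained.
\<close>

section \<open>Laguerre functions\<close>

text \<open>The pair \<open>(t\<^sub>n, \<lambda>\<^sub>n)\<close> at \<open>x\<close>: \<open>t\<^sub>n\<close> is the \<open>n\<close>-th Taylor coefficient of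
  \<open>\<theta>\<^sub>x\<close>, and \<open>\<lambda>\<^sub>n = t\<^sub>0 + \<dots> + t\<^sub>n = e\<^sup>-\<^sup>x L\<^sub>n(2x)\<close> is a Laguerre function, the \<open>n\<close>-th coefficient of
  \<open>\<theta>\<^sub>x / (1 - z)\<close>. The two are computed together because the recurrence for either one alone has
  order two.\<close>

primrec lag_pair :: "real \<Rightarrow> nat \<Rightarrow> real \<times> real" where
  "lag_pair x 0 = (exp (-x), exp (-x))"
| "lag_pair x (Suc n) =
     (let t = (real n * fst (lag_pair x n) - 2 * x * snd (lag_pair x n)) / real (Suc n)
      in (t, snd (lag_pair x n) + t))"

definition theta_coeff :: "real \<Rightarrow> nat \<Rightarrow> real" where "theta_coeff x n = fst (lag_pair x n)"
definition laguerre :: "real \<Rightarrow> nat \<Rightarrow> real" where "laguerre x n = snd (lag_pair x n)"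

lemma theta_coeff_0 [simp]: "theta_coeff x 0 = exp (-x)" and laguerre_0 [simp]: "laguerre x 0 = exp (-x)"
  by (simp_all add: theta_coeff_def laguerre_def)

lemma theta_coeff_Suc: "theta_coeff x (Suc n) = (real n * theta_coeff x n - 2 * x * laguerre x n) / real (Suc n)"
  by (simp add: theta_coeff_def laguerre_def Let_def)

lemma laguerre_Suc: "laguerre x (Suc n) = laguerre x n + theta_coeff x (Suc n)"
  by (simp add: theta_coeff_def laguerre_def Let_def)

lemma theta_coeff_recurrence: "real (Suc n) * theta_coeff x (Suc n) = real n * theta_coeff x n - 2 * x * laguerre x n"
  by (simp add: theta_coeff_Suc)

lemma laguerre_eq_sum: "laguerre x n = (\<Sum>j\<le>n. theta_coeff x j)"
  by (induction n) (simp_all add: laguerre_Suc)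

text \<open>The derivative of \<open>t\<^sub>n\<^sub>+\<^sub>1\<close> involves \<open>x \<lambda>\<^sub>n'\<close>, which is why the classical relation
  \<open>x \<lambda>\<^sub>n' = n t\<^sub>n - x \<lambda>\<^sub>n\<close> is carried through the same induction.\<close>

lemma theta_coeff_deriv_aux:
  "((\<lambda>x. theta_coeff x n) has_real_derivative (theta_coeff x n - 2 * laguerre x n)) (at x) \<and>
   (\<exists>l. ((\<lambda>x. laguerre x n) has_real_derivative l) (at x) \<and> x * l = real n * theta_coeff x n - x * laguerre x n)"
proof (induction n)
  case 0
  have "((\<lambda>x. exp (-x)) has_real_derivative (- exp (-x))) (at x)"
    by (auto intro!: derivative_eq_intros)
  then show ?case by (auto intro!: exI[of _ "- exp (-x)"])
next
  case (Suc n)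
  then obtain l where l: "((\<lambda>x. laguerre x n) has_real_derivative l) (at x)"
      "x * l = real n * theta_coeff x n - x * laguerre x n"
    and t: "((\<lambda>x. theta_coeff x n) has_real_derivative (theta_coeff x n - 2 * laguerre x n)) (at x)" by blast
  let ?d = "theta_coeff x (Suc n) - 2 * laguerre x (Suc n)"
  have "((\<lambda>x. theta_coeff x (Suc n)) has_real_derivative
      (real n * (theta_coeff x n - 2 * laguerre x n) - (2 * laguerre x n + 2 * x * l)) / real (Suc n)) (at x)"
    unfolding theta_coeff_Suc by (auto intro!: derivative_eq_intros l t)
  moreover have "(real n * (theta_coeff x n - 2 * laguerre x n) - (2 * laguerre x n + 2 * x * l)) / real (Suc n) = ?d"
  proof -
    have "2 * x * l = 2 * (real n * theta_coeff x n - x * laguerre x n)" using l(2) by (simp add: algebra_simps)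
    then show ?thesis
      using theta_coeff_recurrence[of n x] unfolding laguerre_Suc by (simp add: field_simps del: of_nat_Suc) (simp add: algebra_simps)
  qed
  ultimately have t': "((\<lambda>x. theta_coeff x (Suc n)) has_real_derivative ?d) (at x)" by simp
  have "((\<lambda>x. laguerre x (Suc n)) has_real_derivative (l + ?d)) (at x)"
    unfolding laguerre_Suc using DERIV_add[OF l(1) t'] by (simp add: laguerre_Suc)
  moreover have "x * (l + ?d) = real (Suc n) * theta_coeff x (Suc n) - x * laguerre x (Suc n)"
    using theta_coeff_recurrence[of n x] l(2) unfolding laguerre_Suc by (simp add: algebra_simps)
  ultimately show ?case using t' by blast
qed

text \<open>The coefficient form of \<open>d\<theta>\<^sub>x/dx = \<theta>\<^sub>x - 2 \<theta>\<^sub>x / (1 - z)\<close>.\<close>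

lemma theta_coeff_has_derivative: "((\<lambda>x. theta_coeff x n) has_real_derivative (theta_coeff x n - 2 * laguerre x n)) (at x)"
  using theta_coeff_deriv_aux by blast

lemma isCont_theta_coeff: "isCont (\<lambda>x. theta_coeff x n) x"
  using theta_coeff_has_derivative DERIV_isCont by blast

lemma continuous_theta_coeff [continuous_intros]: "continuous_on S (\<lambda>x. theta_coeff x n)"
  by (rule continuous_at_imp_continuous_on) (simp add: isCont_theta_coeff)

lemma continuous_laguerre [continuous_intros]: "continuous_on S (\<lambda>x. laguerre x n)"
  unfolding laguerre_eq_sum by (intro continuous_intros)

lemma theta_coeff_at_0: "theta_coeff 0 n = (if n = 0 then 1 else 0)"
  by (induction n) (auto simp: theta_coeff_Suc)

lemma theta_coeff_laguerre_bound:
  assumes "x \<ge> 0"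
  shows "\<bar>theta_coeff x n\<bar> \<le> exp (-x) * (2 + 2 * x) ^ n \<and> \<bar>laguerre x n\<bar> \<le> exp (-x) * (2 + 2 * x) ^ n"
proof (induction n)
  case (Suc n)
  define B where "B = exp (-x) * (2 + 2 * x) ^ n"
  have B: "\<bar>theta_coeff x n\<bar> \<le> B" "\<bar>laguerre x n\<bar> \<le> B" "0 \<le> B" using Suc assms by (auto simp: B_def)
  have "\<bar>real n * theta_coeff x n - 2 * x * laguerre x n\<bar> \<le> real n * B + 2 * x * B"
    using B assms mult_left_mono[OF B(1), of "real n"] mult_left_mono[OF B(2), of "2 * x"]
      abs_triangle_ineq4[of "real n * theta_coeff x n" "2 * x * laguerre x n"] by (auto simp: abs_mult)
  also have "\<dots> \<le> real (Suc n) * ((1 + 2 * x) * B)"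
    using assms B(3) by (simp add: algebra_simps)
  finally have t: "\<bar>theta_coeff x (Suc n)\<bar> \<le> (1 + 2 * x) * B"
    unfolding theta_coeff_Suc by (simp add: abs_divide divide_le_eq del: of_nat_Suc) (simp add: mult.commute)
  have "\<bar>laguerre x (Suc n)\<bar> \<le> (2 + 2 * x) * B"
    using t B(2) abs_triangle_ineq[of "laguerre x n" "theta_coeff x (Suc n)"] unfolding laguerre_Suc
    by (simp add: algebra_simps)
  moreover have "(1 + 2 * x) * B \<le> (2 + 2 * x) * B" using B(3) by (intro mult_right_mono) auto
  ultimately have "\<bar>theta_coeff x (Suc n)\<bar> \<le> (2 + 2 * x) * B" using t by linarith
  then show ?case using \<open>\<bar>laguerre x (Suc n)\<bar> \<le> (2 + 2 * x) * B\<close> by (simp add: B_def mult_ac)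
qed auto

lemma theta_coeff_at_top: "((\<lambda>x. theta_coeff x n) \<longlongrightarrow> 0) at_top"
proof (rule tendsto_rabs_zero_cancel, rule real_tendsto_sandwich[OF _ _ tendsto_const])
  show "((\<lambda>x::real. exp (-x) * (2 + 2 * x) ^ n) \<longlongrightarrow> 0) at_top" by real_asymp
  show "\<forall>\<^sub>F x in at_top. \<bar>theta_coeff x n\<bar> \<le> exp (-x) * (2 + 2 * x) ^ n"
    using eventually_ge_at_top[of 0] by eventually_elim (use theta_coeff_laguerre_bound in blast)
qed auto

section \<open>The kernel of the model space\<close>

text \<open>With \<open>\<Theta>\<close> the matrix of multiplication by \<open>\<theta>\<^sub>x\<close> on Taylor coefficients, this is the matrix
  \<open>I - \<Theta> \<Theta>\<^sup>*\<close>. It turns out to be the orthogonal projection onto the model space, that is, the Gram matrix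
  of the projections of the monomials.\<close>

definition model_kern :: "real \<Rightarrow> nat \<Rightarrow> nat \<Rightarrow> real" where
  "model_kern x n m = (if n = m then 1 else 0) - (\<Sum>i\<le>min n m. theta_coeff x (n - i) * theta_coeff x (m - i))"

lemma model_kern_sym: "model_kern x n m = model_kern x m n"
  by (auto simp: model_kern_def min.commute mult.commute)

lemma model_kern_0_right: "model_kern x n 0 = (if n = 0 then 1 else 0) - theta_coeff x n * theta_coeff x 0"
  by (simp add: model_kern_def)

lemma model_kern_0_left: "model_kern x 0 n = (if n = 0 then 1 else 0) - theta_coeff x n * theta_coeff x 0"
  using model_kern_0_right model_kern_sym by metis

lemma model_kern_Suc_Suc: "model_kern x (Suc n) (Suc m) = model_kern x n m - theta_coeff x (Suc n) * theta_coeff x (Suc m)"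
proof -
  have "(\<Sum>i\<le>Suc (min n m). theta_coeff x (Suc n - i) * theta_coeff x (Suc m - i)) =
      theta_coeff x (Suc n) * theta_coeff x (Suc m) + (\<Sum>i\<le>min n m. theta_coeff x (n - i) * theta_coeff x (m - i))"
    by (subst sum.atMost_Suc_shift) simp
  then show ?thesis by (simp add: model_kern_def)
qed

lemma model_kern_has_derivative:
  "((\<lambda>x. model_kern x n m) has_real_derivative (2 * laguerre x n * laguerre x m)) (at x)"
proof (induction n m rule: diff_induct)
  case (1 n)
  have "((\<lambda>x. (if n = 0 then 1 else 0) - theta_coeff x n * exp (-x)) has_real_derivative
     - ((theta_coeff x n - 2 * laguerre x n) * exp (-x) + (- exp (-x)) * theta_coeff x n)) (at x)"
    by (auto intro!: derivative_eq_intros theta_coeff_has_derivative)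
  then show ?case unfolding model_kern_0_right theta_coeff_0 by (simp add: algebra_simps)
next
  case (2 n)
  have "((\<lambda>x. (if Suc n = 0 then 1 else 0) - theta_coeff x (Suc n) * exp (-x)) has_real_derivative
     - ((theta_coeff x (Suc n) - 2 * laguerre x (Suc n)) * exp (-x) + (- exp (-x)) * theta_coeff x (Suc n))) (at x)"
    by (auto intro!: derivative_eq_intros theta_coeff_has_derivative)
  then show ?case unfolding model_kern_0_left theta_coeff_0 by (simp add: algebra_simps)
next
  case (3 n m)
  have "((\<lambda>x. model_kern x n m - theta_coeff x (Suc n) * theta_coeff x (Suc m)) has_real_derivative
     2 * laguerre x n * laguerre x m - ((theta_coeff x (Suc n) - 2 * laguerre x (Suc n)) * theta_coeff x (Suc m) +
       (theta_coeff x (Suc m) - 2 * laguerre x (Suc m)) * theta_coeff x (Suc n))) (at x)"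
    by (rule DERIV_diff[OF 3 DERIV_mult[OF theta_coeff_has_derivative theta_coeff_has_derivative]])
  moreover have "2 * laguerre x n * laguerre x m - ((theta_coeff x (Suc n) - 2 * laguerre x (Suc n)) * theta_coeff x (Suc m) +
       (theta_coeff x (Suc m) - 2 * laguerre x (Suc m)) * theta_coeff x (Suc n)) = 2 * laguerre x (Suc n) * laguerre x (Suc m)"
    unfolding laguerre_Suc by (simp add: algebra_simps)
  ultimately show ?case unfolding model_kern_Suc_Suc by simp
qed

lemma model_kern_at_0: "model_kern 0 n m = 0"
  by (induction n m rule: diff_induct) (auto simp: model_kern_0_right model_kern_0_left model_kern_Suc_Suc theta_coeff_at_0)

text \<open>Differentiating in \<open>a\<close> telescopes the defining sum to a single product, and the kernel
  vanishes at \<open>a = 0\<close>.\<close>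

lemma model_kern_has_integral:
  assumes "a \<ge> 0"
  shows "((\<lambda>x. 2 * (laguerre x n * laguerre x m)) has_integral model_kern a n m) {0..a}"
proof -
  have "((\<lambda>x. 2 * (laguerre x n * laguerre x m)) has_integral model_kern a n m - model_kern 0 n m) {0..a}"
  proof (rule fundamental_theorem_of_calculus[OF assms])
    fix x assume "x \<in> {0..a}"
    show "((\<lambda>x. model_kern x n m) has_vector_derivative 2 * (laguerre x n * laguerre x m)) (at x within {0..a})"
      using model_kern_has_derivative[of n m x] has_field_derivative_at_within
      by (simp add: has_real_derivative_iff_has_vector_derivative[symmetric] mult.assoc)
  qed
  then show ?thesis by (simp add: model_kern_at_0)
qed

lemma model_kern_at_top: "((\<lambda>b. model_kern b n m) \<longlongrightarrow> (if n = m then 1 else 0)) at_top"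
proof -
  have "((\<lambda>b. (if n = m then 1 else 0) - (\<Sum>i\<le>min n m. theta_coeff b (n - i) * theta_coeff b (m - i)))
     \<longlongrightarrow> (if n = m then 1 else 0) - (\<Sum>i\<le>min n m. 0 * 0)) at_top"
    by (intro tendsto_intros theta_coeff_at_top)
  then show ?thesis unfolding model_kern_def by simp
qed

section \<open>Finite differences and generalized Laguerre functions\<close>

definition fdiff :: "(nat \<Rightarrow> 'a::ab_group_add) \<Rightarrow> nat \<Rightarrow> 'a" where
  "fdiff c n = c (Suc n) - c n"

text \<open>\<open>gen_laguerre m x n = e\<^sup>-\<^sup>x L\<^sub>n\<^sup>(\<^sup>m\<^sup>)(2x)\<close> with the Laguerre polynomials of order \<open>m\<close>.\<close>

primrec gen_laguerre :: "nat \<Rightarrow> real \<Rightarrow> nat \<Rightarrow> real" where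
  "gen_laguerre 0 x n = laguerre x n"
| "gen_laguerre (Suc m) x n = (\<Sum>j\<le>n. gen_laguerre m x j)"

lemma continuous_gen_laguerre [continuous_intros]: "continuous_on S (\<lambda>x. gen_laguerre m x n)"
  by (induction m arbitrary: n) (auto intro!: continuous_intros)

lemma gen_laguerre_recurrence:
  "2 * x * gen_laguerre (Suc m) x k = real (k + m + 1) * gen_laguerre m x k - real (k + 1) * gen_laguerre m x (Suc k)"
proof (induction m arbitrary: k)
  case 0
  show ?case
  proof (induction k)
    case 0 then show ?case using theta_coeff_recurrence[of 0 x] by (simp add: laguerre_Suc)
  next
    case (Suc k)
    then show ?case using theta_coeff_recurrence[of "Suc k" x] by (simp add: laguerre_Suc algebra_simps)
  qed
next
  case (Suc m)
  note step = Suc.IH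
  show ?case
  proof (induction k)
    case 0 show ?case using step[of 0] by (simp add: algebra_simps)
  next
    case (Suc k)
    then show ?case using step[of "Suc k"] by (simp add: algebra_simps)
  qed
qed

lemma pochhammer_Suc_shift: "real (Suc n) * pochhammer (real (Suc (Suc n))) m = pochhammer (real (Suc n)) (Suc m)"
  by (simp add: pochhammer_rec add.commute)

text \<open>The \<open>m\<close>-th difference in \<open>n\<close> trades for a factor \<open>x\<^sup>m\<close> and the Laguerre function of order \<open>m\<close>;
  this is the source of the Bernstein inequality below.\<close>

lemma fdiff_laguerre:
  "pochhammer (real (Suc n)) m * (fdiff ^^ m) (laguerre x) n = (- 2 * x) ^ m * gen_laguerre m x n"
proof (induction m arbitrary: n)
  case (Suc m)
  have "pochhammer (real (Suc n)) (Suc m) * (fdiff ^^ Suc m) (laguerre x) n =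
     pochhammer (real (Suc n)) (Suc m) * (fdiff ^^ m) (laguerre x) (Suc n) -
     pochhammer (real (Suc n)) (Suc m) * (fdiff ^^ m) (laguerre x) n"
    by (simp add: fdiff_def algebra_simps)
  also have "pochhammer (real (Suc n)) (Suc m) * (fdiff ^^ m) (laguerre x) (Suc n) =
     real (Suc n) * ((- 2 * x) ^ m * gen_laguerre m x (Suc n))"
    using Suc.IH[of "Suc n"] pochhammer_Suc_shift[of n m] by (metis mult.assoc)
  also have "pochhammer (real (Suc n)) (Suc m) * (fdiff ^^ m) (laguerre x) n =
     real (n + m + 1) * ((- 2 * x) ^ m * gen_laguerre m x n)"
    unfolding Suc.IH[of n, symmetric] by (simp add: pochhammer_Suc algebra_simps)
  also have "real (Suc n) * ((- 2 * x) ^ m * gen_laguerre m x (Suc n)) -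
      real (n + m + 1) * ((- 2 * x) ^ m * gen_laguerre m x n) = (- 2 * x) ^ m * (- (2 * x * gen_laguerre (Suc m) x n))"
    unfolding gen_laguerre_recurrence by (simp add: algebra_simps)
  also have "\<dots> = (- 2 * x) ^ Suc m * gen_laguerre (Suc m) x n" by simp
  finally show ?case .
qed simp

definition gen_laguerre_gram :: "real \<Rightarrow> nat \<Rightarrow> nat \<Rightarrow> nat \<Rightarrow> real" where
  "gen_laguerre_gram b m n k = integral {0..b} (\<lambda>x. 2 * (2 * x) ^ m * (gen_laguerre m x n * gen_laguerre m x k))"

lemma gen_laguerre_gram_Suc:
  "gen_laguerre_gram b (Suc m) n k =
    (\<Sum>j\<le>n. real (k + m + 1) * gen_laguerre_gram b m j k - real (k + 1) * gen_laguerre_gram b m j (Suc k))"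
proof -
  have "2 * (2 * x) ^ Suc m * (gen_laguerre (Suc m) x n * gen_laguerre (Suc m) x k) =
     (\<Sum>j\<le>n. real (k + m + 1) * (2 * (2 * x) ^ m * (gen_laguerre m x j * gen_laguerre m x k))
         - real (k + 1) * (2 * (2 * x) ^ m * (gen_laguerre m x j * gen_laguerre m x (Suc k))))" for x
  proof -
    have "2 * (2 * x) ^ Suc m * (gen_laguerre (Suc m) x n * gen_laguerre (Suc m) x k) =
      2 * (2 * x) ^ m * gen_laguerre (Suc m) x n * (2 * x * gen_laguerre (Suc m) x k)" by simp
    also have "\<dots> = 2 * (2 * x) ^ m * (\<Sum>j\<le>n. gen_laguerre m x j) *
       (real (k + m + 1) * gen_laguerre m x k - real (k + 1) * gen_laguerre m x (Suc k))"
      unfolding gen_laguerre_recurrence by simp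
    also have "\<dots> = (\<Sum>j\<le>n. real (k + m + 1) * (2 * (2 * x) ^ m * (gen_laguerre m x j * gen_laguerre m x k))
         - real (k + 1) * (2 * (2 * x) ^ m * (gen_laguerre m x j * gen_laguerre m x (Suc k))))"
      unfolding sum_distrib_left sum_distrib_right by (rule sum.cong) (auto simp: algebra_simps)
    finally show ?thesis .
  qed
  then show ?thesis unfolding gen_laguerre_gram_def
    by (simp only: integral_sum integral_diff integral_mult_right integrable_continuous_real
        continuous_intros finite_atMost)
qed

text \<open>Orthogonality of the Laguerre functions of order \<open>m\<close> for the weight \<open>(2x)\<^sup>m\<close>, by induction on
  \<open>m\<close>: order zero is the kernel formula, in which the coefficients of \<open>\<theta>\<^sub>b\<close> vanish as \<open>b\<close> grows.\<close>

lemma gen_laguerre_gram_at_top: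
  "((\<lambda>b. gen_laguerre_gram b m n k) \<longlongrightarrow> (if n = k then pochhammer (real (Suc k)) m else 0)) at_top"
proof (induction m arbitrary: n k)
  case 0
  have "eventually (\<lambda>b. model_kern b n k = gen_laguerre_gram b 0 n k) at_top"
    using eventually_ge_at_top[of 0]
  proof eventually_elim
    case (elim b)
    then show ?case using integral_unique[OF model_kern_has_integral[OF elim, of n k]]
      by (simp add: gen_laguerre_gram_def)
  qed
  from Lim_transform_eventually[OF model_kern_at_top this] show ?case by (cases "n = k") auto
next
  case (Suc m)
  have "((\<lambda>b. gen_laguerre_gram b (Suc m) n k) \<longlongrightarrow>
     (\<Sum>j\<le>n. real (k + m + 1) * (if j = k then pochhammer (real (Suc k)) m else 0)
       - real (k + 1) * (if j = Suc k then pochhammer (real (Suc (Suc k))) m else 0))) at_top"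
    unfolding gen_laguerre_gram_Suc by (intro tendsto_intros Suc.IH)
  moreover have "(\<Sum>j\<le>n. real (k + m + 1) * (if j = k then pochhammer (real (Suc k)) m else 0)
       - real (k + 1) * (if j = Suc k then pochhammer (real (Suc (Suc k))) m else 0)) =
      (if k \<le> n then pochhammer (real (Suc k)) (Suc m) else 0) -
      (if Suc k \<le> n then pochhammer (real (Suc k)) (Suc m) else 0)"
  proof -
    have a: "real (k + m + 1) * pochhammer (real (Suc k)) m = pochhammer (real (Suc k)) (Suc m)"
      by (simp add: pochhammer_Suc algebra_simps)
    have b: "real (k + 1) * pochhammer (real (Suc (Suc k))) m = pochhammer (real (Suc k)) (Suc m)"
      using pochhammer_Suc_shift[of k m] by simp
    have c: "(\<Sum>j\<le>n. u * (if j = i then X else 0)) = (if i \<le> n then u * X else 0)"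
      for u X :: real and i
      by (simp add: sum_distrib_left[symmetric])
    show ?thesis
      unfolding sum_subtractf c a b ..
  qed
  ultimately show ?case by (cases n k rule: linorder_cases) auto
qed

lemma fdiff_pow_eq_sum:
  fixes c :: "nat \<Rightarrow> 'a::comm_ring_1"
  shows "(fdiff ^^ m) c n = (\<Sum>i\<le>m. (-1) ^ (m + i) * of_nat (m choose i) * c (n + i))"
proof (induction m arbitrary: n)
  case (Suc m)
  let ?b = "\<lambda>m i. (-1) ^ (m + i) * of_nat (m choose i) :: 'a"
  have pascal: "?b (Suc m) (Suc i) = ?b m i - ?b m (Suc i)" for i
    by (simp add: algebra_simps)
  have "(\<Sum>i\<le>Suc m. ?b (Suc m) i * c (n + i)) =
      - (?b m 0 * c n) + (\<Sum>i\<le>m. (?b m i - ?b m (Suc i)) * c (Suc n + i))"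
    unfolding sum.atMost_Suc_shift pascal by simp
  moreover have "(\<Sum>i\<le>m. ?b m i * c (n + i)) = (\<Sum>i\<le>Suc m. ?b m i * c (n + i))"
    by (simp add: binomial_eq_0)
  moreover have "\<dots> = ?b m 0 * c n + (\<Sum>i\<le>m. ?b m (Suc i) * c (Suc n + i))"
    unfolding sum.atMost_Suc_shift by simp
  moreover have "(fdiff ^^ Suc m) c n = (\<Sum>i\<le>m. ?b m i * c (Suc n + i)) - (\<Sum>i\<le>m. ?b m i * c (n + i))"
    unfolding funpow.simps o_def fdiff_def by (simp only: Suc.IH fdiff_def[symmetric])
  moreover have "P - (B + Q) = - B + (P - Q)" for P B Q :: 'a by simp
  ultimately show ?case by (simp only: sum_subtractf left_diff_distrib)
qed simp

lemma fdiff_pow_Re: "(fdiff ^^ m) (\<lambda>n. Re (c n)) n = Re ((fdiff ^^ m) c n)"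
  by (induction m arbitrary: n) (simp_all add: fdiff_def)

lemma fdiff_pow_Im: "(fdiff ^^ m) (\<lambda>n. Im (c n)) n = Im ((fdiff ^^ m) c n)"
  by (induction m arbitrary: n) (simp_all add: fdiff_def)

text \<open>\<open>theta_mat x n j\<close> is the \<open>n\<close>-th Taylor coefficient of \<open>z\<^sup>j \<theta>\<^sub>x\<close>.\<close>

definition theta_mat :: "real \<Rightarrow> nat \<Rightarrow> nat \<Rightarrow> real" where
  "theta_mat x n j = (if j \<le> n then theta_coeff x (n - j) else 0)"

lemma model_kern_eq_theta_mat:
  assumes "N \<ge> min n m"
  shows "model_kern x n m = (if n = m then 1 else 0) - (\<Sum>j\<le>N. theta_mat x n j * theta_mat x m j)"
proof -
  have "(\<Sum>j\<le>N. theta_mat x n j * theta_mat x m j) = (\<Sum>i\<le>min n m. theta_coeff x (n - i) * theta_coeff x (m - i))"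
    using assms by (intro sum.mono_neutral_cong_right) (auto simp: theta_mat_def)
  then show ?thesis by (simp add: model_kern_def)
qed

text \<open>The quadratic form of \<open>I - \<Theta> \<Theta>\<^sup>*\<close>: the squared norm of \<open>p\<close> less that of \<open>\<Theta>\<^sup>* p\<close>.\<close>

lemma model_kern_form:
  "(\<Sum>n\<le>N. \<Sum>l\<le>N. model_kern x n l * p l * p n) =
     (\<Sum>n\<le>N. (p n)\<^sup>2) - (\<Sum>j\<le>N. (\<Sum>n\<le>N. theta_mat x n j * p n)\<^sup>2)"
proof -
  have "(\<Sum>n\<le>N. \<Sum>l\<le>N. model_kern x n l * p l * p n) =
     (\<Sum>n\<le>N. \<Sum>l\<le>N. (if n = l then p n * p l else 0) - (\<Sum>j\<le>N. (theta_mat x n j * p n) * (theta_mat x l j * p l)))"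
  proof (intro sum.cong refl)
    fix n l assume "n \<in> {..N}" "l \<in> {..N}"
    then have "model_kern x n l = (if n = l then 1 else 0) - (\<Sum>j\<le>N. theta_mat x n j * theta_mat x l j)"
      by (intro model_kern_eq_theta_mat) auto
    then show "model_kern x n l * p l * p n =
        (if n = l then p n * p l else 0) - (\<Sum>j\<le>N. (theta_mat x n j * p n) * (theta_mat x l j * p l))"
      by (simp add: left_diff_distrib right_diff_distrib sum_distrib_right sum_distrib_left mult_ac)
  qed
  also have "\<dots> = (\<Sum>n\<le>N. (p n)\<^sup>2) - (\<Sum>n\<le>N. \<Sum>l\<le>N. \<Sum>j\<le>N. (theta_mat x n j * p n) * (theta_mat x l j * p l))"
    by (simp add: sum_subtractf power2_eq_square)
  also have "(\<Sum>n\<le>N. \<Sum>l\<le>N. \<Sum>j\<le>N. (theta_mat x n j * p n) * (theta_mat x l j * p l)) =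
     (\<Sum>j\<le>N. \<Sum>n\<le>N. \<Sum>l\<le>N. (theta_mat x n j * p n) * (theta_mat x l j * p l))"
    by (subst (2) sum.swap, subst sum.swap, rule refl)
  also have "\<dots> = (\<Sum>j\<le>N. (\<Sum>n\<le>N. theta_mat x n j * p n)\<^sup>2)"
    by (simp add: power2_eq_square sum_product)
  finally show ?thesis .
qed

text \<open>A Bernstein inequality of every order. In the model \<open>L\<^sup>2(0,a)\<close> the numbers \<open>c n\<close> are the
  coefficients of \<open>g\<close> against the Laguerre functions, the weighted \<open>m\<close>-th differences of these are
  the coefficients of \<open>(2x)\<^sup>m g\<close> against the orthogonal Laguerre functions of order \<open>m\<close>, so Bessel's
  inequality applies; and \<open>2x \<le> 2a\<close> on the interval.\<close>

lemma bernstein_finite: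
  fixes p :: "nat \<Rightarrow> real"
  assumes a: "a > 0" and c: "\<And>n. c n = (\<Sum>l\<le>N'. model_kern a n l * p l)"
  shows "(\<Sum>n\<le>N. pochhammer (real (Suc n)) m * ((fdiff ^^ m) c n)\<^sup>2) \<le>
     (2 * a) ^ m * (\<Sum>n\<le>N'. \<Sum>l\<le>N'. model_kern a n l * p l * p n)"
proof -
  let ?I = "integral {0..a}"
  define g where "g = (\<lambda>x. \<Sum>l\<le>N'. laguerre x l * p l)"
  have [continuous_intros]: "continuous_on S g" for S unfolding g_def by (intro continuous_intros)
  have kI: "model_kern a n l = ?I (\<lambda>x. 2 * (laguerre x n * laguerre x l))" for n l
    using integral_unique[OF model_kern_has_integral, of a n l] a by simp
  have cI: "c n = ?I (\<lambda>x. 2 * (laguerre x n * g x))" for n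
  proof -
    have "c n = (\<Sum>l\<le>N'. ?I (\<lambda>x. 2 * (laguerre x n * laguerre x l) * p l))"
      unfolding c kI by (simp add: integral_mult_left integrable_continuous_real continuous_intros)
    also have "\<dots> = ?I (\<lambda>x. \<Sum>l\<le>N'. 2 * (laguerre x n * laguerre x l) * p l)"
      by (rule integral_sum[symmetric]) (auto intro!: integrable_continuous_real continuous_intros)
    also have "\<dots> = ?I (\<lambda>x. 2 * (laguerre x n * g x))"
      unfolding g_def by (simp add: sum_distrib_left mult_ac)
    finally show ?thesis .
  qed
  define w where "w = (\<lambda>n. pochhammer (real (Suc n)) m)"
  have w: "w n > 0" for n unfolding w_def by (intro pochhammer_pos) auto
  define e where "e = (\<lambda>n. (-1) ^ m * (fdiff ^^ m) c n)"
  have we: "w n * e n = ?I (\<lambda>x. 2 * (2 * x) ^ m * (gen_laguerre m x n * g x))" for n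
  proof -
    let ?b = "\<lambda>i. (-1) ^ (m + i) * of_nat (m choose i) :: real"
    have "w n * (fdiff ^^ m) c n = (\<Sum>i\<le>m. ?I (\<lambda>x. w n * (?b i * (2 * (laguerre x (n + i) * g x)))))"
      unfolding fdiff_pow_eq_sum[of m c] sum_distrib_left cI
      by (simp add: integral_mult_right integrable_continuous_real continuous_intros)
    also have "\<dots> = ?I (\<lambda>x. \<Sum>i\<le>m. w n * (?b i * (2 * (laguerre x (n + i) * g x))))"
      by (rule integral_sum[symmetric]) (auto intro!: integrable_continuous_real continuous_intros)
    also have "\<dots> = ?I (\<lambda>x. 2 * (w n * (fdiff ^^ m) (laguerre x) n) * g x)"
      unfolding fdiff_pow_eq_sum by (simp add: sum_distrib_left sum_distrib_right mult_ac)
    also have "\<dots> = ?I (\<lambda>x. (-1) ^ m * (2 * (2 * x) ^ m * (gen_laguerre m x n * g x)))"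
    proof (rule arg_cong[where f = ?I], rule ext)
      fix x :: real
      have "(- 2 * x) ^ m = ((- 1) * (2 * x)) ^ m" by simp
      also have "\<dots> = (-1) ^ m * (2 * x) ^ m" by (rule power_mult_distrib)
      finally have "(- 2 * x) ^ m = (-1) ^ m * (2 * x) ^ m" .
      then show "2 * (w n * (fdiff ^^ m) (laguerre x) n) * g x =
          (-1) ^ m * (2 * (2 * x) ^ m * (gen_laguerre m x n * g x))"
        unfolding w_def fdiff_laguerre by simp
    qed
    also have "\<dots> = (-1) ^ m * ?I (\<lambda>x. 2 * (2 * x) ^ m * (gen_laguerre m x n * g x))"
      by (intro integral_mult_right)
    finally show ?thesis unfolding e_def
      by (metis (no_types, lifting) left_minus_one_mult_self mult.left_commute)
  qed
  define \<Psi> where "\<Psi> = (\<lambda>x. \<Sum>n\<le>N. e n * gen_laguerre m x n)"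
  have [continuous_intros]: "continuous_on S \<Psi>" for S unfolding \<Psi>_def by (intro continuous_intros)
  define S where "S = (\<Sum>n\<le>N. w n * (e n)\<^sup>2)"
  have cross: "?I (\<lambda>x. 2 * (2 * x) ^ m * (\<Psi> x * g x)) = S"
  proof -
    have "?I (\<lambda>x. 2 * (2 * x) ^ m * (\<Psi> x * g x)) =
        ?I (\<lambda>x. \<Sum>n\<le>N. e n * (2 * (2 * x) ^ m * (gen_laguerre m x n * g x)))"
      unfolding \<Psi>_def by (simp add: sum_distrib_left sum_distrib_right mult_ac)
    also have "\<dots> = (\<Sum>n\<le>N. ?I (\<lambda>x. e n * (2 * (2 * x) ^ m * (gen_laguerre m x n * g x))))"
      by (rule integral_sum) (auto intro!: integrable_continuous_real continuous_intros)
    also have "\<dots> = (\<Sum>n\<le>N. e n * (w n * e n))"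
      unfolding we by (simp add: integral_mult_right)
    finally show ?thesis by (simp add: S_def power2_eq_square mult_ac)
  qed
  have sq: "integral {0..b} (\<lambda>x. 2 * (2 * x) ^ m * (\<Psi> x)\<^sup>2) =
      (\<Sum>n\<le>N. \<Sum>k\<le>N. e n * e k * gen_laguerre_gram b m n k)" for b
  proof -
    have "integral {0..b} (\<lambda>x. 2 * (2 * x) ^ m * (\<Psi> x)\<^sup>2) =
      integral {0..b} (\<lambda>x. \<Sum>n\<le>N. \<Sum>k\<le>N. e n * e k * (2 * (2 * x) ^ m * (gen_laguerre m x n * gen_laguerre m x k)))"
      unfolding \<Psi>_def power2_eq_square sum_product by (simp add: sum_distrib_left mult_ac)
    also have "\<dots> = (\<Sum>n\<le>N. \<Sum>k\<le>N. integral {0..b} (\<lambda>x. e n * e k * (2 * (2 * x) ^ m * (gen_laguerre m x n * gen_laguerre m x k))))"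
      by (simp add: integral_sum integrable_continuous_real continuous_intros)
    finally show ?thesis unfolding gen_laguerre_gram_def by (simp add: integral_mult_right)
  qed
  have "?I (\<lambda>x. 2 * (2 * x) ^ m * (\<Psi> x)\<^sup>2) \<le> S"
  proof (rule tendsto_lowerbound)
    have "((\<lambda>b. \<Sum>n\<le>N. \<Sum>k\<le>N. e n * e k * gen_laguerre_gram b m n k) \<longlongrightarrow>
        (\<Sum>n\<le>N. \<Sum>k\<le>N. e n * e k * (if n = k then pochhammer (real (Suc k)) m else 0))) at_top"
      by (intro tendsto_intros gen_laguerre_gram_at_top)
    also have "(\<Sum>n\<le>N. \<Sum>k\<le>N. e n * e k * (if n = k then pochhammer (real (Suc k)) m else 0)) = S"
      unfolding S_def w_def by (intro sum.cong refl) (simp add: power2_eq_square mult_ac if_distrib sum.delta cong: if_cong)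
    finally show "((\<lambda>b. \<Sum>n\<le>N. \<Sum>k\<le>N. e n * e k * gen_laguerre_gram b m n k) \<longlongrightarrow> S) at_top" .
    show "\<forall>\<^sub>F b in at_top. ?I (\<lambda>x. 2 * (2 * x) ^ m * (\<Psi> x)\<^sup>2) \<le>
        (\<Sum>n\<le>N. \<Sum>k\<le>N. e n * e k * gen_laguerre_gram b m n k)"
      using eventually_ge_at_top[of a]
    proof eventually_elim
      case (elim b)
      then show ?case unfolding sq[symmetric]
        by (intro integral_subset_le) (auto intro!: integrable_continuous_real continuous_intros)
    qed
  qed auto
  moreover have "0 \<le> ?I (\<lambda>x. 2 * (2 * x) ^ m * (g x - \<Psi> x)\<^sup>2)"
    by (intro integral_nonneg) (auto intro!: integrable_continuous_real continuous_intros)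
  moreover have "?I (\<lambda>x. 2 * (2 * x) ^ m * (g x - \<Psi> x)\<^sup>2) =
      ?I (\<lambda>x. 2 * (2 * x) ^ m * (g x)\<^sup>2) - 2 * ?I (\<lambda>x. 2 * (2 * x) ^ m * (\<Psi> x * g x)) +
      ?I (\<lambda>x. 2 * (2 * x) ^ m * (\<Psi> x)\<^sup>2)"
  proof -
    have "?I (\<lambda>x. 2 * (2 * x) ^ m * (g x - \<Psi> x)\<^sup>2) =
      ?I (\<lambda>x. 2 * (2 * x) ^ m * (g x)\<^sup>2 - 2 * (2 * (2 * x) ^ m * (\<Psi> x * g x)) + 2 * (2 * x) ^ m * (\<Psi> x)\<^sup>2)"
      by (simp add: power2_eq_square algebra_simps)
    also have "\<dots> = ?I (\<lambda>x. 2 * (2 * x) ^ m * (g x)\<^sup>2 - 2 * (2 * (2 * x) ^ m * (\<Psi> x * g x))) +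
       ?I (\<lambda>x. 2 * (2 * x) ^ m * (\<Psi> x)\<^sup>2)"
      by (rule integral_add) (auto intro!: integrable_continuous_real continuous_intros)
    also have "?I (\<lambda>x. 2 * (2 * x) ^ m * (g x)\<^sup>2 - 2 * (2 * (2 * x) ^ m * (\<Psi> x * g x))) =
      ?I (\<lambda>x. 2 * (2 * x) ^ m * (g x)\<^sup>2) - ?I (\<lambda>x. 2 * (2 * (2 * x) ^ m * (\<Psi> x * g x)))"
      by (rule integral_diff) (auto intro!: integrable_continuous_real continuous_intros)
    also have "?I (\<lambda>x. 2 * (2 * (2 * x) ^ m * (\<Psi> x * g x))) = 2 * ?I (\<lambda>x. 2 * (2 * x) ^ m * (\<Psi> x * g x))"
      by (rule integral_mult_right)
    finally show ?thesis .
  qed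
  ultimately have "S \<le> ?I (\<lambda>x. 2 * (2 * x) ^ m * (g x)\<^sup>2)" using cross by linarith
  also have "\<dots> \<le> ?I (\<lambda>x. (2 * a) ^ m * (2 * (g x)\<^sup>2))"
  proof (rule integral_le)
    fix x assume "x \<in> {0..a}"
    then have "(2 * x) ^ m \<le> (2 * a) ^ m" by (intro power_mono) auto
    then have "(2 * x) ^ m * (2 * (g x)\<^sup>2) \<le> (2 * a) ^ m * (2 * (g x)\<^sup>2)" by (intro mult_right_mono) auto
    then show "2 * (2 * x) ^ m * (g x)\<^sup>2 \<le> (2 * a) ^ m * (2 * (g x)\<^sup>2)" by (simp add: mult_ac)
  qed (auto intro!: integrable_continuous_real continuous_intros)
  also have "\<dots> = (2 * a) ^ m * ?I (\<lambda>x. 2 * (g x)\<^sup>2)" by (rule integral_mult_right)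
  also have "?I (\<lambda>x. 2 * (g x)\<^sup>2) = ?I (\<lambda>x. \<Sum>n\<le>N'. 2 * (laguerre x n * g x) * p n)"
    by (rule arg_cong[where f = ?I], rule ext) (simp add: g_def power2_eq_square sum_distrib_left sum_distrib_right mult_ac)
  also have "\<dots> = (\<Sum>n\<le>N'. ?I (\<lambda>x. 2 * (laguerre x n * g x) * p n))"
    by (rule integral_sum) (auto intro!: integrable_continuous_real continuous_intros)
  also have "\<dots> = (\<Sum>n\<le>N'. c n * p n)"
    unfolding cI by (simp add: integral_mult_left integrable_continuous_real continuous_intros)
  also have "\<dots> = (\<Sum>n\<le>N'. \<Sum>l\<le>N'. model_kern a n l * p l * p n)"
    unfolding c by (simp add: sum_distrib_right)
  finally have "S \<le> (2 * a) ^ m * (\<Sum>n\<le>N'. \<Sum>l\<le>N'. model_kern a n l * p l * p n)" .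
  moreover have "(e n)\<^sup>2 = ((fdiff ^^ m) c n)\<^sup>2" for n
    unfolding e_def by (cases "even m") auto
  ultimately show ?thesis unfolding S_def w_def by simp
qed

lemma model_kern_form_le: "(\<Sum>n\<le>N. \<Sum>l\<le>N. model_kern x n l * p l * p n) \<le> (\<Sum>n\<le>N. (p n)\<^sup>2)"
  unfolding model_kern_form by (simp add: sum_nonneg)

lemma bernstein_finite_complex:
  fixes p :: "nat \<Rightarrow> complex"
  assumes a: "a > 0" and c: "\<And>n. c n = (\<Sum>l\<le>N'. of_real (model_kern a n l) * p l)"
  shows "(\<Sum>n\<le>N. pochhammer (real (Suc n)) m * (norm ((fdiff ^^ m) c n))\<^sup>2) \<le>
     (2 * a) ^ m * (\<Sum>n\<le>N'. (norm (p n))\<^sup>2)"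
proof -
  have "(\<Sum>n\<le>N. pochhammer (real (Suc n)) m * ((fdiff ^^ m) (\<lambda>n. Re (c n)) n)\<^sup>2) \<le>
     (2 * a) ^ m * (\<Sum>n\<le>N'. \<Sum>l\<le>N'. model_kern a n l * Re (p l) * Re (p n))"
    by (rule bernstein_finite[OF a]) (simp add: c)
  also have "\<dots> \<le> (2 * a) ^ m * (\<Sum>n\<le>N'. (Re (p n))\<^sup>2)"
    using a by (intro mult_left_mono model_kern_form_le) auto
  finally have 1: "(\<Sum>n\<le>N. pochhammer (real (Suc n)) m * (Re ((fdiff ^^ m) c n))\<^sup>2) \<le>
     (2 * a) ^ m * (\<Sum>n\<le>N'. (Re (p n))\<^sup>2)" by (simp add: fdiff_pow_Re)
  have "(\<Sum>n\<le>N. pochhammer (real (Suc n)) m * ((fdiff ^^ m) (\<lambda>n. Im (c n)) n)\<^sup>2) \<le>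
     (2 * a) ^ m * (\<Sum>n\<le>N'. \<Sum>l\<le>N'. model_kern a n l * Im (p l) * Im (p n))"
    by (rule bernstein_finite[OF a]) (simp add: c)
  also have "\<dots> \<le> (2 * a) ^ m * (\<Sum>n\<le>N'. (Im (p n))\<^sup>2)"
    using a by (intro mult_left_mono model_kern_form_le) auto
  finally have 2: "(\<Sum>n\<le>N. pochhammer (real (Suc n)) m * (Im ((fdiff ^^ m) c n))\<^sup>2) \<le>
     (2 * a) ^ m * (\<Sum>n\<le>N'. (Im (p n))\<^sup>2)" by (simp add: fdiff_pow_Im)
  show ?thesis
    unfolding cmod_power2 distrib_left sum.distrib using 1 2 by simp
qed

section \<open>The kernel is a projection\<close>

text \<open>A sequence that varies little over windows of length about \<open>sqrt N\<close> and is square summable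
  is of size \<open>N powr (-1/4)\<close> at most.\<close>

lemma pointwise_decay:
  fixes c :: "nat \<Rightarrow> real"
  assumes A: "\<And>M. (\<Sum>n\<le>M. (c n)\<^sup>2) \<le> A"
    and B: "\<And>M. (\<Sum>n\<le>M. real (Suc n) * (fdiff c n)\<^sup>2) \<le> B"
  shows "(c N)\<^sup>2 \<le> (2 * A + 4 * B) / sqrt (real (Suc N))"
proof -
  define r where "r = sqrt (real (Suc N))"
  have r1: "r \<ge> 1" and r2: "r\<^sup>2 = real (Suc N)" by (auto simp: r_def)
  define W where "W = nat \<lceil>r\<rceil>"
  have W: "r \<le> real W" "real W \<le> 2 * r" unfolding W_def using r1 by linarith+
  have B0: "B \<ge> 0" using B[of 0] by (smt (verit) sum_nonneg mult_nonneg_nonneg of_nat_0_le_iff zero_le_power2)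
  have A0: "A \<ge> 0" using A[of 0] by (smt (verit) sum_nonneg zero_le_power2)
  have D: "(\<Sum>i<W. (fdiff c (N + i))\<^sup>2) \<le> B / r\<^sup>2"
  proof -
    have "r\<^sup>2 * (\<Sum>i<W. (fdiff c (N + i))\<^sup>2) \<le> (\<Sum>i<W. real (Suc (N + i)) * (fdiff c (N + i))\<^sup>2)"
      unfolding sum_distrib_left r2 by (intro sum_mono mult_right_mono) auto
    also have "\<dots> = (\<Sum>n\<in>(\<lambda>i. N + i) ` {..<W}. real (Suc n) * (fdiff c n)\<^sup>2)"
      by (subst sum.reindex) (auto simp: inj_on_def)
    also have "\<dots> \<le> (\<Sum>n\<le>N + W. real (Suc n) * (fdiff c n)\<^sup>2)"
      by (intro sum_mono2) auto
    also have "\<dots> \<le> B" by (rule B)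
    finally show ?thesis using r1 by (simp add: field_simps)
  qed
  have step: "(c N)\<^sup>2 \<le> 2 * (c (N + l))\<^sup>2 + 2 * (real W * (B / r\<^sup>2))" if "l < W" for l
  proof -
    have "c (N + l) - c N = (\<Sum>i<l. fdiff c (N + i))"
      by (induction l) (auto simp: fdiff_def)
    then have "(c (N + l) - c N)\<^sup>2 \<le> real l * (\<Sum>i<l. (fdiff c (N + i))\<^sup>2)"
      using sum_squared_le_sum_of_squares[of "\<lambda>i. fdiff c (N + i)" "{..<l}"] by (simp add: mult.commute)
    also have "\<dots> \<le> real W * (\<Sum>i<W. (fdiff c (N + i))\<^sup>2)"
      using that by (intro mult_mono sum_mono2) (auto intro: sum_nonneg)
    also have "\<dots> \<le> real W * (B / r\<^sup>2)" by (intro mult_left_mono D) auto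
    finally have 1: "(c (N + l) - c N)\<^sup>2 \<le> real W * (B / r\<^sup>2)" .
    have "(c N)\<^sup>2 \<le> 2 * (c (N + l))\<^sup>2 + 2 * (c (N + l) - c N)\<^sup>2"
      using sum_squares_ge_zero[of "2 * c (N + l) - c N" 0] by (simp add: power2_eq_square algebra_simps)
    with 1 show ?thesis by linarith
  qed
  have "real W * (c N)\<^sup>2 = (\<Sum>l<W. (c N)\<^sup>2)" by simp
  also have "\<dots> \<le> (\<Sum>l<W. 2 * (c (N + l))\<^sup>2 + 2 * (real W * (B / r\<^sup>2)))"
    by (intro sum_mono step) auto
  also have "\<dots> = 2 * (\<Sum>l<W. (c (N + l))\<^sup>2) + real W * (2 * (real W * (B / r\<^sup>2)))"
    by (simp add: sum.distrib sum_distrib_left)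
  also have "(\<Sum>l<W. (c (N + l))\<^sup>2) \<le> A"
  proof -
    have "(\<Sum>l<W. (c (N + l))\<^sup>2) = (\<Sum>n\<in>(\<lambda>i. N + i) ` {..<W}. (c n)\<^sup>2)"
      by (subst sum.reindex) (auto simp: inj_on_def)
    also have "\<dots> \<le> (\<Sum>n\<le>N + W. (c n)\<^sup>2)" by (intro sum_mono2) auto
    finally show ?thesis using A[of "N + W"] by linarith
  qed
  finally have "(c N)\<^sup>2 \<le> 2 * A / real W + 2 * (real W * (B / r\<^sup>2))"
    using W(1) r1 by (simp add: field_simps)
  also have "\<dots> \<le> 2 * A / r + 2 * (2 * r * (B / r\<^sup>2))"
    using W r1 A0 B0 by (intro add_mono divide_left_mono mult_left_mono mult_right_mono mult_pos_pos) auto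
  also have "\<dots> = (2 * A + 4 * B) / r" using r1 by (simp add: field_simps power2_eq_square)
  finally show ?thesis by (simp add: r_def)
qed

lemma model_kern_column_bernstein:
  assumes "a > 0"
  shows "(\<Sum>n\<le>M. pochhammer (real (Suc n)) m * ((fdiff ^^ m) (\<lambda>n. model_kern a n N) n)\<^sup>2) \<le>
     (2 * a) ^ m * model_kern a N N"
proof -
  let ?p = "\<lambda>l. if l = N then 1 else 0 :: real"
  have "(\<Sum>n\<le>M. pochhammer (real (Suc n)) m * ((fdiff ^^ m) (\<lambda>n. model_kern a n N) n)\<^sup>2) \<le>
     (2 * a) ^ m * (\<Sum>n\<le>N. \<Sum>l\<le>N. model_kern a n l * ?p l * ?p n)"
    by (rule bernstein_finite[OF assms]) (simp add: if_distrib cong: if_cong)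
  also have "(\<Sum>n\<le>N. \<Sum>l\<le>N. model_kern a n l * ?p l * ?p n) = (\<Sum>n\<le>N. if n = N then model_kern a N N else 0)"
    by (intro sum.cong refl) (auto simp: if_distrib[of "(*) _"] cong: if_cong)
  also have "\<dots> = model_kern a N N" by simp
  finally show ?thesis .
qed

lemma model_kern_column_sq_le:
  assumes "a > 0"
  shows "(\<Sum>n\<le>M. (model_kern a n N)\<^sup>2) \<le> model_kern a N N"
  using model_kern_column_bernstein[OF assms, where m = 0] by simp

lemma model_kern_diag_nonneg: "a > 0 \<Longrightarrow> model_kern a N N \<ge> 0"
  using model_kern_column_sq_le[of a N 0] by (smt (verit) sum_nonneg zero_le_power2)

text \<open>A kernel column is its own test sequence: its value at \<open>N\<close> is also its squared norm, so the
  Bernstein inequalities of orders zero and one bound the diagonal.\<close>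

lemma model_kern_diag_le:
  assumes "a > 0"
  shows "model_kern a N N \<le> (2 + 8 * a) / sqrt (real (Suc N))"
proof (cases "model_kern a N N = 0")
  case False
  have "(model_kern a N N)\<^sup>2 \<le> (2 * model_kern a N N + 4 * (2 * a * model_kern a N N)) / sqrt (real (Suc N))"
    using model_kern_column_sq_le[OF assms] model_kern_column_bernstein[OF assms, where m = 1]
    by (intro pointwise_decay) simp_all
  also have "\<dots> = model_kern a N N * ((2 + 8 * a) / sqrt (real (Suc N)))" by (simp add: algebra_simps)
  finally have "model_kern a N N * model_kern a N N \<le> model_kern a N N * ((2 + 8 * a) / sqrt (real (Suc N)))"
    by (simp add: power2_eq_square)
  then show ?thesis using False model_kern_diag_nonneg[OF assms, of N]
    by (metis mult_le_cancel_left_pos order_less_le)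
qed (use assms in simp)

lemma model_kern_diag_tendsto:
  assumes "a > 0"
  shows "(\<lambda>N. model_kern a N N) \<longlonglongrightarrow> 0"
proof (rule real_tendsto_sandwich[OF _ _ tendsto_const])
  show "(\<lambda>N. (2 + 8 * a) / sqrt (real (Suc N))) \<longlonglongrightarrow> 0" by real_asymp
qed (use assms in \<open>auto simp: model_kern_diag_nonneg model_kern_diag_le simp del: of_nat_Suc\<close>)

lemma model_kern_diagonals_tendsto:
  assumes "a > 0"
  shows "(\<lambda>n. model_kern a n (n + k)) \<longlonglongrightarrow> 0"
proof -
  have "(\<lambda>n. (model_kern a n (n + k))\<^sup>2) \<longlonglongrightarrow> 0"
  proof (rule real_tendsto_sandwich[OF _ _ tendsto_const model_kern_diag_tendsto[OF assms]])
    have "(model_kern a n (n + k))\<^sup>2 \<le> model_kern a n n" for n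
    proof -
      have "(model_kern a (n + k) n)\<^sup>2 \<le> (\<Sum>i\<le>n + k. (model_kern a i n)\<^sup>2)"
        by (rule member_le_sum) auto
      then show ?thesis using model_kern_column_sq_le[OF assms, of n "n + k"] by (simp add: model_kern_sym)
    qed
    then show "\<forall>\<^sub>F n in sequentially. (model_kern a n (n + k))\<^sup>2 \<le> model_kern a n n" by simp
  qed auto
  then show ?thesis by simp
qed

text \<open>Multiplication by the inner function \<open>\<theta>\<^sub>a\<close> is isometric: the defect is the limit of the
  kernel along the diagonals.\<close>

lemma theta_coeff_correlation:
  assumes "a > 0"
  shows "(\<lambda>i. theta_coeff a i * theta_coeff a (i + k)) sums (if k = 0 then 1 else 0)"
proof -
  have "(\<Sum>i\<le>n. theta_coeff a i * theta_coeff a (i + k)) = (if k = 0 then 1 else 0) - model_kern a n (n + k)" for n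
  proof -
    have "(\<Sum>i\<le>n. theta_coeff a i * theta_coeff a (i + k)) = (\<Sum>i\<le>n. theta_coeff a (n - i) * theta_coeff a (n + k - i))"
      by (rule sum.reindex_bij_witness[of _ "\<lambda>i. n - i" "\<lambda>i. n - i"]) (auto simp: add.commute)
    then show ?thesis by (simp add: model_kern_def)
  qed
  then have "(\<lambda>n. \<Sum>i\<le>n. theta_coeff a i * theta_coeff a (i + k)) \<longlonglongrightarrow> (if k = 0 then 1 else 0) - 0"
    using tendsto_diff[OF tendsto_const model_kern_diagonals_tendsto[OF assms]] by simp
  then show ?thesis by (simp add: sums_def_le)
qed

lemma theta_mat_correlation:
  assumes "a > 0"
  shows "(\<lambda>n. theta_mat a (n + k) j * theta_coeff a n) sums (if j = k then 1 else 0)"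
proof (cases "j \<le> k")
  case True
  have "(\<lambda>n. theta_coeff a n * theta_coeff a (n + (k - j))) sums (if k - j = 0 then 1 else 0)"
    by (rule theta_coeff_correlation[OF assms])
  moreover have "(\<lambda>n. theta_mat a (n + k) j * theta_coeff a n) = (\<lambda>n. theta_coeff a n * theta_coeff a (n + (k - j)))"
    using True by (simp add: theta_mat_def mult.commute)
  moreover have "(k - j = 0) = (j = k)" using True by auto
  ultimately show ?thesis by simp
next
  case False
  define d where "d = j - k"
  have d: "j = k + d" "d > 0" using False by (auto simp: d_def)
  have "(\<lambda>n. theta_mat a (n + d + k) j * theta_coeff a (n + d)) sums 0"
    using theta_coeff_correlation[OF assms, of d] d by (simp add: theta_mat_def)
  then have "(\<lambda>n. theta_mat a (n + k) j * theta_coeff a n) sums (0 + (\<Sum>i<d. theta_mat a (i + k) j * theta_coeff a i))"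
    by (subst (asm) sums_iff_shift) simp
  then show ?thesis using d by (simp add: theta_mat_def)
qed

text \<open>Kernel columns are orthogonal to \<open>z\<^sup>k \<theta>\<^sub>a\<close>, because the shifts of the coefficients of \<open>\<theta>\<^sub>a\<close> are
  orthonormal.\<close>

lemma model_kern_column_orthogonal:
  assumes "a > 0"
  shows "(\<lambda>n. model_kern a (n + k) N * theta_coeff a n) sums 0"
proof -
  have "(\<lambda>n. (if n + k = N then theta_coeff a n else 0) - (\<Sum>j\<le>N. theta_mat a N j * (theta_mat a (n + k) j * theta_coeff a n)))
    sums (theta_mat a N k - (\<Sum>j\<le>N. theta_mat a N j * (if j = k then 1 else 0)))"
  proof (intro sums_diff sums_sum sums_mult theta_mat_correlation assms)
    show "(\<lambda>n. if n + k = N then theta_coeff a n else 0) sums theta_mat a N k"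
    proof (cases "k \<le> N")
      case True
      have "(\<lambda>n. if n = N - k then theta_coeff a n else 0) sums theta_coeff a (N - k)" by (rule sums_single)
      also have "(\<lambda>n. if n = N - k then theta_coeff a n else 0) = (\<lambda>n. if n + k = N then theta_coeff a n else 0)"
        using True by (metis add.commute diff_add_inverse le_add_diff_inverse)
      finally show ?thesis using True by (simp add: theta_mat_def)
    qed (auto simp: theta_mat_def)
  qed
  moreover have "theta_mat a N k - (\<Sum>j\<le>N. theta_mat a N j * (if j = k then 1 else 0)) = 0"
    by (auto simp: theta_mat_def if_distrib cong: if_cong)
  moreover have "(if n + k = N then theta_coeff a n else 0) - (\<Sum>j\<le>N. theta_mat a N j * (theta_mat a (n + k) j * theta_coeff a n)) =
     model_kern a (n + k) N * theta_coeff a n" for n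
    by (subst model_kern_eq_theta_mat[of _ _ N]) (auto simp: left_diff_distrib right_diff_distrib sum_distrib_left mult_ac)
  ultimately show ?thesis by simp
qed

section \<open>Square-summable sequences\<close>

lemma series_Cauchy_Schwarz:
  fixes b :: "nat \<Rightarrow> complex"
  assumes X: "summable X" and Y: "summable Y" and "\<And>j. 0 \<le> X j" and "\<And>j. 0 \<le> Y j"
    and b: "\<And>j. (norm (b j))\<^sup>2 \<le> X j * Y j"
  shows "summable (\<lambda>j. norm (b j))" and "(norm (\<Sum>j. b j))\<^sup>2 \<le> suminf X * suminf Y"
proof -
  have s0: "0 \<le> suminf X" "0 \<le> suminf Y" using assms by (auto intro: suminf_nonneg)
  have bnd: "(\<Sum>j<N. norm (b j)) \<le> sqrt (suminf X * suminf Y)" for N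
  proof (rule real_le_rsqrt)
    have "(\<Sum>j<N. norm (b j))\<^sup>2 \<le> (\<Sum>j<N. sqrt (X j) * sqrt (Y j))\<^sup>2"
      using assms(3,4) b by (intro power_mono sum_mono sum_nonneg) (auto simp: real_le_rsqrt simp flip: real_sqrt_mult)
    also have "\<dots> \<le> (\<Sum>j<N. (sqrt (X j))\<^sup>2) * (\<Sum>j<N. (sqrt (Y j))\<^sup>2)"
      by (rule Cauchy_Schwarz_ineq_sum)
    also have "\<dots> = (\<Sum>j<N. X j) * (\<Sum>j<N. Y j)" using assms(3,4) by simp
    also have "\<dots> \<le> suminf X * suminf Y"
      using assms s0 by (intro mult_mono sum_le_suminf sum_nonneg) auto
    finally show "(\<Sum>j<N. norm (b j))\<^sup>2 \<le> suminf X * suminf Y" .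
  qed
  show sm: "summable (\<lambda>j. norm (b j))"
    by (rule summableI_nonneg_bounded[OF _ bnd]) simp
  have "norm (\<Sum>j. b j) \<le> (\<Sum>j. norm (b j))" by (rule summable_norm[OF sm])
  also have "\<dots> \<le> sqrt (suminf X * suminf Y)" by (rule suminf_le_const[OF sm bnd])
  finally have "(norm (\<Sum>j. b j))\<^sup>2 \<le> (sqrt (suminf X * suminf Y))\<^sup>2" by (intro power_mono) auto
  then show "(norm (\<Sum>j. b j))\<^sup>2 \<le> suminf X * suminf Y" using s0 by simp
qed

definition sq_summable :: "(nat \<Rightarrow> complex) \<Rightarrow> bool" where
  "sq_summable c \<longleftrightarrow> summable (\<lambda>n. (norm (c n))\<^sup>2)"

definition normsq :: "(nat \<Rightarrow> complex) \<Rightarrow> real" where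
  "normsq c = (\<Sum>n. (norm (c n))\<^sup>2)"

definition sprod :: "(nat \<Rightarrow> complex) \<Rightarrow> (nat \<Rightarrow> complex) \<Rightarrow> complex" where
  "sprod u v = (\<Sum>n. u n * cnj (v n))"

lemma normsq_nonneg: "sq_summable c \<Longrightarrow> normsq c \<ge> 0"
  unfolding sq_summable_def normsq_def by (rule suminf_nonneg) auto

lemma sum_le_normsq: "sq_summable c \<Longrightarrow> finite A \<Longrightarrow> (\<Sum>n\<in>A. (norm (c n))\<^sup>2) \<le> normsq c"
  unfolding sq_summable_def normsq_def by (rule sum_le_suminf) auto

lemma sqsumI_bound:
  assumes "\<And>N. (\<Sum>n\<le>N. (norm (c n))\<^sup>2) \<le> B"
  shows "sq_summable c" and "normsq c \<le> B"
proof -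
  have b: "(\<Sum>n<N. (norm (c n))\<^sup>2) \<le> B" for N
  proof -
    have "(\<Sum>n<N. (norm (c n))\<^sup>2) \<le> (\<Sum>n\<le>N. (norm (c n))\<^sup>2)" by (intro sum_mono2) auto
    then show ?thesis using assms[of N] by linarith
  qed
  show s: "sq_summable c" unfolding sq_summable_def by (rule summableI_nonneg_bounded[OF _ b]) auto
  show "normsq c \<le> B" using s suminf_le_const[OF _ b] unfolding sq_summable_def normsq_def by blast
qed

lemma norm_add_sq_le: "(norm (x + y :: complex))\<^sup>2 \<le> 2 * (norm x)\<^sup>2 + 2 * (norm y)\<^sup>2"
proof -
  have "(norm (x + y))\<^sup>2 \<le> (norm x + norm y)\<^sup>2" by (intro power_mono norm_triangle_ineq) auto
  also have "\<dots> \<le> 2 * (norm x)\<^sup>2 + 2 * (norm y)\<^sup>2"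
    using sum_squares_ge_zero[of "norm x - norm y" 0] by (simp add: power2_eq_square algebra_simps)
  finally show ?thesis .
qed

lemma sq_summable_add: assumes "sq_summable u" "sq_summable v" shows "sq_summable (\<lambda>n. u n + v n)"
  unfolding sq_summable_def
proof (rule summable_comparison_test')
  show "summable (\<lambda>n. 2 * (norm (u n))\<^sup>2 + 2 * (norm (v n))\<^sup>2)"
    using assms unfolding sq_summable_def by (intro summable_add summable_mult)
qed (simp add: norm_add_sq_le)

lemma sq_summable_scale: "sq_summable u \<Longrightarrow> sq_summable (\<lambda>n. c * u n)"
  unfolding sq_summable_def by (simp add: norm_mult power_mult_distrib summable_mult)

lemma sq_summable_diff: "sq_summable u \<Longrightarrow> sq_summable v \<Longrightarrow> sq_summable (\<lambda>n. u n - v n)"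
  using sq_summable_add[of u "\<lambda>n. (-1) * v n"] sq_summable_scale[of v "-1"] by simp

lemma sq_summable_0 [simp]: "sq_summable (\<lambda>n. 0)" by (simp add: sq_summable_def)

lemma sq_summable_shift: "sq_summable u \<Longrightarrow> sq_summable (\<lambda>n. u (n + k))"
  unfolding sq_summable_def by (rule summable_ignore_initial_segment)

lemma normsq_shift_le: assumes "sq_summable u" shows "normsq (\<lambda>n. u (n + k)) \<le> normsq u"
proof -
  have "(\<Sum>n\<le>N. (norm (u (n + k)))\<^sup>2) = (\<Sum>n\<in>(\<lambda>n. n + k) ` {..N}. (norm (u n))\<^sup>2)" for N
    by (subst sum.reindex) (auto simp: inj_on_def)
  then show ?thesis using sum_le_normsq[OF assms] by (intro sqsumI_bound(2)) simp
qed

lemma sprod_summable: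
  assumes "sq_summable u" "sq_summable v"
  shows "summable (\<lambda>n. norm (u n * cnj (v n)))" and "summable (\<lambda>n. u n * cnj (v n))"
proof -
  show "summable (\<lambda>n. norm (u n * cnj (v n)))"
    using assms unfolding sq_summable_def
    by (intro series_Cauchy_Schwarz(1)[where X = "\<lambda>n. (norm (u n))\<^sup>2" and Y = "\<lambda>n. (norm (v n))\<^sup>2"])
      (auto simp: norm_mult power_mult_distrib)
  then show "summable (\<lambda>n. u n * cnj (v n))" by (rule summable_norm_cancel)
qed

lemma sprod_Cauchy_Schwarz: "sq_summable u \<Longrightarrow> sq_summable v \<Longrightarrow> (norm (sprod u v))\<^sup>2 \<le> normsq u * normsq v"
  unfolding sprod_def normsq_def sq_summable_def
  by (intro series_Cauchy_Schwarz(2)) (auto simp: norm_mult power_mult_distrib)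

lemma sprod_add_left: "sq_summable u \<Longrightarrow> sq_summable v \<Longrightarrow> sq_summable w \<Longrightarrow> sprod (\<lambda>n. u n + v n) w = sprod u w + sprod v w"
  unfolding sprod_def by (subst suminf_add[OF sprod_summable(2) sprod_summable(2)]) (auto simp: distrib_right)

lemma sprod_diff_left: "sq_summable u \<Longrightarrow> sq_summable v \<Longrightarrow> sq_summable w \<Longrightarrow> sprod (\<lambda>n. u n - v n) w = sprod u w - sprod v w"
  unfolding sprod_def by (subst suminf_diff[OF sprod_summable(2) sprod_summable(2)]) (auto simp: left_diff_distrib)

lemma sprod_scale_left: "sq_summable u \<Longrightarrow> sq_summable w \<Longrightarrow> sprod (\<lambda>n. c * u n) w = c * sprod u w"
  unfolding sprod_def by (subst suminf_mult[OF sprod_summable(2), symmetric]) (auto simp: mult_ac)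

lemma sprod_cnj: "sq_summable u \<Longrightarrow> sq_summable v \<Longrightarrow> sprod v u = cnj (sprod u v)"
  unfolding sprod_def
  using bounded_linear.suminf[OF bounded_linear_cnj sprod_summable(2), of u v] by (simp add: mult.commute)

lemma sprod_diff_right: "sq_summable u \<Longrightarrow> sq_summable v \<Longrightarrow> sq_summable w \<Longrightarrow> sprod w (\<lambda>n. u n - v n) = sprod w u - sprod w v"
  using sprod_diff_left[of u v w] sprod_cnj[of "\<lambda>n. u n - v n" w] sprod_cnj[of u w] sprod_cnj[of v w]
  by (simp add: sq_summable_diff)

lemma sprod_scale_right: "sq_summable u \<Longrightarrow> sq_summable w \<Longrightarrow> sprod w (\<lambda>n. c * u n) = cnj c * sprod w u"
  using sprod_scale_left[of u w c] sprod_cnj[of "\<lambda>n. c * u n" w] sprod_cnj[of u w]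
  by (simp add: sq_summable_scale)

lemma sprod_add_right: "sq_summable u \<Longrightarrow> sq_summable v \<Longrightarrow> sq_summable w \<Longrightarrow> sprod w (\<lambda>n. u n + v n) = sprod w u + sprod w v"
  using sprod_add_left[of u v w] sprod_cnj[of "\<lambda>n. u n + v n" w] sprod_cnj[of u w] sprod_cnj[of v w]
  by (simp add: sq_summable_add)

lemma sprod_self: "sq_summable u \<Longrightarrow> sprod u u = of_real (normsq u)"
  unfolding sprod_def normsq_def sq_summable_def
  by (subst suminf_of_real) (auto simp: complex_norm_square[symmetric])

lemma normsq_eq_0_iff: "sq_summable u \<Longrightarrow> normsq u = 0 \<Longrightarrow> u n = 0"
  unfolding normsq_def sq_summable_def by (subst (asm) suminf_eq_zero_iff) auto

lemma normsq_diff: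
  assumes "sq_summable u" "sq_summable v"
  shows "normsq (\<lambda>n. u n - v n) = normsq u - 2 * Re (sprod u v) + normsq v"
proof -
  have "complex_of_real (normsq (\<lambda>n. u n - v n)) = sprod u u - sprod u v - (sprod v u - sprod v v)"
    using assms by (simp add: sprod_self[symmetric] sq_summable_diff sprod_diff_left sprod_diff_right)
  also have "\<dots> = of_real (normsq u) - sprod u v - (cnj (sprod u v) - of_real (normsq v))"
    using assms by (simp add: sprod_self sprod_cnj[of u v])
  also have "Re \<dots> = normsq u - 2 * Re (sprod u v) + normsq v" by simp
  finally show ?thesis by (metis Re_complex_of_real)
qed

section \<open>The model space as a space of sequences\<close>

text \<open>The sequences of Taylor coefficients of the functions in \<open>K\<^sub>a\<close>: orthogonality to
  \<open>z\<^sup>k \<theta>\<^sub>a\<close> for every \<open>k\<close>.\<close>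

definition model_seqs :: "real \<Rightarrow> (nat \<Rightarrow> complex) set" where
  "model_seqs a = {c. sq_summable c \<and> (\<forall>k. (\<lambda>n. c (n + k) * of_real (theta_coeff a n)) sums 0)}"

definition kern_column :: "real \<Rightarrow> nat \<Rightarrow> nat \<Rightarrow> complex" where
  "kern_column a N n = of_real (model_kern a n N)"

lemma model_seqs_sq_summable: "c \<in> model_seqs a \<Longrightarrow> sq_summable c" by (simp add: model_seqs_def)

lemma model_seqs_add: "u \<in> model_seqs a \<Longrightarrow> v \<in> model_seqs a \<Longrightarrow> (\<lambda>n. u n + v n) \<in> model_seqs a"
  unfolding model_seqs_def using sums_add[where a = 0 and b = 0] by (auto simp: sq_summable_add distrib_right)

lemma model_seqs_scale: "u \<in> model_seqs a \<Longrightarrow> (\<lambda>n. c * u n) \<in> model_seqs a"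
  unfolding model_seqs_def using sums_mult[where c = c and a = 0] by (auto simp: sq_summable_scale mult.assoc)

lemma model_seqs_diff: "u \<in> model_seqs a \<Longrightarrow> v \<in> model_seqs a \<Longrightarrow> (\<lambda>n. u n - v n) \<in> model_seqs a"
  using model_seqs_add[of u a "\<lambda>n. (-1) * v n"] model_seqs_scale[of v a "-1"] by simp

lemma model_seqs_0: "(\<lambda>n. 0) \<in> model_seqs a" by (simp add: model_seqs_def)

lemma model_seqs_sum: "finite A \<Longrightarrow> (\<And>i. i \<in> A \<Longrightarrow> f i \<in> model_seqs a) \<Longrightarrow> (\<lambda>n. \<Sum>i\<in>A. f i n) \<in> model_seqs a"
  by (induction A rule: finite_induct) (auto intro!: model_seqs_add simp: model_seqs_0)

lemma model_seqs_shift: assumes "c \<in> model_seqs a" shows "(\<lambda>n. c (n + k)) \<in> model_seqs a"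
proof -
  have "(\<lambda>n. c (n + i + k) * of_real (theta_coeff a n)) sums 0" for i
    using assms unfolding model_seqs_def by (simp add: add.assoc)
  then show ?thesis using assms sq_summable_shift[of c k] unfolding model_seqs_def by simp
qed

lemma model_seqs_fdiff: "c \<in> model_seqs a \<Longrightarrow> fdiff c \<in> model_seqs a"
  using model_seqs_diff[OF model_seqs_shift[of c a 1]] by (simp add: fdiff_def[abs_def])

lemma model_seqs_fdiff_pow: "c \<in> model_seqs a \<Longrightarrow> (fdiff ^^ m) c \<in> model_seqs a"
  by (induction m) (auto simp: model_seqs_fdiff)

lemma kern_column_normsq: assumes "a > 0" shows "sq_summable (kern_column a N)" and "normsq (kern_column a N) \<le> model_kern a N N"
  using sqsumI_bound[of "kern_column a N" "model_kern a N N"] model_kern_column_sq_le[OF assms]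
  by (auto simp: kern_column_def)

lemma kern_column_in_model_seqs: assumes "a > 0" shows "kern_column a N \<in> model_seqs a"
proof -
  have "(\<lambda>n. complex_of_real (model_kern a (n + k) N * theta_coeff a n)) sums of_real 0" for k
    by (intro sums_of_real model_kern_column_orthogonal assms)
  then show ?thesis using kern_column_normsq(1)[OF assms] by (simp add: model_seqs_def kern_column_def)
qed

lemma model_seqs_theta_mat: assumes "c \<in> model_seqs a" shows "(\<lambda>m. c m * of_real (theta_mat a m j)) sums 0"
proof -
  have "(\<lambda>n. c (n + j) * of_real (theta_mat a (n + j) j)) sums 0"
    using assms by (simp add: model_seqs_def theta_mat_def)
  then have "(\<lambda>m. c m * of_real (theta_mat a m j)) sums (0 + (\<Sum>i<j. c i * of_real (theta_mat a i j)))"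
    by (subst (asm) sums_iff_shift) simp
  then show ?thesis by (simp add: theta_mat_def)
qed

text \<open>An element of the space is annihilated by \<open>\<Theta>\<^sup>*\<close>, hence fixed by \<open>I - \<Theta> \<Theta>\<^sup>*\<close>.\<close>

lemma model_seqs_reproducing:
  assumes "c \<in> model_seqs a"
  shows "(\<lambda>m. of_real (model_kern a n m) * c m) sums c n"
proof -
  have "(\<lambda>m. (if m = n then c m else 0) - (\<Sum>j\<le>n. of_real (theta_mat a n j) * (c m * of_real (theta_mat a m j))))
     sums (c n - (\<Sum>j\<le>n. of_real (theta_mat a n j) * 0))"
    by (intro sums_diff sums_sum sums_mult model_seqs_theta_mat assms sums_single)
  moreover have "(if m = n then c m else 0) - (\<Sum>j\<le>n. of_real (theta_mat a n j) * (c m * of_real (theta_mat a m j))) =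
     of_real (model_kern a n m) * c m" for m
    by (subst model_kern_eq_theta_mat[of _ _ n])
      (auto simp: left_diff_distrib right_diff_distrib sum_distrib_left sum_distrib_right mult_ac)
  ultimately show ?thesis by simp
qed

lemma sprod_kern_column: "a > 0 \<Longrightarrow> c \<in> model_seqs a \<Longrightarrow> sprod c (kern_column a n) = c n"
  unfolding sprod_def using model_seqs_reproducing[of c a n]
  by (simp add: kern_column_def model_kern_sym[of a n] mult.commute sums_iff)

lemma model_seqs_pointwise:
  assumes "a > 0" "c \<in> model_seqs a"
  shows "(norm (c n))\<^sup>2 \<le> model_kern a n n * normsq c"
proof -
  have "(norm (c n))\<^sup>2 \<le> normsq c * normsq (kern_column a n)"
    using sprod_Cauchy_Schwarz[OF model_seqs_sq_summable[OF assms(2)] kern_column_normsq(1)[OF assms(1), of n]]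
    by (simp add: sprod_kern_column[OF assms])
  also have "\<dots> \<le> normsq c * model_kern a n n"
    by (intro mult_left_mono kern_column_normsq assms normsq_nonneg model_seqs_sq_summable[OF assms(2)])
  finally show ?thesis by (simp add: mult.commute)
qed

text \<open>The finite Bernstein inequality passes to the limit because the rows of the kernel reproduce
  elements of the space.\<close>

lemma bernstein_partial:
  assumes a: "a > 0" and c: "c \<in> model_seqs a"
  shows "(\<Sum>n\<le>N. pochhammer (real (Suc n)) m * (norm ((fdiff ^^ m) c n))\<^sup>2) \<le> (2 * a) ^ m * normsq c"
proof -
  define d where "d = (\<lambda>M n. \<Sum>l\<le>M. of_real (model_kern a n l) * c l)"
  have lim: "(\<lambda>M. d M n) \<longlonglongrightarrow> c n" for n
    using model_seqs_reproducing[OF c, of n] by (simp add: d_def sums_def_le)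
  show ?thesis
  proof (rule LIMSEQ_le_const2)
    show "(\<lambda>M. \<Sum>n\<le>N. pochhammer (real (Suc n)) m * (norm ((fdiff ^^ m) (d M) n))\<^sup>2) \<longlonglongrightarrow>
       (\<Sum>n\<le>N. pochhammer (real (Suc n)) m * (norm ((fdiff ^^ m) c n))\<^sup>2)"
      unfolding fdiff_pow_eq_sum by (intro tendsto_intros lim)
    have "(\<Sum>n\<le>N. pochhammer (real (Suc n)) m * (norm ((fdiff ^^ m) (d M) n))\<^sup>2) \<le> (2 * a) ^ m * normsq c" for M
    proof -
      have "(\<Sum>n\<le>N. pochhammer (real (Suc n)) m * (norm ((fdiff ^^ m) (d M) n))\<^sup>2) \<le>
        (2 * a) ^ m * (\<Sum>n\<le>M. (norm (c n))\<^sup>2)"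
        by (rule bernstein_finite_complex[OF a]) (simp add: d_def)
      also have "\<dots> \<le> (2 * a) ^ m * normsq c"
        using a by (intro mult_left_mono sum_le_normsq model_seqs_sq_summable[OF c]) auto
      finally show ?thesis .
    qed
    then show "\<exists>n. \<forall>M\<ge>n. (\<Sum>n\<le>N. pochhammer (real (Suc n)) m * (norm ((fdiff ^^ m) (d M) n))\<^sup>2) \<le> (2 * a) ^ m * normsq c"
      by blast
  qed
qed

lemma pochhammer_Suc_ge_fact: "fact m \<le> pochhammer (real (Suc n)) m"
proof (induction m)
  case (Suc m)
  have "fact (Suc m) = fact m * (1 + real m)" by (simp add: algebra_simps)
  also have "\<dots> \<le> pochhammer (real (Suc n)) m * (real (Suc n) + real m)"
    using Suc by (intro mult_mono) (auto intro: order_trans[OF fact_ge_zero])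
  finally show ?case by (simp add: pochhammer_Suc)
qed simp

lemma pochhammer_Suc_pos: "pochhammer (real (Suc n)) m > 0"
  by (intro pochhammer_pos) auto

section \<open>A local energy controlling all differences\<close>

text \<open>The Bernstein inequalities of all orders are summed into one energy per point. The factor
  \<open>(4a)\<^sup>-\<^sup>j\<close> beats the Bernstein constant \<open>(2a)\<^sup>j\<close>, so the total energy is at most twice the squared norm.\<close>

definition energy_term :: "real \<Rightarrow> (nat \<Rightarrow> complex) \<Rightarrow> nat \<Rightarrow> nat \<Rightarrow> real" where
  "energy_term a c N j = pochhammer (real (Suc N)) j * (norm ((fdiff ^^ j) c N))\<^sup>2 / (4 * a) ^ j"

definition energy :: "real \<Rightarrow> (nat \<Rightarrow> complex) \<Rightarrow> nat \<Rightarrow> real" where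
  "energy a c N = (\<Sum>j. energy_term a c N j)"

lemma energy_term_nonneg: "a > 0 \<Longrightarrow> energy_term a c N j \<ge> 0"
  unfolding energy_term_def using pochhammer_Suc_pos[of N j] by (intro divide_nonneg_nonneg mult_nonneg_nonneg) auto

lemma energy_term_sum:
  assumes a: "a > 0" and c: "c \<in> model_seqs a"
  shows "(\<Sum>n\<le>N. energy_term a c n j) \<le> normsq c * (1/2) ^ j"
proof -
  have "(\<Sum>n\<le>N. energy_term a c n j) =
      (\<Sum>n\<le>N. pochhammer (real (Suc n)) j * (norm ((fdiff ^^ j) c n))\<^sup>2) / (4 * a) ^ j"
    unfolding energy_term_def sum_divide_distrib ..
  also have "\<dots> \<le> (2 * a) ^ j * normsq c / (4 * a) ^ j"
    using a by (intro divide_right_mono bernstein_partial[OF assms]) auto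
  also have "\<dots> = normsq c * ((2 * a) / (4 * a)) ^ j" by (simp only: power_divide) simp
  also have "(2 * a) / (4 * a) = 1 / 2" using a by simp
  finally show ?thesis .
qed

lemma energy_term_summable:
  assumes a: "a > 0" and c: "c \<in> model_seqs a"
  shows "summable (energy_term a c N)"
proof (rule summable_comparison_test')
  show "summable (\<lambda>j. normsq c * (1/2) ^ j)" by (intro summable_mult summable_geometric) auto
  fix j :: nat
  have "energy_term a c N j \<le> (\<Sum>n\<le>N. energy_term a c n j)"
    by (rule member_le_sum) (auto simp: energy_term_nonneg a)
  then show "norm (energy_term a c N j) \<le> normsq c * (1/2) ^ j"
    using energy_term_sum[OF assms, where N = N and j = j] energy_term_nonneg[OF a, of c N j] by simp
qed

lemma energy_nonneg: "a > 0 \<Longrightarrow> c \<in> model_seqs a \<Longrightarrow> energy a c N \<ge> 0"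
  unfolding energy_def by (intro suminf_nonneg energy_term_summable energy_term_nonneg)

lemma energy_sum_le:
  assumes a: "a > 0" and c: "c \<in> model_seqs a"
  shows "(\<Sum>n\<le>N. energy a c n) \<le> 2 * normsq c"
proof -
  have "(\<Sum>n\<le>N. energy a c n) = (\<Sum>j. \<Sum>n\<le>N. energy_term a c n j)"
    unfolding energy_def by (rule suminf_sum[symmetric]) (rule energy_term_summable[OF assms])
  also have "\<dots> \<le> (\<Sum>j. normsq c * (1/2) ^ j)"
    by (intro suminf_le energy_term_sum assms summable_sum energy_term_summable
        summable_mult summable_geometric) auto
  also have "\<dots> = 2 * normsq c" by (subst suminf_mult) (auto simp: suminf_geometric)
  finally show ?thesis .
qed

lemma energy_sum_finite_le:
  assumes a: "a > 0" and c: "c \<in> model_seqs a" and A: "finite A"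
  shows "(\<Sum>n\<in>A. energy a c n) \<le> 2 * normsq c"
proof -
  have "(\<Sum>n\<in>A. energy a c n) \<le> (\<Sum>n\<le>Max A. energy a c n)"
    using A by (intro sum_mono2) (auto simp: energy_nonneg a c)
  then show ?thesis using energy_sum_le[OF a c, of "Max A"] by linarith
qed

definition exp_tail :: "nat \<Rightarrow> real \<Rightarrow> real" where
  "exp_tail m r = (\<Sum>j. r ^ (j + m) / fact (j + m))"

lemma exp_tail_summable: "summable (\<lambda>j. r ^ (j + m) / fact (j + m) :: real)"
  using summable_ignore_initial_segment[OF summable_exp[of r], of m] by (simp add: field_simps)

lemma exp_tail_nonneg: "r \<ge> 0 \<Longrightarrow> exp_tail m r \<ge> 0"
  unfolding exp_tail_def by (intro suminf_nonneg exp_tail_summable) auto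

lemma exp_tail_le:
  assumes "r \<ge> 0"
  shows "exp_tail m r \<le> r ^ m / fact m * exp r"
proof -
  have "exp_tail m r \<le> (\<Sum>j. r ^ m / fact m * (r ^ j / fact j))"
    unfolding exp_tail_def
  proof (intro suminf_le exp_tail_summable summable_mult)
    show "summable (\<lambda>j. r ^ j / fact j)" using exp_tail_summable[of r 0] by simp
    fix j
    have "fact m * fact j \<le> (fact (j + m) :: real)"
      by (metis fact_fact_dvd_fact add.commute dvd_imp_le fact_gt_zero of_nat_fact of_nat_le_iff of_nat_mult)
    then have "r ^ (j + m) / fact (j + m) \<le> r ^ (j + m) / (fact m * fact j)"
      using assms by (intro divide_left_mono) auto
    then show "r ^ (j + m) / fact (j + m) \<le> r ^ m / fact m * (r ^ j / fact j)"
      by (simp add: power_add mult_ac)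
  qed
  also have "\<dots> = r ^ m / fact m * exp r"
    using exp_tail_summable[of r 0] by (subst suminf_mult) (auto simp: exp_def field_simps)
  finally show ?thesis .
qed

text \<open>The common source of all remainder estimates: by the Cauchy--Schwarz inequality, a series in the
  differences at \<open>N\<close> whose coefficients grow no faster than the Bernstein weights allow is
  controlled by the energy at \<open>N\<close>, with a factor that decreases superexponentially in the starting
  index.\<close>

lemma difference_series:
  assumes a: "a > 0" and c: "c \<in> model_seqs a" and C: "C \<ge> 0" and D: "D \<ge> 0"
    and b: "\<And>j. j \<ge> m \<Longrightarrow> (norm (b j :: complex))\<^sup>2 * fact j \<le> D * C ^ j * pochhammer (real (Suc N)) j"
  shows "summable (\<lambda>j. norm (b j * (fdiff ^^ j) c N))"
    and "(norm (\<Sum>j. b (j + m) * (fdiff ^^ (j + m)) c N))\<^sup>2 \<le> D * exp_tail m (4 * a * C) * energy a c N"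
proof -
  let ?X = "\<lambda>j. D * ((4 * a * C) ^ (j + m) / fact (j + m))"
  let ?Y = "\<lambda>j. energy_term a c N (j + m)"
  have X: "summable ?X" "suminf ?X = D * exp_tail m (4 * a * C)"
    unfolding exp_tail_def by (intro summable_mult suminf_mult exp_tail_summable)+
  have Y: "summable ?Y" "suminf ?Y \<le> energy a c N"
  proof -
    show "summable ?Y" by (intro summable_ignore_initial_segment energy_term_summable assms)
    have "energy a c N = suminf ?Y + (\<Sum>j<m. energy_term a c N j)"
      unfolding energy_def by (intro suminf_split_initial_segment energy_term_summable assms)
    then show "suminf ?Y \<le> energy a c N" by (simp add: sum_nonneg energy_term_nonneg a)
  qed
  have le: "(norm (b (j + m) * (fdiff ^^ (j + m)) c N))\<^sup>2 \<le> ?X j * ?Y j" for j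
  proof -
    let ?i = "j + m" let ?p = "pochhammer (real (Suc N)) ?i"
    have "(norm (b ?i))\<^sup>2 \<le> D * C ^ ?i * ?p / fact ?i" using b[of ?i] by (simp add: field_simps)
    then have "(norm (b ?i * (fdiff ^^ ?i) c N))\<^sup>2 \<le> D * C ^ ?i * ?p / fact ?i * (norm ((fdiff ^^ ?i) c N))\<^sup>2"
      unfolding norm_mult power_mult_distrib by (intro mult_right_mono) auto
    also have "\<dots> = ?X j * ?Y j"
      using a by (simp add: energy_term_def power_mult_distrib field_simps)
    finally show ?thesis .
  qed
  have nn: "0 \<le> ?X j" "0 \<le> ?Y j" for j using a C D by (auto simp: energy_term_nonneg)
  note cs = series_Cauchy_Schwarz[where b = "\<lambda>j. b (j + m) * (fdiff ^^ (j + m)) c N", OF X(1) Y(1) nn le]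
  show "summable (\<lambda>j. norm (b j * (fdiff ^^ j) c N))"
    using cs(1) summable_iff_shift[of "\<lambda>j. norm (b j * (fdiff ^^ j) c N)" m] by simp
  have "(norm (\<Sum>j. b (j + m) * (fdiff ^^ (j + m)) c N))\<^sup>2 \<le> D * exp_tail m (4 * a * C) * suminf ?Y"
    using cs(2) X(2) by simp
  also have "\<dots> \<le> D * exp_tail m (4 * a * C) * energy a c N"
    using Y(2) D a C by (intro mult_left_mono mult_nonneg_nonneg exp_tail_nonneg) auto
  finally show "(norm (\<Sum>j. b (j + m) * (fdiff ^^ (j + m)) c N))\<^sup>2 \<le> D * exp_tail m (4 * a * C) * energy a c N" .
qed

section \<open>Representation of bounded functionals\<close>

text \<open>A Riesz representation on the model space. Because the kernel columns span a dense subspace and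
  the kernel is a projection, the values of the functional on the columns are the coefficients of
  the representing element.\<close>

lemma model_seqs_riesz:
  assumes a: "a > 0"
    and add: "\<And>u v. u \<in> model_seqs a \<Longrightarrow> v \<in> model_seqs a \<Longrightarrow> \<psi> (\<lambda>n. u n + v n) = \<psi> u + \<psi> v"
    and scale: "\<And>u c. u \<in> model_seqs a \<Longrightarrow> \<psi> (\<lambda>n. c * u n) = c * \<psi> u"
    and bdd: "\<And>u. u \<in> model_seqs a \<Longrightarrow> (norm (\<psi> u :: complex))\<^sup>2 \<le> C * normsq u"
    and C: "C \<ge> 0"
  shows "\<exists>g\<in>model_seqs a. \<forall>u\<in>model_seqs a. sprod u g = \<psi> u"
proof -
  define G where "G = (\<lambda>p N m. \<Sum>n\<le>N. p n * kern_column a n m)"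
  have GK: "G p N \<in> model_seqs a" for p :: "nat \<Rightarrow> complex" and N
    unfolding G_def by (intro model_seqs_sum model_seqs_scale kern_column_in_model_seqs a) auto
  have \<psi>0: "\<psi> (\<lambda>n. 0) = 0" using scale[OF model_seqs_0, of 0] by simp
  have \<psi>G: "\<psi> (G p N) = (\<Sum>n\<le>N. p n * \<psi> (kern_column a n))" for p N
  proof (induction N)
    case 0 show ?case using scale[OF kern_column_in_model_seqs[OF a], of "p 0" 0] by (simp add: G_def)
  next
    case (Suc N)
    have "G p (Suc N) = (\<lambda>m. G p N m + p (Suc N) * kern_column a (Suc N) m)" by (simp add: G_def)
    then have "\<psi> (G p (Suc N)) = \<psi> (G p N) + p (Suc N) * \<psi> (kern_column a (Suc N))"
      by (simp add: add GK model_seqs_scale kern_column_in_model_seqs a scale)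
    then show ?case by (simp add: Suc)
  qed
  have G_eq: "G p N m = (\<Sum>l\<le>N. of_real (model_kern a m l) * p l)" for p :: "nat \<Rightarrow> complex" and N m
    by (simp add: G_def kern_column_def mult.commute)
  have Gn: "normsq (G p N) \<le> (\<Sum>n\<le>N. (norm (p n))\<^sup>2)" for p N
    using bernstein_finite_complex[OF a, where m = 0 and c = "G p N" and p = p, OF G_eq]
    by (intro sqsumI_bound(2)) simp
  define \<gamma> where "\<gamma> = (\<lambda>n. cnj (\<psi> (kern_column a n)))"
  have \<gamma>2: "sq_summable \<gamma>"
  proof (rule sqsumI_bound(1))
    fix N
    let ?S = "\<Sum>n\<le>N. (norm (\<gamma> n))\<^sup>2"
    have S0: "?S \<ge> 0" by (simp add: sum_nonneg)
    have "\<psi> (G \<gamma> N) = of_real ?S"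
      unfolding \<psi>G by (simp add: \<gamma>_def complex_norm_square mult.commute del: of_real_power)
    then have "norm (\<psi> (G \<gamma> N)) = ?S" using S0 by (simp only: norm_of_real abs_of_nonneg)
    then have "?S\<^sup>2 \<le> C * normsq (G \<gamma> N)" using bdd[OF GK, of \<gamma> N] by simp
    also have "\<dots> \<le> C * ?S" by (intro mult_left_mono Gn C)
    finally have "?S * ?S \<le> C * ?S" by (simp add: power2_eq_square)
    then show "?S \<le> C" using S0 C by (metis mult_le_cancel_right_pos order_le_less)
  qed
  have rep: "sprod u \<gamma> = \<psi> u" if u: "u \<in> model_seqs a" for u
  proof -
    have su: "sq_summable u" using u by (rule model_seqs_sq_summable)
    have ipG: "sprod u (G p N) = (\<Sum>n\<le>N. cnj (p n) * u n)" for p N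
    proof (induction N)
      case 0 show ?case using sprod_scale_right[OF kern_column_normsq(1)[OF a] su] sprod_kern_column[OF a u]
        by (simp add: G_def)
    next
      case (Suc N)
      have "G p (Suc N) = (\<lambda>m. G p N m + p (Suc N) * kern_column a (Suc N) m)" by (simp add: G_def)
      then have "sprod u (G p (Suc N)) = sprod u (G p N) + cnj (p (Suc N)) * u (Suc N)"
        by (simp add: sprod_add_right sq_summable_scale kern_column_normsq(1) a model_seqs_sq_summable[OF GK] su sprod_scale_right sprod_kern_column u)
      then show ?case by (simp add: Suc)
    qed
    have dn: "normsq (\<lambda>n. u n - G u N n) \<le> normsq u - (\<Sum>n\<le>N. (norm (u n))\<^sup>2)" for N
    proof -
      have "sprod u (G u N) = of_real (\<Sum>n\<le>N. (norm (u n))\<^sup>2)"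
        unfolding ipG by (simp add: complex_norm_square mult.commute del: of_real_power)
      then show ?thesis using normsq_diff[OF su model_seqs_sq_summable[OF GK], of u N] Gn[of u N] by simp
    qed
    have "(\<lambda>N. C * (normsq u - (\<Sum>n\<le>N. (norm (u n))\<^sup>2))) \<longlonglongrightarrow> C * (normsq u - normsq u)"
      using su unfolding sq_summable_def normsq_def by (intro tendsto_intros summable_LIMSEQ')
    then have lim0: "(\<lambda>N. C * (normsq u - (\<Sum>n\<le>N. (norm (u n))\<^sup>2))) \<longlonglongrightarrow> 0" by simp
    have "(\<lambda>N. (norm (\<psi> u - \<psi> (G u N)))\<^sup>2) \<longlonglongrightarrow> 0"
    proof (rule real_tendsto_sandwich[OF _ _ tendsto_const lim0])
      have "(norm (\<psi> u - \<psi> (G u N)))\<^sup>2 \<le> C * (normsq u - (\<Sum>n\<le>N. (norm (u n))\<^sup>2))" for N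
      proof -
        have "\<psi> (\<lambda>n. u n - G u N n) = \<psi> u - \<psi> (G u N)"
          using add[OF u model_seqs_scale[OF GK, of "-1" u N]] scale[OF GK, of "-1" u N] by simp
        then have "(norm (\<psi> u - \<psi> (G u N)))\<^sup>2 \<le> C * normsq (\<lambda>n. u n - G u N n)"
          using bdd[OF model_seqs_diff[OF u GK], of u N] by simp
        also have "\<dots> \<le> C * (normsq u - (\<Sum>n\<le>N. (norm (u n))\<^sup>2))" by (intro mult_left_mono dn C)
        finally show ?thesis .
      qed
      then show "\<forall>\<^sub>F N in sequentially. (norm (\<psi> u - \<psi> (G u N)))\<^sup>2 \<le> C * (normsq u - (\<Sum>n\<le>N. (norm (u n))\<^sup>2))"
        by simp
    qed auto
    then have "(\<lambda>N. \<psi> u - \<psi> (G u N)) \<longlonglongrightarrow> 0" by (simp add: tendsto_norm_zero_iff)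
    from tendsto_diff[OF tendsto_const[of "\<psi> u"] this] have "(\<lambda>N. \<psi> (G u N)) \<longlonglongrightarrow> \<psi> u" by simp
    moreover have "(\<lambda>N. \<psi> (G u N)) \<longlonglongrightarrow> sprod u \<gamma>"
      unfolding \<psi>G sprod_def using summable_LIMSEQ'[OF sprod_summable(2)[OF su \<gamma>2]] by (simp add: \<gamma>_def)
    ultimately show ?thesis using LIMSEQ_unique by blast
  qed
  have "\<gamma> \<in> model_seqs a"
  proof -
    have "(\<lambda>n. \<gamma> (n + k) * of_real (theta_coeff a n)) sums 0" for k
    proof -
      let ?p = "\<lambda>n. complex_of_real (theta_mat a n k)"
      let ?s = "\<lambda>N. \<Sum>n\<le>N. (theta_mat a n k)\<^sup>2"
      have s1: "?s \<longlonglongrightarrow> 1"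
      proof -
        have "(\<lambda>n. (theta_mat a (n + k) k)\<^sup>2) sums 1"
          using theta_mat_correlation[OF a, of k k] by (simp add: theta_mat_def power2_eq_square)
        then have "(\<lambda>n. (theta_mat a n k)\<^sup>2) sums (1 + (\<Sum>i<k. (theta_mat a i k)\<^sup>2))"
          by (subst (asm) sums_iff_shift) simp
        then show ?thesis by (simp add: theta_mat_def sums_def_le)
      qed
      \<comment> \<open>The truncations of \<open>z\<^sup>k \<theta>\<^sub>a\<close> have norm tending to \<open>1\<close>, and so do their components along \<open>z\<^sup>k \<theta>\<^sub>a\<close>; their projections to the model space vanish in the limit.\<close>
      have Gq: "normsq (G ?p N) \<le> ?s N - (?s N)\<^sup>2" if "k \<le> N" for N
      proof (rule sqsumI_bound(2))
        fix M
        let ?d = "\<lambda>m. \<Sum>l\<le>N. model_kern a m l * theta_mat a l k"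
        have "G ?p N m = of_real (?d m)" for m by (simp add: G_eq)
        then have "(\<Sum>n\<le>M. (norm (G ?p N n))\<^sup>2) = (\<Sum>n\<le>M. (?d n)\<^sup>2)" by (simp del: of_real_sum of_real_mult)
        also have "\<dots> \<le> (\<Sum>n\<le>N. \<Sum>l\<le>N. model_kern a n l * theta_mat a l k * theta_mat a n k)"
          using bernstein_finite[OF a, where c = ?d and p = "\<lambda>l. theta_mat a l k" and m = 0 and N' = N and N = M] by simp
        also have "\<dots> = ?s N - (\<Sum>j\<le>N. (\<Sum>n\<le>N. theta_mat a n j * theta_mat a n k)\<^sup>2)" by (rule model_kern_form)
        also have "\<dots> \<le> ?s N - (\<Sum>n\<le>N. theta_mat a n k * theta_mat a n k)\<^sup>2"
          using that member_le_sum[of k "{..N}" "\<lambda>j. (\<Sum>n\<le>N. theta_mat a n j * theta_mat a n k)\<^sup>2"] by simp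
        finally show "(\<Sum>n\<le>M. (norm (G ?p N n))\<^sup>2) \<le> ?s N - (?s N)\<^sup>2"
          by (simp only: power2_eq_square)
      qed
      have "(\<lambda>N. C * (?s N - (?s N)\<^sup>2)) \<longlonglongrightarrow> C * (1 - 1\<^sup>2)" by (intro tendsto_intros s1)
      then have lim0: "(\<lambda>N. C * (?s N - (?s N)\<^sup>2)) \<longlonglongrightarrow> 0" by simp
      have "(\<lambda>N. (norm (\<psi> (G ?p N)))\<^sup>2) \<longlonglongrightarrow> 0"
      proof (rule real_tendsto_sandwich[OF _ _ tendsto_const lim0])
        show "\<forall>\<^sub>F N in sequentially. (norm (\<psi> (G ?p N)))\<^sup>2 \<le> C * (?s N - (?s N)\<^sup>2)"
          using eventually_ge_at_top[of k]
        proof eventually_elim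
          case (elim N)
          show ?case using order_trans[OF bdd[OF GK] mult_left_mono[OF Gq[OF elim] C]] .
        qed
      qed auto
      then have "(\<lambda>N. \<psi> (G ?p N)) \<longlonglongrightarrow> 0" by (simp add: tendsto_norm_zero_iff)
      then have "(\<lambda>n. ?p n * \<psi> (kern_column a n)) sums 0" unfolding \<psi>G by (simp add: sums_def_le)
      then have "(\<lambda>n. cnj (?p n * \<psi> (kern_column a n))) sums cnj 0" by (subst sums_cnj)
      then have "(\<lambda>n. \<gamma> n * ?p n) sums 0" by (simp add: \<gamma>_def mult.commute)
      then have "(\<lambda>n. \<gamma> (n + k) * ?p (n + k)) sums (0 - (\<Sum>i<k. \<gamma> i * ?p i))"
        by (subst sums_iff_shift') 
      then show ?thesis by (simp add: theta_mat_def)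
    qed
    then show ?thesis using \<gamma>2 by (simp add: model_seqs_def)
  qed
  then show ?thesis using rep by blast
qed

section \<open>Newton interpolation of Taylor coefficients\<close>

text \<open>The Newton series started at \<open>N\<close>, with \<open>s\<close> measured from \<open>N\<close>: it interpolates \<open>c\<close> at the
  integers \<open>N + s\<close>.\<close>

definition newton :: "(nat \<Rightarrow> complex) \<Rightarrow> nat \<Rightarrow> real \<Rightarrow> complex" where
  "newton c N s = (\<Sum>j. of_real (s gchoose j) * (fdiff ^^ j) c N)"

lemma gbinomial_Suc_mult: "((s::real) gchoose Suc j) = (s gchoose j) * (s - real j) / real (Suc j)"
  by (simp add: gbinomial_prod_rev field_simps)

text \<open>Factor by factor, \<open>(s - l)\<^sup>2 \<le> C (N + 1 + l) (l + 1)\<close>. The weight \<open>(N+1)\<^sub>j\<close> is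
  the one of the Bernstein inequality, so the range \<open>s = O(sqrt N)\<close> is where the Newton series
  started at \<open>N\<close> is controlled by the energy at \<open>N\<close>.\<close>

lemma gbinomial_sq_bound:
  assumes "s \<ge> 0" and "s\<^sup>2 \<le> C * real (Suc N)" and "C \<ge> 1"
  shows "(s gchoose j)\<^sup>2 * fact j \<le> C ^ j * pochhammer (real (Suc N)) j"
proof (induction j)
  case (Suc j)
  have "(s - real j)\<^sup>2 \<le> C * ((real (Suc N) + real j) * real (Suc j))"
  proof (cases "s \<ge> real j")
    case True
    then have "(s - real j)\<^sup>2 \<le> s\<^sup>2" by (intro power_mono) auto
    also have "\<dots> \<le> C * real (Suc N)" by (rule assms)
    also have "\<dots> \<le> C * ((real (Suc N) + real j) * real (Suc j))"
      using assms(3) by (intro mult_left_mono) (auto simp: algebra_simps)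
    finally show ?thesis .
  next
    case False
    then have "(s - real j)\<^sup>2 \<le> (real j)\<^sup>2" using assms(1) abs_le_square_iff[of "s - real j" "real j"] by auto
    also have "\<dots> \<le> 1 * ((real (Suc N) + real j) * real (Suc j))"
      by (simp add: power2_eq_square algebra_simps)
    also have "\<dots> \<le> C * ((real (Suc N) + real j) * real (Suc j))"
      using assms(3) by (intro mult_right_mono) auto
    finally show ?thesis .
  qed
  then have step: "(s - real j)\<^sup>2 / real (Suc j) \<le> C * (real (Suc N) + real j)"
    by (simp add: divide_le_eq mult_ac del: of_nat_Suc)
  have "(s gchoose Suc j)\<^sup>2 * fact (Suc j) = ((s gchoose j)\<^sup>2 * fact j) * ((s - real j)\<^sup>2 / real (Suc j))"
  proof -
    have "k > 0 \<Longrightarrow> (g * d / k)\<^sup>2 * (k * f) = (g\<^sup>2 * f) * (d\<^sup>2 / k)" for k g d f :: real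
      by (simp add: power2_eq_square field_simps)
    from this[of "real (Suc j)"] show ?thesis unfolding gbinomial_Suc_mult fact_Suc by simp
  qed
  also have "\<dots> \<le> (C ^ j * pochhammer (real (Suc N)) j) * (C * (real (Suc N) + real j))"
    using assms(3) pochhammer_Suc_pos[of N j] by (intro mult_mono[OF Suc step]) auto
  finally show ?case by (simp add: pochhammer_Suc mult_ac)
qed simp

lemma newton_summable:
  assumes "a > 0" "c \<in> model_seqs a" "s \<ge> 0"
  shows "summable (\<lambda>j. norm (of_real (s gchoose j) * (fdiff ^^ j) c N))"
proof (rule difference_series(1)[OF assms(1,2), where C = "1 + s\<^sup>2" and D = 1 and m = 0])
  have "s\<^sup>2 \<le> (1 + s\<^sup>2) * real (Suc N)" by (simp add: algebra_simps)
  then show "(norm (complex_of_real (s gchoose j)))\<^sup>2 * fact j \<le>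
      1 * (1 + s\<^sup>2) ^ j * pochhammer (real (Suc N)) j" for j
    using gbinomial_sq_bound[OF assms(3), of "1 + s\<^sup>2" N j] by simp
qed auto

lemma newton_remainder:
  assumes "a > 0" "c \<in> model_seqs a" "s \<ge> 0" "s\<^sup>2 \<le> C * real (Suc N)" "C \<ge> 1"
  shows "(norm (newton c N s - (\<Sum>j<m. of_real (s gchoose j) * (fdiff ^^ j) c N)))\<^sup>2
     \<le> exp_tail m (4 * a * C) * energy a c N"
proof -
  have "newton c N s - (\<Sum>j<m. of_real (s gchoose j) * (fdiff ^^ j) c N) =
     (\<Sum>j. of_real (s gchoose (j + m)) * (fdiff ^^ (j + m)) c N)"
    unfolding newton_def
    using suminf_split_initial_segment[OF summable_norm_cancel[OF newton_summable[OF assms(1-3), of N]], of m] by simp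
  then show ?thesis
    using difference_series(2)[OF assms(1,2), where C = C and D = 1 and m = m and N = N and
        b = "\<lambda>j. of_real (s gchoose j)"] gbinomial_sq_bound[OF assms(3-5)] assms(5) by simp
qed

lemma newton_bound:
  assumes "a > 0" "c \<in> model_seqs a" "s \<ge> 0" "s\<^sup>2 \<le> C * real (Suc N)" "C \<ge> 1"
  shows "(norm (newton c N s))\<^sup>2 \<le> exp (4 * a * C) * energy a c N"
proof -
  have "exp_tail 0 (4 * a * C) \<le> exp (4 * a * C)" using exp_tail_le[of "4 * a * C" 0] assms by simp
  then have "exp_tail 0 (4 * a * C) * energy a c N \<le> exp (4 * a * C) * energy a c N"
    by (intro mult_right_mono energy_nonneg assms)
  then show ?thesis using newton_remainder[OF assms, of 0] by simp
qed

lemma newton_at_0: "newton c N 0 = c N"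
proof -
  have "(\<lambda>j. of_real ((0::real) gchoose j) * (fdiff ^^ j) c N) = (\<lambda>j. if j = 0 then c N else 0)"
    by (auto simp: fun_eq_iff gbinomial_0_left)
  then show ?thesis unfolding newton_def
    using sums_unique[OF sums_single[of 0 "\<lambda>_. c N"]] by simp
qed

lemma fdiff_pow_Suc_eq: "(fdiff ^^ j) c (Suc N) = (fdiff ^^ j) c N + (fdiff ^^ Suc j) c N"
  by (simp add: fdiff_def)

text \<open>Pascal's rule for the binomial coefficients.\<close>

lemma newton_Suc:
  assumes "a > 0" "c \<in> model_seqs a" "s \<ge> 0"
  shows "newton c N (s + 1) = newton c (Suc N) s"
proof -
  let ?b = "\<lambda>s j. complex_of_real (s gchoose j)" and ?d = "\<lambda>j. (fdiff ^^ j) c N"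
  note sm = summable_norm_cancel[OF newton_summable[OF assms(1,2)]]
  have s0: "summable (\<lambda>j. ?b s j * ?d j)" by (rule sm[OF assms(3)])
  have s1: "summable (\<lambda>j. ?b (s + 1) j * ?d j)" using assms(3) by (intro sm) auto
  have s2: "summable (\<lambda>j. ?b s j * (fdiff ^^ j) c (Suc N))" by (rule sm[OF assms(3)])
  have s3: "summable (\<lambda>j. ?b s j * ?d (Suc j))"
  proof -
    have "(\<lambda>j. ?b s j * ?d (Suc j)) = (\<lambda>j. ?b s j * (fdiff ^^ j) c (Suc N) - ?b s j * ?d j)"
      unfolding fdiff_pow_Suc_eq by (simp add: algebra_simps)
    then show ?thesis using summable_diff[OF s2 s0] by simp
  qed
  have s4: "summable (\<lambda>j. ?b s (Suc j) * ?d (Suc j))"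
    using s0 by (subst summable_Suc_iff)
  have "newton c N (s + 1) = ?d 0 + (\<Sum>j. ?b (s + 1) (Suc j) * ?d (Suc j))"
    using suminf_split_head[OF s1] unfolding newton_def by simp
  also have "(\<Sum>j. ?b (s + 1) (Suc j) * ?d (Suc j)) =
     (\<Sum>j. ?b s j * ?d (Suc j) + ?b s (Suc j) * ?d (Suc j))"
    by (simp only: gbinomial_Suc_Suc of_real_add distrib_right)
  also have "\<dots> = (\<Sum>j. ?b s j * ?d (Suc j)) + (\<Sum>j. ?b s (Suc j) * ?d (Suc j))"
    by (rule suminf_add[OF s3 s4, symmetric])
  also have "(\<Sum>j. ?b s (Suc j) * ?d (Suc j)) = (\<Sum>j. ?b s j * ?d j) - ?d 0"
    using suminf_split_head[OF s0] by simp
  finally have "newton c N (s + 1) = (\<Sum>j. ?b s j * ?d (Suc j)) + (\<Sum>j. ?b s j * ?d j)" by simp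
  also have "\<dots> = (\<Sum>j. ?b s j * ?d (Suc j) + ?b s j * ?d j)" by (rule suminf_add[OF s3 s0])
  also have "\<dots> = (\<Sum>j. ?b s j * (fdiff ^^ j) c (Suc N))"
    unfolding fdiff_pow_Suc_eq distrib_left by (simp only: add.commute)
  finally show ?thesis by (simp add: newton_def)
qed

text \<open>All Newton series of \<open>c\<close> represent one interpolating function, whatever integer they start from.\<close>

lemma newton_base:
  assumes "a > 0" "c \<in> model_seqs a" "s \<ge> 0"
  shows "newton c M (real N + s) = newton c (M + N) s"
  using assms(3)
proof (induction N arbitrary: s)
  case (Suc N)
  have "newton c M (real (Suc N) + s) = newton c (M + N) (s + 1)"
    using Suc.IH[of "s + 1"] Suc.prems by (simp add: add_ac)
  then show ?case using newton_Suc[OF assms(1,2) Suc.prems] by simp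
qed simp

lemma newton_nat: "a > 0 \<Longrightarrow> c \<in> model_seqs a \<Longrightarrow> newton c 0 (real N) = c N"
  using newton_base[of a c 0 0 N] by (simp add: newton_at_0)

section \<open>The resolvent of the backward shift on the model space\<close>

text \<open>The solution \<open>(w - S\<^sup>*)\<^sup>-\<^sup>1 u\<close> for the backward shift \<open>S\<^sup>* = 1 + \<Delta>\<close>, expanded in the difference
  operator \<open>\<Delta>\<close>, which is quasinilpotent on the model space.\<close>

definition bshift_res :: "complex \<Rightarrow> (nat \<Rightarrow> complex) \<Rightarrow> nat \<Rightarrow> complex" where
  "bshift_res w u n = (\<Sum>j. inverse (w - 1) ^ Suc j * (fdiff ^^ j) u n)"

lemma half_circle_coeff_bound:
  assumes "norm (w - 1 :: complex) = 1/2"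
  shows "(norm (inverse (w - 1) ^ Suc j))\<^sup>2 * fact j \<le> 4 * 4 ^ j * pochhammer (real (Suc N)) j"
proof -
  have "norm (inverse (w - 1)) = 2" unfolding norm_inverse assms by simp
  then have "norm (inverse (w - 1) ^ Suc j) = 2 ^ Suc j" by (simp only: norm_power)
  then have "(norm (inverse (w - 1) ^ Suc j))\<^sup>2 = 4 * 4 ^ j"
    by (simp add: power2_eq_square flip: power_mult_distrib)
  then show ?thesis using pochhammer_Suc_ge_fact[of j N] by simp
qed

lemma bshift_res_summable:
  assumes "a > 0" "u \<in> model_seqs a" "norm (w - 1) = 1/2"
  shows "summable (\<lambda>j. norm (inverse (w - 1) ^ Suc j * (fdiff ^^ j) u n))"
  by (rule difference_series(1)[OF assms(1,2), where C = 4 and D = 4 and m = 0])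
    (use half_circle_coeff_bound[OF assms(3)] in auto)

lemma bshift_res_tail:
  assumes "a > 0" "u \<in> model_seqs a" "norm (w - 1) = 1/2"
  shows "(norm (bshift_res w u n - (\<Sum>j<m. inverse (w - 1) ^ Suc j * (fdiff ^^ j) u n)))\<^sup>2
    \<le> 4 * exp_tail m (16 * a) * energy a u n"
proof -
  have "bshift_res w u n - (\<Sum>j<m. inverse (w - 1) ^ Suc j * (fdiff ^^ j) u n) =
    (\<Sum>j. inverse (w - 1) ^ Suc (j + m) * (fdiff ^^ (j + m)) u n)"
    unfolding bshift_res_def
    using suminf_split_initial_segment[OF summable_norm_cancel[OF bshift_res_summable[OF assms, of n]], of m] by simp
  then show ?thesis
    using difference_series(2)[OF assms(1,2), where C = 4 and D = 4 and m = m and N = n and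
        b = "\<lambda>j. inverse (w - 1) ^ Suc j"] half_circle_coeff_bound[OF assms(3)] by simp
qed

lemma exp_tail_tendsto: assumes "r \<ge> 0" shows "(\<lambda>m. exp_tail m r) \<longlonglongrightarrow> 0"
proof (rule real_tendsto_sandwich[OF _ _ tendsto_const])
  have "(\<lambda>m. r ^ m / fact m) \<longlonglongrightarrow> 0"
    using summable_LIMSEQ_zero[OF exp_tail_summable[of r 0]] by simp
  from tendsto_mult_left_zero[OF this] show "(\<lambda>m. r ^ m / fact m * exp r) \<longlonglongrightarrow> 0" .
  show "\<forall>\<^sub>F m in sequentially. exp_tail m r \<le> r ^ m / fact m * exp r"
    by (intro always_eventually allI exp_tail_le assms)
qed (use assms in \<open>auto simp: exp_tail_nonneg\<close>)

text \<open>The partial sums lie in the space, and the energy bounds their distance to the limit in norm, so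
  the orthogonality relations survive.\<close>

lemma bshift_res_in_model_seqs:
  assumes a: "a > 0" and u: "u \<in> model_seqs a" and w: "norm (w - 1) = 1/2"
  shows "bshift_res w u \<in> model_seqs a"
proof -
  define P where "P = (\<lambda>m n. \<Sum>j<m. inverse (w - 1) ^ Suc j * (fdiff ^^ j) u n)"
  have P: "P m \<in> model_seqs a" for m unfolding P_def
    by (intro model_seqs_sum model_seqs_scale model_seqs_fdiff_pow u) auto
  define D where "D = (\<lambda>m n. bshift_res w u n - P m n)"
  have Dsum: "(\<Sum>n\<le>N. (norm (D m n))\<^sup>2) \<le> 8 * exp_tail m (16 * a) * normsq u" for m N
  proof -
    have "(\<Sum>n\<le>N. (norm (D m n))\<^sup>2) \<le> (\<Sum>n\<le>N. 4 * exp_tail m (16 * a) * energy a u n)"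
      unfolding D_def P_def by (intro sum_mono bshift_res_tail assms)
    also have "\<dots> = 4 * exp_tail m (16 * a) * (\<Sum>n\<le>N. energy a u n)" by (simp add: sum_distrib_left)
    also have "\<dots> \<le> 4 * exp_tail m (16 * a) * (2 * normsq u)"
      using a by (intro mult_left_mono energy_sum_le assms mult_nonneg_nonneg exp_tail_nonneg) auto
    finally show ?thesis by simp
  qed
  note D = sqsumI_bound[of "D _", OF Dsum]
  have sq: "sq_summable (bshift_res w u)"
    using sq_summable_add[OF D(1)[of 0] model_seqs_sq_summable[OF P[of 0]]] by (simp add: D_def)
  have t2: "sq_summable (\<lambda>n. of_real (theta_coeff a n))" "normsq (\<lambda>n. of_real (theta_coeff a n)) = 1"
    using theta_coeff_correlation[OF a, of 0] unfolding sq_summable_def normsq_def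
    by (auto simp: power2_eq_square sums_iff)
  have "(\<lambda>n. bshift_res w u (n + k) * of_real (theta_coeff a n)) sums 0" for k
  proof -
    let ?s = "\<Sum>n. bshift_res w u (n + k) * of_real (theta_coeff a n)"
    have sm: "summable (\<lambda>n. bshift_res w u (n + k) * of_real (theta_coeff a n))"
      using sprod_summable(2)[OF sq_summable_shift[OF sq, of k] t2(1)] by simp
    have "(norm ?s)\<^sup>2 \<le> 8 * exp_tail m (16 * a) * normsq u" for m
    proof -
      have "?s = (\<Sum>n. bshift_res w u (n + k) * of_real (theta_coeff a n) - P m (n + k) * of_real (theta_coeff a n))"
        using P[of m] sm unfolding model_seqs_def by (subst suminf_diff[symmetric]) (auto simp: sums_iff)
      also have "\<dots> = sprod (\<lambda>n. D m (n + k)) (\<lambda>n. of_real (theta_coeff a n))"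
        unfolding sprod_def D_def by (simp add: left_diff_distrib)
      finally have "(norm ?s)\<^sup>2 \<le> normsq (\<lambda>n. D m (n + k)) * 1"
        using sprod_Cauchy_Schwarz[OF sq_summable_shift[OF D(1)[of m], of k] t2(1)] t2(2) by simp
      also have "\<dots> \<le> 8 * exp_tail m (16 * a) * normsq u"
        using normsq_shift_le[OF D(1), of m k] D(2)[of m] by simp
      finally show ?thesis .
    qed
    moreover have "(\<lambda>m. 8 * exp_tail m (16 * a) * normsq u) \<longlonglongrightarrow> 8 * 0 * normsq u"
      using a by (intro tendsto_intros exp_tail_tendsto) auto
    ultimately have "(norm ?s)\<^sup>2 \<le> 8 * 0 * normsq u"
      by (intro LIMSEQ_le_const) auto
    then show ?thesis using sm by (simp add: sums_iff)
  qed
  then show ?thesis using sq by (simp add: model_seqs_def)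
qed

lemma inverse_mult_cancel_half:
  assumes "norm (w - 1 :: complex) = 1/2"
  shows "(w - 1) * (inverse (w - 1) ^ Suc j * x) = inverse (w - 1) ^ j * x"
proof -
  have "w - 1 \<noteq> 0" using assms by auto
  then have "(w - 1) * inverse (w - 1) = 1" by (rule right_inverse)
  then show ?thesis unfolding power_Suc by (metis mult.assoc mult_1)
qed

lemma bshift_res_right:
  assumes a: "a > 0" and u: "u \<in> model_seqs a" and w: "norm (w - 1) = 1/2"
  shows "w * bshift_res w u n - bshift_res w u (Suc n) = u n"
proof -
  let ?i = "inverse (w - 1)"
  note sm = summable_norm_cancel[OF bshift_res_summable[OF a u w]]
  have "bshift_res w u (Suc n) - bshift_res w u n = (\<Sum>j. ?i ^ Suc j * (fdiff ^^ Suc j) u n)"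
    unfolding bshift_res_def
    by (subst suminf_diff[OF sm sm]) (simp add: fdiff_def right_diff_distrib)
  moreover have "(w - 1) * bshift_res w u n = (\<Sum>j. ?i ^ j * (fdiff ^^ j) u n)"
    unfolding bshift_res_def
    by (subst suminf_mult[OF sm, symmetric]) (simp only: inverse_mult_cancel_half[OF w])
  moreover have "summable (\<lambda>j. ?i ^ j * (fdiff ^^ j) u n)"
    using summable_mult[OF sm, of "w - 1" n] by (simp only: inverse_mult_cancel_half[OF w])
  then have "(\<Sum>j. ?i ^ j * (fdiff ^^ j) u n) = u n + (\<Sum>j. ?i ^ Suc j * (fdiff ^^ Suc j) u n)"
    using suminf_split_head[of "\<lambda>j. ?i ^ j * (fdiff ^^ j) u n"] by simp
  ultimately show ?thesis by (simp add: algebra_simps)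
qed

lemma fdiff_pow_scale: "(fdiff ^^ j) (\<lambda>n. c * u n :: complex) n = c * (fdiff ^^ j) u n"
  by (induction j arbitrary: n) (auto simp: fdiff_def right_diff_distrib)

lemma fdiff_pow_add: "(fdiff ^^ j) (\<lambda>n. u n + v n :: complex) n = (fdiff ^^ j) u n + (fdiff ^^ j) v n"
  by (induction j arbitrary: n) (auto simp: fdiff_def)

lemma fdiff_pow_shift: "(fdiff ^^ j) (\<lambda>n. u (Suc n)) n = (fdiff ^^ j) u (Suc n)"
  by (induction j arbitrary: n) (auto simp: fdiff_def)

lemma bshift_res_add:
  assumes "a > 0" "u \<in> model_seqs a" "v \<in> model_seqs a" "norm (w - 1) = 1/2"
  shows "bshift_res w (\<lambda>n. u n + v n) n = bshift_res w u n + bshift_res w v n"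
  unfolding bshift_res_def using assms
  by (subst suminf_add[OF summable_norm_cancel[OF bshift_res_summable] summable_norm_cancel[OF bshift_res_summable]])
    (auto simp: fdiff_pow_add distrib_left)

lemma bshift_res_scale:
  assumes "a > 0" "u \<in> model_seqs a" "norm (w - 1) = 1/2"
  shows "bshift_res w (\<lambda>n. c * u n) n = c * bshift_res w u n"
  unfolding bshift_res_def using assms
  by (subst suminf_mult[OF summable_norm_cancel[OF bshift_res_summable], symmetric])
    (auto simp: fdiff_pow_scale mult_ac)

lemma bshift_res_left:
  assumes a: "a > 0" and u: "u \<in> model_seqs a" and w: "norm (w - 1) = 1/2"
  shows "bshift_res w (\<lambda>n. w * u n - u (Suc n)) n = u n"
proof -
  have sh: "(\<lambda>n. u (Suc n)) \<in> model_seqs a" using model_seqs_shift[OF u, of 1] by simp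
  have eq: "(\<lambda>n. w * u n - u (Suc n)) = (\<lambda>n. w * u n + (-1) * u (Suc n))" by simp
  have "bshift_res w (\<lambda>n. w * u n - u (Suc n)) n =
      w * bshift_res w u n + (-1) * bshift_res w (\<lambda>n. u (Suc n)) n"
    unfolding eq by (subst bshift_res_add[OF a model_seqs_scale[OF u] model_seqs_scale[OF sh] w])
      (simp only: bshift_res_scale[OF a u w] bshift_res_scale[OF a sh w])
  also have "bshift_res w (\<lambda>n. u (Suc n)) n = bshift_res w u (Suc n)"
    unfolding bshift_res_def fdiff_pow_shift ..
  finally show ?thesis using bshift_res_right[OF assms, of n] by simp
qed

lemma bshift_res_bounded:
  assumes a: "a > 0" and u: "u \<in> model_seqs a" and w: "norm (w - 1) = 1/2"
  shows "(norm (bshift_res w u 0))\<^sup>2 \<le> 8 * exp_tail 0 (16 * a) * normsq u"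
proof -
  have "(norm (bshift_res w u 0))\<^sup>2 \<le> 4 * exp_tail 0 (16 * a) * energy a u 0"
    using bshift_res_tail[OF assms, of 0 0] by simp
  also have "\<dots> \<le> 4 * exp_tail 0 (16 * a) * (2 * normsq u)"
    using energy_sum_le[OF a u, of 0] a by (intro mult_left_mono mult_nonneg_nonneg exp_tail_nonneg) auto
  finally show ?thesis by simp
qed

section \<open>Multiplication by the inner function\<close>

definition inner_mult :: "real \<Rightarrow> (nat \<Rightarrow> complex) \<Rightarrow> nat \<Rightarrow> complex" where
  "inner_mult a g n = (\<Sum>j\<le>n. of_real (theta_mat a n j) * g j)"

lemma theta_mat_orthonormal:
  assumes "a > 0"
  shows "(\<lambda>n. theta_mat a n j * theta_mat a n k) sums (if j = k then 1 else 0)"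
proof -
  have "(\<lambda>n. theta_mat a (n + k) j * theta_mat a (n + k) k) sums (if j = k then 1 else 0)"
    using theta_mat_correlation[OF assms, of k j] by (simp add: theta_mat_def)
  then have "(\<lambda>n. theta_mat a n j * theta_mat a n k) sums ((if j = k then 1 else 0) + (\<Sum>i<k. theta_mat a i j * theta_mat a i k))"
    by (subst (asm) sums_iff_shift) simp
  then show ?thesis by (simp add: theta_mat_def)
qed

text \<open>The first \<open>N\<close> coefficients of \<open>\<theta>\<^sub>a g\<close> only involve the first \<open>N\<close> coefficients of \<open>g\<close>, and
  the shifts of \<open>\<theta>\<^sub>a\<close> are orthonormal.\<close>

lemma inner_mult_sum_le:
  assumes a: "a > 0"
  shows "(\<Sum>n\<le>N. (norm (inner_mult a g n))\<^sup>2) \<le> (\<Sum>j\<le>N. (norm (g j))\<^sup>2)"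
proof -
  define v where "v = (\<lambda>n. \<Sum>j\<le>N. of_real (theta_mat a n j) * g j)"
  have "(\<lambda>n. \<Sum>j\<le>N. \<Sum>k\<le>N. g j * cnj (g k) * of_real (theta_mat a n j * theta_mat a n k)) sums
     (\<Sum>j\<le>N. \<Sum>k\<le>N. g j * cnj (g k) * of_real (if j = k then 1 else 0))"
    by (intro sums_sum sums_mult sums_of_real theta_mat_orthonormal a)
  moreover have "(\<Sum>j\<le>N. \<Sum>k\<le>N. g j * cnj (g k) * of_real (theta_mat a n j * theta_mat a n k)) = of_real ((norm (v n))\<^sup>2)" for n
    unfolding v_def complex_norm_square by (simp add: sum_product mult_ac)
  moreover have "(\<Sum>j\<le>N. \<Sum>k\<le>N. g j * cnj (g k) * of_real (if j = k then 1 else 0)) = of_real (\<Sum>j\<le>N. (norm (g j))\<^sup>2)"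
    unfolding of_real_sum complex_norm_square
    by (intro sum.cong refl) (simp add: if_distrib cong: if_cong)
  ultimately have s: "(\<lambda>n. (norm (v n))\<^sup>2) sums (\<Sum>j\<le>N. (norm (g j))\<^sup>2)"
    by (simp only: sums_of_real_iff)
  have "(\<Sum>n\<le>N. (norm (inner_mult a g n))\<^sup>2) = (\<Sum>n\<le>N. (norm (v n))\<^sup>2)"
  proof (rule sum.cong)
    fix n assume "n \<in> {..N}"
    then have "inner_mult a g n = v n" unfolding inner_mult_def v_def
      by (intro sum.mono_neutral_left) (auto simp: theta_mat_def)
    then show "(norm (inner_mult a g n))\<^sup>2 = (norm (v n))\<^sup>2" by simp
  qed auto
  also have "\<dots> \<le> (\<Sum>n. (norm (v n))\<^sup>2)" using s by (intro sum_le_suminf) (auto simp: sums_iff)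
  finally show ?thesis using s by (simp add: sums_iff)
qed

lemma inner_mult_sq_summable:
  assumes "a > 0" "sq_summable g"
  shows "sq_summable (inner_mult a g)" "normsq (inner_mult a g) \<le> normsq g"
  using sqsumI_bound[of "inner_mult a g" "normsq g"]
    order_trans[OF inner_mult_sum_le[OF assms(1)] sum_le_normsq[OF assms(2)]] by auto

text \<open>Orthogonality to the \<open>z\<^sup>k \<theta>\<^sub>a\<close> extends to \<open>\<theta>\<^sub>a g\<close> by truncating \<open>g\<close>, since multiplication by
  \<open>\<theta>\<^sub>a\<close> does not increase the norm.\<close>

lemma model_seqs_orthogonal_inner_mult:
  assumes a: "a > 0" and c: "c \<in> model_seqs a" and g: "sq_summable g"
  shows "sprod c (inner_mult a g) = 0"
proof -
  have sc: "sq_summable c" using c by (rule model_seqs_sq_summable)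
  define tr where "tr = (\<lambda>J j. if j \<le> J then g j else 0)"
  have tr: "sq_summable (\<lambda>j. g j - tr J j)" "normsq (\<lambda>j. g j - tr J j) \<le> normsq g - (\<Sum>j\<le>J. (norm (g j))\<^sup>2)" for J
  proof -
    have "(\<Sum>j\<le>N. (norm (g j - tr J j))\<^sup>2) \<le> normsq g - (\<Sum>j\<le>J. (norm (g j))\<^sup>2)" for N
    proof -
      have "(\<Sum>j\<le>N. (norm (g j - tr J j))\<^sup>2) + (\<Sum>j\<le>J. (norm (g j))\<^sup>2) =
          (\<Sum>j\<in>{..N} - {..J}. (norm (g j))\<^sup>2) + (\<Sum>j\<le>J. (norm (g j))\<^sup>2)"
        unfolding tr_def by (intro arg_cong2[where f = "(+)"] sum.mono_neutral_cong_right) auto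
      also have "\<dots> = (\<Sum>j\<in>({..N} - {..J}) \<union> {..J}. (norm (g j))\<^sup>2)"
        by (intro sum.union_disjoint[symmetric]) auto
      also have "\<dots> \<le> normsq g" by (intro sum_le_normsq g) auto
      finally show ?thesis by simp
    qed
    from sqsumI_bound[of "\<lambda>j. g j - tr J j", OF this]
    show "sq_summable (\<lambda>j. g j - tr J j)" "normsq (\<lambda>j. g j - tr J j) \<le> normsq g - (\<Sum>j\<le>J. (norm (g j))\<^sup>2)"
      by blast+
  qed
  have trs: "sq_summable (tr J)" for J using sq_summable_diff[OF g tr(1)[of J]] by simp
  have z: "sprod c (inner_mult a (tr J)) = 0" for J
  proof -
    have "inner_mult a (tr J) n = (\<Sum>j\<le>J. of_real (theta_mat a n j) * g j)" for n
      unfolding inner_mult_def tr_def by (intro sum.mono_neutral_cong) (auto simp: theta_mat_def)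
    moreover have "(\<lambda>n. \<Sum>j\<le>J. cnj (g j) * (c n * of_real (theta_mat a n j))) sums (\<Sum>j\<le>J. cnj (g j) * 0)"
      by (intro sums_sum sums_mult model_seqs_theta_mat c)
    ultimately show ?thesis unfolding sprod_def by (simp add: sums_iff sum_distrib_left mult_ac)
  qed
  have "(norm (sprod c (inner_mult a g)))\<^sup>2 \<le> normsq c * (normsq g - (\<Sum>j\<le>J. (norm (g j))\<^sup>2))" for J
  proof -
    have "inner_mult a (\<lambda>j. g j - tr J j) = (\<lambda>n. inner_mult a g n - inner_mult a (tr J) n)"
      by (simp add: inner_mult_def fun_eq_iff right_diff_distrib sum_subtractf)
    then have "sprod c (inner_mult a g) = sprod c (inner_mult a (\<lambda>j. g j - tr J j))"
      using sprod_diff_right[OF inner_mult_sq_summable(1)[OF a g] inner_mult_sq_summable(1)[OF a trs[of J]] sc] z by simp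
    then have "(norm (sprod c (inner_mult a g)))\<^sup>2 \<le> normsq c * normsq (inner_mult a (\<lambda>j. g j - tr J j))"
      using sprod_Cauchy_Schwarz[OF sc inner_mult_sq_summable(1)[OF a tr(1)]] by simp
    also have "\<dots> \<le> normsq c * (normsq g - (\<Sum>j\<le>J. (norm (g j))\<^sup>2))"
      by (intro mult_left_mono order_trans[OF inner_mult_sq_summable(2)[OF a tr(1)] tr(2)] normsq_nonneg sc)
    finally show ?thesis .
  qed
  moreover have "(\<lambda>J. normsq c * (normsq g - (\<Sum>j\<le>J. (norm (g j))\<^sup>2))) \<longlonglongrightarrow> normsq c * (normsq g - normsq g)"
    using g unfolding sq_summable_def normsq_def[of g] by (intro tendsto_intros summable_LIMSEQ')
  ultimately have "(norm (sprod c (inner_mult a g)))\<^sup>2 \<le> normsq c * (normsq g - normsq g)"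
    by (intro LIMSEQ_le_const) auto
  then show ?thesis by simp
qed

section \<open>From the Hardy space to sequences\<close>

lemma taylor_coeff_unique:
  assumes "\<And>z. norm z < 1 \<Longrightarrow> (\<lambda>n. c n * z ^ n) sums f z"
  shows "taylor_coeff f = c"
proof -
  have "f has_fps_expansion Abs_fps c"
    unfolding has_fps_expansion_def
  proof
    have "summable (\<lambda>n. c n * (1/2) ^ n)" using assms[of "1/2"] by (auto simp: sums_iff)
    from conv_radius_geI[OF this] show "fps_conv_radius (Abs_fps c) > 0"
      by (simp add: fps_conv_radius_def) (metis divide_pos_pos ereal_less(2) less_le_trans zero_less_numeral zero_less_one)
    have "eventually (\<lambda>z. z \<in> ball 0 1) (nhds (0::complex))" by (intro eventually_nhds_in_open) auto
    then show "\<forall>\<^sub>F z in nhds 0. eval_fps (Abs_fps c) z = f z"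
      by eventually_elim (use assms in \<open>auto simp: eval_fps_def sums_iff\<close>)
  qed
  from fps_nth_fps_expansion[OF this] show ?thesis by (auto simp: taylor_coeff_def fun_eq_iff)
qed

lemma taylor_series:
  assumes "f holomorphic_on ball 0 1" "norm z < 1"
  shows "(\<lambda>n. taylor_coeff f n * z ^ n) sums f z"
  using holomorphic_power_series[OF assms(1), of z] assms(2) by (simp add: taylor_coeff_def)

definition series_fun :: "(nat \<Rightarrow> complex) \<Rightarrow> complex \<Rightarrow> complex" where
  "series_fun c z = (if norm z < 1 then \<Sum>n. c n * z ^ n else 0)"

lemma sq_summable_powers:
  assumes "norm (z::complex) < 1"
  shows "sq_summable (\<lambda>n. z ^ n)"
proof -
  have "(norm z)\<^sup>2 < 1" using assms by (simp add: abs_square_less_1)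
  then show ?thesis unfolding sq_summable_def norm_power
    by (simp add: power_mult[symmetric] mult.commute[of _ 2] summable_geometric)
      (simp add: power_mult summable_geometric)
qed

lemma series_fun_sums:
  assumes "sq_summable c" "norm z < 1"
  shows "(\<lambda>n. c n * z ^ n) sums series_fun c z"
  using sprod_summable(2)[OF assms(1) sq_summable_powers[of "cnj z"]] assms(2)
  by (simp add: series_fun_def summable_sums)

lemma taylor_coeff_series_fun: "sq_summable c \<Longrightarrow> taylor_coeff (series_fun c) = c"
  by (intro taylor_coeff_unique series_fun_sums)

lemma series_fun_in_hardy2:
  assumes "sq_summable c"
  shows "series_fun c \<in> hardy2"
proof -
  have "series_fun c holomorphic_on ball 0 1"
    by (rule power_series_holomorphic[where a = c]) (use series_fun_sums[OF assms] in auto)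
  then show ?thesis using assms by (auto simp: hardy2_def taylor_coeff_series_fun series_fun_def sq_summable_def)
qed

lemma series_fun_eqI:
  assumes "\<And>z. norm z \<ge> 1 \<Longrightarrow> f z = 0" "\<And>z. norm z < 1 \<Longrightarrow> (\<lambda>n. c n * z ^ n) sums f z"
  shows "f = series_fun c"
  using assms by (auto simp: series_fun_def fun_eq_iff sums_iff)

lemma hardy2_sq_summable: "f \<in> hardy2 \<Longrightarrow> sq_summable (taylor_coeff f)"
  by (simp add: hardy2_def sq_summable_def)

lemma hardy2_eq_series_fun: "f \<in> hardy2 \<Longrightarrow> f = series_fun (taylor_coeff f)"
  by (intro series_fun_eqI) (auto simp: hardy2_def taylor_series)

lemma hinner_series_fun: "sq_summable u \<Longrightarrow> sq_summable v \<Longrightarrow> hinner (series_fun u) (series_fun v) = sprod u v"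
  by (simp add: hinner_def sprod_def taylor_coeff_series_fun)

lemma hnorm_series_fun: "sq_summable u \<Longrightarrow> (hnorm (series_fun u))\<^sup>2 = normsq u"
  by (simp add: hnorm_def hinner_series_fun sprod_self normsq_nonneg)

lemma series_fun_diff: "sq_summable u \<Longrightarrow> sq_summable v \<Longrightarrow> (\<lambda>z. series_fun u z - series_fun v z) = series_fun (\<lambda>n. u n - v n)"
  by (rule series_fun_eqI) (auto simp: series_fun_def left_diff_distrib intro!: sums_diff series_fun_sums[unfolded series_fun_def] dest: series_fun_sums)

lemma series_fun_scale: "sq_summable u \<Longrightarrow> (\<lambda>z. \<zeta> * series_fun u z) = series_fun (\<lambda>n. \<zeta> * u n)"
proof (rule series_fun_eqI)
  fix z :: complex assume "sq_summable u" "norm z < 1"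
  from sums_mult[OF series_fun_sums[OF this], of \<zeta>] show "(\<lambda>n. \<zeta> * u n * z ^ n) sums (\<zeta> * series_fun u z)"
    by (simp add: mult.assoc)
qed (auto simp: series_fun_def)

lemma hone_eq_series_fun: "hone = series_fun (\<lambda>n. if n = 0 then 1 else 0)"
proof (rule series_fun_eqI)
  fix z :: complex assume "norm z < 1"
  then show "(\<lambda>n. (if n = 0 then 1 else 0) * z ^ n) sums hone z"
    using sums_single[of 0 "\<lambda>_. 1 :: complex"] by (simp add: hone_def if_distrib[of "\<lambda>x. x * _"] cong: if_cong)
qed (auto simp: hone_def)

lemma sq_summable_single: "sq_summable (\<lambda>n. if n = k then 1 else 0)"
proof -
  have "(\<lambda>n. (norm (if n = k then 1 else 0 :: complex))\<^sup>2) = (\<lambda>n. if n = k then 1 else 0)" by auto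
  then show ?thesis unfolding sq_summable_def by simp
qed

definition fwd_shift :: "(nat \<Rightarrow> complex) \<Rightarrow> nat \<Rightarrow> complex" where
  "fwd_shift c n = (case n of 0 \<Rightarrow> 0 | Suc m \<Rightarrow> c m)"

lemma sq_summable_fwd_shift: "sq_summable c \<Longrightarrow> sq_summable (fwd_shift c)"
  unfolding sq_summable_def by (subst summable_Suc_iff[symmetric]) (simp add: fwd_shift_def)

lemma Mz_series_fun: assumes "sq_summable c" shows "Mz (series_fun c) = series_fun (fwd_shift c)"
proof (rule series_fun_eqI)
  fix z :: complex assume z: "norm z < 1"
  have "(\<lambda>n. fwd_shift c (Suc n) * z ^ Suc n) sums (z * series_fun c z)"
    using sums_mult[OF series_fun_sums[OF assms z], of z] by (simp add: fwd_shift_def mult_ac)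
  then show "(\<lambda>n. fwd_shift c n * z ^ n) sums Mz (series_fun c) z"
    by (subst (asm) sums_Suc_iff) (simp add: fwd_shift_def Mz_def)
qed (auto simp: Mz_def series_fun_def)

lemma sprod_fwd_shift:
  assumes "sq_summable c" "sq_summable u"
  shows "sprod (fwd_shift c) u = sprod c (\<lambda>n. u (Suc n))"
proof -
  have "summable (\<lambda>n. fwd_shift c n * cnj (u n))" by (intro sprod_summable(2) sq_summable_fwd_shift assms)
  from suminf_split_head[OF this] show ?thesis by (simp add: sprod_def fwd_shift_def)
qed

lemma theta_holomorphic: "theta a holomorphic_on ball 0 1"
  unfolding theta_def by (intro holomorphic_intros) auto

text \<open>\<open>\<theta>\<^sub>a\<close> solves \<open>(1 - z)\<^sup>2 \<theta>' = -2a \<theta>\<close>, which is the Laguerre recurrence for its coefficients.\<close>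

lemma taylor_coeff_theta: "taylor_coeff (theta a) n = of_real (theta_coeff a n)"
proof -
  note hol = theta_holomorphic[of a]
  define F where "F = fps_expansion (theta a) 0"
  have F: "theta a has_fps_expansion F"
    unfolding F_def by (rule has_fps_expansion_fps_expansion[OF _ _ hol]) auto
  have Fn: "fps_nth F n = taylor_coeff (theta a) n" for n
    using fps_nth_fps_expansion[OF F] by (simp add: taylor_coeff_def)
  have ode: "(1 - z) * ((1 - z) * deriv (theta a) z) = - 2 * of_real a * theta a z" if "norm z < 1" for z
  proof -
    have z: "1 - z \<noteq> 0" using that by auto
    have "((\<lambda>z. exp (- of_real a * ((1 + z) / (1 - z)))) has_field_derivative
        exp (- of_real a * ((1 + z) / (1 - z))) * (- of_real a * (2 / ((1 - z) * (1 - z))))) (at z)"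
      using z by (auto intro!: derivative_eq_intros simp: field_simps)
    then have "deriv (theta a) z = theta a z * (- of_real a * (2 / ((1 - z) * (1 - z))))"
      unfolding theta_def[abs_def] by (rule DERIV_imp_deriv)
    then show ?thesis using z by simp
  qed
  have 1: "(\<lambda>z. (1 - z) * ((1 - z) * deriv (theta a) z)) has_fps_expansion (1 - fps_X) * ((1 - fps_X) * fps_deriv F)"
    by (intro fps_expansion_intros F)
  have 2: "(\<lambda>z. - 2 * of_real a * theta a z) has_fps_expansion fps_const (- 2 * of_real a) * F"
    by (intro fps_expansion_intros F)
  have ev: "eventually (\<lambda>z. z \<in> ball 0 1) (nhds (0::complex))" by (intro eventually_nhds_in_open) auto
  then have ev': "eventually (\<lambda>z. (1 - z) * ((1 - z) * deriv (theta a) z) = - 2 * of_real a * theta a z) (nhds 0)"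
    by eventually_elim (use ode in auto)
  have "(\<lambda>z. - 2 * of_real a * theta a z) has_fps_expansion (1 - fps_X) * ((1 - fps_X) * fps_deriv F)"
    by (rule iffD1[OF has_fps_expansion_cong[OF ev' refl] 1])
  from fps_expansion_unique_complex[OF this 2]
  have eq: "(1 - fps_X) * ((1 - fps_X) * fps_deriv F) = fps_const (- 2 * of_real a) * F" .
  define D where "D = (1 - fps_X) * fps_deriv F"
  have D: "fps_nth D n = of_nat (Suc n) * fps_nth F (Suc n) - of_nat n * fps_nth F n" for n
    unfolding D_def by (cases n) (auto simp: left_diff_distrib)
  have D_rec: "fps_nth D n = (if n = 0 then 0 else fps_nth D (n - 1)) - 2 * of_real a * fps_nth F n" for n
  proof -
    have "fps_nth ((1 - fps_X) * D) n = - 2 * of_real a * fps_nth F n"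
      unfolding D_def eq by simp
    then show ?thesis by (cases n) (auto simp: left_diff_distrib algebra_simps)
  qed
  have D_sum: "fps_nth D n = - 2 * of_real a * (\<Sum>j\<le>n. fps_nth F j)" for n
    by (induction n) (subst D_rec, simp add: algebra_simps)+
  have "\<forall>j\<le>n. fps_nth F j = of_real (theta_coeff a j)" for n
  proof (induction n)
    case 0
    have "fps_nth F 0 = theta a 0" unfolding Fn taylor_coeff_def by simp
    then show ?case by (simp add: theta_def exp_of_real[symmetric])
  next
    case (Suc n)
    have "(\<Sum>j\<le>n. fps_nth F j) = of_real (laguerre a n)"
      unfolding laguerre_eq_sum of_real_sum using Suc by (intro sum.cong) auto
    then have "of_nat (Suc n) * fps_nth F (Suc n) = of_nat n * of_real (theta_coeff a n) - 2 * of_real a * of_real (laguerre a n)"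
      using D[of n] D_sum[of n] Suc by (simp add: algebra_simps)
    also have "\<dots> = of_nat (Suc n) * complex_of_real (theta_coeff a (Suc n))"
      using arg_cong[OF theta_coeff_recurrence[of n a], of complex_of_real] by simp
    finally have "fps_nth F (Suc n) = of_real (theta_coeff a (Suc n))"
      by (metis mult_cancel_left of_nat_neq_0)
    then show ?case using Suc by (auto simp: le_Suc_eq)
  qed
  then show ?thesis using Fn by auto
qed

lemma theta_sums: "norm z < 1 \<Longrightarrow> (\<lambda>n. of_real (theta_coeff a n) * z ^ n) sums theta a z"
  using taylor_series[OF theta_holomorphic, of z a] by (simp add: taylor_coeff_theta)

lemma theta_mult_series_fun:
  assumes a: "a > 0" and g: "sq_summable g"
  shows "taylor_coeff (\<lambda>z. theta a z * series_fun g z) = inner_mult a g"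
proof (rule taylor_coeff_unique)
  fix z :: complex assume z: "norm z < 1"
  have t: "sq_summable (\<lambda>n. of_real (theta_coeff a n))"
    using theta_coeff_correlation[OF a, of 0] by (simp add: sq_summable_def power2_eq_square sums_iff)
  have abs: "summable (\<lambda>n. norm (c n * z ^ n))" if "sq_summable c" for c
    using sprod_summable(1)[OF that sq_summable_powers[of "cnj z"]] z by simp
  have "(\<lambda>k. \<Sum>i\<le>k. (of_real (theta_coeff a i) * z ^ i) * (g (k - i) * z ^ (k - i))) sums
     ((\<Sum>k. of_real (theta_coeff a k) * z ^ k) * (\<Sum>k. g k * z ^ k))"
    by (intro Cauchy_product_sums abs t g)
  also have "(\<Sum>k. of_real (theta_coeff a k) * z ^ k) * (\<Sum>k. g k * z ^ k) = theta a z * series_fun g z"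
    using theta_sums[OF z] series_fun_sums[OF g z] by (simp add: sums_iff)
  also have "(\<lambda>k. \<Sum>i\<le>k. (of_real (theta_coeff a i) * z ^ i) * (g (k - i) * z ^ (k - i))) =
     (\<lambda>k. inner_mult a g k * z ^ k)"
  proof (rule ext)
    fix k
    have "(\<Sum>i\<le>k. (of_real (theta_coeff a i) * z ^ i) * (g (k - i) * z ^ (k - i))) =
        (\<Sum>j\<le>k. of_real (theta_mat a k j) * g j * z ^ k)"
      by (rule sum.reindex_bij_witness[of _ "\<lambda>i. k - i" "\<lambda>i. k - i"])
        (auto simp: theta_mat_def mult_ac power_add[symmetric])
    then show "(\<Sum>i\<le>k. (of_real (theta_coeff a i) * z ^ i) * (g (k - i) * z ^ (k - i))) = inner_mult a g k * z ^ k"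
      by (simp add: inner_mult_def sum_distrib_right)
  qed
  finally show "(\<lambda>n. inner_mult a g n * z ^ n) sums (theta a z * series_fun g z)" .
qed

text \<open>Testing orthogonality with \<open>\<theta>\<^sub>a z\<^sup>k\<close> gives the defining relations of the sequence space; conversely
  these say that the adjoint of multiplication by \<open>\<theta>\<^sub>a\<close> annihilates the sequence.\<close>

lemma model_space_eq:
  assumes a: "a > 0"
  shows "model_space a = series_fun ` model_seqs a"
proof (intro equalityI subsetI)
  fix f assume f: "f \<in> model_space a"
  define c where "c = taylor_coeff f"
  have fh: "f \<in> hardy2" using f by (simp add: model_space_def)
  have c: "sq_summable c" "f = series_fun c" using hardy2_sq_summable[OF fh] hardy2_eq_series_fun[OF fh] by (auto simp: c_def)
  have "(\<lambda>n. c (n + k) * of_real (theta_coeff a n)) sums 0" for k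
  proof -
    define e where "e = (\<lambda>n. if n = k then 1 else 0 :: complex)"
    have e: "sq_summable e" unfolding e_def by (rule sq_summable_single)
    have "hinner f (\<lambda>z. theta a z * series_fun e z) = 0"
      using f series_fun_in_hardy2[OF e] by (simp add: model_space_def)
    moreover have "inner_mult a e n = of_real (theta_mat a n k)" for n
    proof -
      have "inner_mult a e n = (\<Sum>j\<le>n. if j = k then of_real (theta_mat a n k) else 0)"
        unfolding inner_mult_def e_def by (intro sum.cong) auto
      then show ?thesis by (auto simp: theta_mat_def)
    qed
    ultimately have "(\<Sum>n. c n * of_real (theta_mat a n k)) = 0"
      unfolding hinner_def theta_mult_series_fun[OF a e] by (simp add: c_def)
    moreover have "summable (\<lambda>n. c n * of_real (theta_mat a n k))"
      using sprod_summable(2)[OF c(1) inner_mult_sq_summable(1)[OF a e]] \<open>\<And>n. inner_mult a e n = of_real (theta_mat a n k)\<close> by simp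
    ultimately have "(\<lambda>n. c n * of_real (theta_mat a n k)) sums 0" by (simp add: sums_iff)
    then have "(\<lambda>n. c (n + k) * of_real (theta_mat a (n + k) k)) sums (0 - (\<Sum>i<k. c i * of_real (theta_mat a i k)))"
      by (subst sums_iff_shift')
    then show ?thesis by (simp add: theta_mat_def)
  qed
  then have "c \<in> model_seqs a" using c by (simp add: model_seqs_def)
  then show "f \<in> series_fun ` model_seqs a" using c by blast
next
  fix f assume "f \<in> series_fun ` model_seqs a"
  then obtain c where c: "c \<in> model_seqs a" "f = series_fun c" by blast
  note sc = model_seqs_sq_summable[OF c(1)]
  have "hinner f (\<lambda>z. theta a z * g z) = 0" if "g \<in> hardy2" for g
  proof -
    have "hinner f (\<lambda>z. theta a z * series_fun (taylor_coeff g) z) = sprod c (inner_mult a (taylor_coeff g))"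
      using theta_mult_series_fun[OF a hardy2_sq_summable[OF that]] c(2)
      by (simp add: hinner_def sprod_def taylor_coeff_series_fun[OF sc])
    then show ?thesis
      using model_seqs_orthogonal_inner_mult[OF a c(1) hardy2_sq_summable[OF that]] hardy2_eq_series_fun[OF that] by simp
  qed
  then show "f \<in> model_space a" using series_fun_in_hardy2[OF sc] c(2) by (simp add: model_space_def)
qed

text \<open>Existence of the projection is the Riesz representation of \<open>u \<mapsto> \<langle>u, w\<rangle>\<close> on the model space;
  uniqueness makes it the object that the definite description denotes.\<close>

lemma hproj_series_fun:
  assumes a: "a > 0" and w: "sq_summable w"
  obtains g where "g \<in> model_seqs a" "hproj (model_space a) (series_fun w) = series_fun g" "\<And>u. u \<in> model_seqs a \<Longrightarrow> sprod g u = sprod w u"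
proof -
  have "\<exists>g\<in>model_seqs a. \<forall>u\<in>model_seqs a. sprod u g = sprod u w"
  proof (rule model_seqs_riesz[OF a, where C = "normsq w"])
    fix u assume "u \<in> model_seqs a"
    then show "(norm (sprod u w))\<^sup>2 \<le> normsq w * normsq u"
      using sprod_Cauchy_Schwarz[OF model_seqs_sq_summable w] by (simp add: mult.commute)
  qed (use w in \<open>auto simp: sprod_add_left sprod_scale_left model_seqs_sq_summable normsq_nonneg\<close>)
  then obtain g where g: "g \<in> model_seqs a" "\<And>u. u \<in> model_seqs a \<Longrightarrow> sprod u g = sprod u w" by blast
  have g': "sprod g u = sprod w u" if "u \<in> model_seqs a" for u
    using g(2)[OF that] sprod_cnj[OF model_seqs_sq_summable[OF that] w] sprod_cnj[OF model_seqs_sq_summable[OF that] model_seqs_sq_summable[OF g(1)]] by simp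
  have "hproj (model_space a) (series_fun w) = series_fun g"
    unfolding hproj_def
  proof (rule the_equality)
    show "series_fun g \<in> model_space a \<and> (\<forall>h\<in>model_space a. hinner (\<lambda>z. series_fun w z - series_fun g z) h = 0)"
      using g g' w by (auto simp: model_space_eq[OF a] series_fun_diff model_seqs_sq_summable hinner_series_fun sq_summable_diff sprod_diff_left)
  next
    fix f assume f: "f \<in> model_space a \<and> (\<forall>h\<in>model_space a. hinner (\<lambda>z. series_fun w z - f z) h = 0)"
    then obtain v where v: "v \<in> model_seqs a" "f = series_fun v" by (auto simp: model_space_eq[OF a])
    define d where "d = (\<lambda>n. g n - v n)"
    have d: "d \<in> model_seqs a" unfolding d_def by (intro model_seqs_diff g v)
    have "sprod (\<lambda>n. w n - v n) d = 0"
      using f d v w by (auto simp: model_space_eq[OF a] series_fun_diff model_seqs_sq_summable hinner_series_fun sq_summable_diff)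
    then have "sprod g d - sprod v d = 0"
      using g'[OF d] sprod_diff_left[OF w model_seqs_sq_summable[OF v(1)] model_seqs_sq_summable[OF d]] by simp
    then have "sprod d d = 0"
      using g(1) v(1) d by (simp add: sprod_diff_left model_seqs_sq_summable d_def)
    then have "normsq d = 0" by (simp add: sprod_self model_seqs_sq_summable[OF d])
    then have "g = v" using normsq_eq_0_iff[OF model_seqs_sq_summable[OF d]] by (simp add: d_def fun_eq_iff)
    then show "f = series_fun g" using v by simp
  qed
  then show ?thesis using that g(1) g' by blast
qed

lemma model_seqs_eqI:
  assumes "u \<in> model_seqs a" "v \<in> model_seqs a" "\<And>x. x \<in> model_seqs a \<Longrightarrow> sprod u x = sprod v x"
  shows "u = v"
proof
  fix n
  let ?d = "\<lambda>n. u n - v n"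
  have d: "?d \<in> model_seqs a" by (intro model_seqs_diff assms)
  have "sprod ?d ?d = 0" using assms(3)[OF d] assms d by (simp add: sprod_diff_left model_seqs_sq_summable)
  then have "normsq ?d = 0" by (simp add: sprod_self model_seqs_sq_summable[OF d])
  from normsq_eq_0_iff[OF model_seqs_sq_summable[OF d] this, of n] show "u n = v n" by simp
qed

section \<open>The powers of the compressed shift\<close>

text \<open>The compressed shift is the adjoint of the backward shift.\<close>

lemma comp_shift_series_fun:
  assumes a: "a > 0" and c: "c \<in> model_seqs a"
  obtains g where "g \<in> model_seqs a" "comp_shift a (series_fun c) = series_fun g"
    "\<And>u. u \<in> model_seqs a \<Longrightarrow> sprod g u = sprod c (\<lambda>n. u (Suc n))"
proof -
  note sc = model_seqs_sq_summable[OF c]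
  obtain g where g: "g \<in> model_seqs a" "hproj (model_space a) (series_fun (fwd_shift c)) = series_fun g"
    "\<And>u. u \<in> model_seqs a \<Longrightarrow> sprod g u = sprod (fwd_shift c) u"
    using hproj_series_fun[OF a sq_summable_fwd_shift[OF sc]] by blast
  then show ?thesis using that[of g] by (simp add: comp_shift_def Mz_series_fun[OF sc] sprod_fwd_shift sc model_seqs_sq_summable)
qed

lemma kzero_series_fun:
  assumes a: "a > 0"
  obtains k where "k \<in> model_seqs a" "kzero a = series_fun k" "\<And>u. u \<in> model_seqs a \<Longrightarrow> sprod k u = cnj (u 0)"
proof -
  let ?e = "\<lambda>n. if n = 0 then 1 else 0 :: complex"
  obtain k where k: "k \<in> model_seqs a" "hproj (model_space a) (series_fun ?e) = series_fun k"
    "\<And>u. u \<in> model_seqs a \<Longrightarrow> sprod k u = sprod ?e u"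
    using hproj_series_fun[OF a sq_summable_single[of 0]] by blast
  moreover have "sprod ?e u = cnj (u 0)" for u
  proof -
    have "(\<lambda>n. ?e n * cnj (u n)) = (\<lambda>n. if n = 0 then cnj (u n) else 0)" by auto
    then show ?thesis unfolding sprod_def using sums_unique[OF sums_single[of 0 "\<lambda>n. cnj (u n)"]] by simp
  qed
  ultimately show ?thesis using that[of k] by (simp add: kzero_def hone_eq_series_fun)
qed

text \<open>Solvability of \<open>(\<zeta> - T) f = k\<^sub>0\<close> on the contour is dual to solvability for the adjoint,
  which is the backward shift; the resolvent of the latter is its Neumann series about \<open>1\<close>.\<close>

lemma resolvent_kzero:
  assumes a: "a > 0" and \<zeta>: "norm (\<zeta> - 1) = 1/2"
  obtains r where "r \<in> model_seqs a" "resolvent (model_space a) (comp_shift a) \<zeta> (kzero a) = series_fun r"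
    "\<And>u. u \<in> model_seqs a \<Longrightarrow> sprod r u = cnj (bshift_res (cnj \<zeta>) u 0)"
proof -
  let ?w = "cnj \<zeta>"
  let ?L = "\<lambda>f z. \<zeta> * f z - comp_shift a f z"
  have w: "norm (?w - 1) = 1/2"
    using \<zeta> by (metis complex_cnj_diff complex_cnj_one complex_mod_cnj)
  obtain k where k: "k \<in> model_seqs a" "kzero a = series_fun k" "\<And>u. u \<in> model_seqs a \<Longrightarrow> sprod k u = cnj (u 0)"
    using kzero_series_fun[OF a] by blast
  have "\<exists>g\<in>model_seqs a. \<forall>u\<in>model_seqs a. sprod u g = bshift_res ?w u 0"
    by (rule model_seqs_riesz[OF a, where C = "8 * exp_tail 0 (16 * a)"])
      (use a w in \<open>auto simp: bshift_res_add[OF a] bshift_res_scale[OF a] bshift_res_bounded exp_tail_nonneg\<close>)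
  then obtain g where g: "g \<in> model_seqs a" "\<And>u. u \<in> model_seqs a \<Longrightarrow> sprod u g = bshift_res ?w u 0" by blast
  have L: "\<exists>d\<in>model_seqs a. ?L (series_fun c) = series_fun d \<and> (\<forall>u\<in>model_seqs a. sprod d u = sprod c (\<lambda>n. ?w * u n - u (Suc n)))"
    if c: "c \<in> model_seqs a" for c
  proof -
    obtain t where t: "t \<in> model_seqs a" "comp_shift a (series_fun c) = series_fun t"
      "\<And>u. u \<in> model_seqs a \<Longrightarrow> sprod t u = sprod c (\<lambda>n. u (Suc n))" using comp_shift_series_fun[OF a c] by blast
    have "?L (series_fun c) = series_fun (\<lambda>n. \<zeta> * c n - t n)"
      using c t by (simp add: series_fun_scale series_fun_diff[symmetric] model_seqs_sq_summable sq_summable_scale)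
        (simp add: series_fun_scale[symmetric] model_seqs_sq_summable fun_eq_iff)
    moreover have "sprod (\<lambda>n. \<zeta> * c n - t n) u = sprod c (\<lambda>n. ?w * u n - u (Suc n))" if u: "u \<in> model_seqs a" for u
    proof -
      have "(\<lambda>n. u (Suc n)) \<in> model_seqs a" using model_seqs_shift[OF u, of 1] by simp
      then show ?thesis using c t u
        by (simp add: sprod_diff_left sprod_diff_right sprod_scale_left sprod_scale_right model_seqs_sq_summable sq_summable_scale)
    qed
    ultimately show ?thesis by (intro bexI[of _ "\<lambda>n. \<zeta> * c n - t n"]) (auto intro!: model_seqs_diff model_seqs_scale c t)
  qed
  have "?L (series_fun g) = kzero a"
  proof -
    obtain d where d: "d \<in> model_seqs a" "?L (series_fun g) = series_fun d"
      "\<And>u. u \<in> model_seqs a \<Longrightarrow> sprod d u = sprod g (\<lambda>n. ?w * u n - u (Suc n))" using L[OF g(1)] by blast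
    have "d = k"
    proof (rule model_seqs_eqI[OF d(1) k(1)])
      fix u assume u: "u \<in> model_seqs a"
      let ?u = "\<lambda>n. ?w * u n - u (Suc n)"
      have u': "?u \<in> model_seqs a" using model_seqs_diff[OF model_seqs_scale[OF u] model_seqs_shift[OF u, of 1]] by simp
      have "sprod g ?u = cnj (sprod ?u g)" by (rule sprod_cnj) (use u' g in \<open>auto simp: model_seqs_sq_summable\<close>)
      also have "\<dots> = cnj (u 0)" using g(2)[OF u'] bshift_res_left[OF a u w, of 0] by simp
      finally show "sprod d u = sprod k u" using d(3)[OF u] k(3)[OF u] by simp
    qed
    then show ?thesis using d k by simp
  qed
  moreover have "series_fun g \<in> model_space a" using g by (auto simp: model_space_eq[OF a])
  ultimately have img: "kzero a \<in> ?L ` model_space a" by (intro image_eqI) (rule sym)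
  define f where "f = resolvent (model_space a) (comp_shift a) \<zeta> (kzero a)"
  have f: "f \<in> model_space a" "?L f = kzero a"
    unfolding f_def resolvent_def using inv_into_into[OF img] f_inv_into_f[OF img] by auto
  obtain r where r: "r \<in> model_seqs a" "f = series_fun r" using f(1) by (auto simp: model_space_eq[OF a])
  obtain d where d: "d \<in> model_seqs a" "?L (series_fun r) = series_fun d"
    "\<And>u. u \<in> model_seqs a \<Longrightarrow> sprod d u = sprod r (\<lambda>n. ?w * u n - u (Suc n))" using L[OF r(1)] by blast
  have "series_fun d = series_fun k" using f(2) r(2) d(2) k(2) by simp
  then have dk: "d = k" using taylor_coeff_series_fun d(1) k(1) model_seqs_sq_summable by metis
  have ipr: "sprod r u = cnj (bshift_res ?w u 0)" if u: "u \<in> model_seqs a" for u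
  proof -
    have v: "bshift_res ?w u \<in> model_seqs a" by (rule bshift_res_in_model_seqs[OF a u w])
    have "sprod r u = sprod d (bshift_res ?w u)" unfolding d(3)[OF v] bshift_res_right[OF a u w] ..
    then show ?thesis using k(3)[OF v] dk by simp
  qed
  have "resolvent (model_space a) (comp_shift a) \<zeta> (kzero a) = series_fun r"
    using r(2) by (simp only: f_def)
  from that[OF r(1) this ipr] show ?thesis .
qed

lemma real_power_holomorphic: "(\<lambda>\<zeta>. exp (of_real s * Ln \<zeta>)) holomorphic_on ball 1 1"
proof -
  have "z \<notin> \<real>\<^sub>\<le>\<^sub>0" if "z \<in> ball 1 1" for z :: complex
  proof -
    have "\<bar>Re (1 - z)\<bar> < 1" using that abs_Re_le_cmod[of "1 - z"] by (simp add: dist_norm)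
    then show ?thesis by (auto simp: complex_nonpos_Reals_iff)
  qed
  then show ?thesis by (intro holomorphic_intros) auto
qed

lemma real_power_coeff:
  "(deriv ^^ j) (\<lambda>\<zeta>. exp (of_real s * Ln \<zeta>)) 1 / fact j = complex_of_real (s gchoose j)"
proof -
  let ?\<phi> = "\<lambda>\<zeta>. exp (of_real s * Ln \<zeta>)"
  note hol = real_power_holomorphic[of s]
  have "(deriv ^^ j) (\<lambda>w. ?\<phi> (1 * w + 1)) 0 = 1 ^ j * (deriv ^^ j) ?\<phi> (1 * 0 + 1)"
    by (rule higher_deriv_compose_linear'[OF hol, of "ball 0 1"]) (auto simp: dist_norm)
  then have 1: "(deriv ^^ j) ?\<phi> 1 = (deriv ^^ j) (\<lambda>w. ?\<phi> (w + 1)) 0" by simp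
  have "taylor_coeff (\<lambda>w. ?\<phi> (w + 1)) = (\<lambda>n. of_real s gchoose n)"
  proof (rule taylor_coeff_unique)
    fix z :: complex assume z: "norm z < 1"
    then have "1 + z \<noteq> 0" by (metis add.commute add_eq_0_iff less_irrefl norm_minus_cancel norm_one)
    then show "(\<lambda>n. (of_real s gchoose n) * z ^ n) sums exp (of_real s * Ln (z + 1))"
      using gen_binomial_complex[OF z, of "of_real s"] by (simp add: powr_def add.commute)
  qed
  moreover have "complex_of_real (s gchoose j) = (of_real s gchoose j)"
    by (simp add: gbinomial_prod_rev)
  ultimately show ?thesis unfolding 1 by (metis taylor_coeff_def)
qed

text \<open>Expanding the resolvent at \<open>1\<close> under the contour integral leaves the Taylor coefficients
  of \<open>\<zeta>\<^sup>s\<close> at \<open>1\<close>, i.e. the binomial coefficients of the Newton series.\<close>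

lemma power_contour_integral:
  assumes a: "a > 0" and u: "u \<in> model_seqs a" and s: "s \<ge> 0"
  shows "contour_integral (circlepath 1 (1/2))
     (\<lambda>\<zeta>. exp (of_real s * Ln \<zeta>) * cnj (bshift_res (cnj \<zeta>) u 0)) / (2 * of_real pi * \<i>) = cnj (newton u 0 s)"
proof -
  let ?\<phi> = "\<lambda>\<zeta>. exp (of_real s * Ln \<zeta>)"
  define b where "b = (\<lambda>j. cnj ((fdiff ^^ j) u 0))"
  note hol = real_power_holomorphic[of s]
  have cont: "continuous_on (cball 1 (1/2)) ?\<phi>"
    by (rule continuous_on_subset[OF holomorphic_on_imp_continuous_on[OF hol]]) auto
  have hol': "?\<phi> holomorphic_on ball 1 (1/2)" by (rule holomorphic_on_subset[OF hol]) auto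
  define t where "t = (\<lambda>j \<zeta>. b j * (?\<phi> \<zeta> / (\<zeta> - 1) ^ Suc j))"
  have t_int: "(t j has_contour_integral b j * (2 * of_real pi * \<i> * of_real (s gchoose j))) (circlepath 1 (1/2))" for j
  proof -
    have "((\<lambda>\<zeta>. ?\<phi> \<zeta> / (\<zeta> - 1) ^ Suc j) has_contour_integral
        ((2 * of_real pi * \<i>) / fact j * (deriv ^^ j) ?\<phi> 1)) (circlepath 1 (1/2))"
      using Cauchy_has_contour_integral_higher_derivative_circlepath[OF cont hol', of 1 j] by simp
    moreover have "(2 * of_real pi * \<i>) / fact j * (deriv ^^ j) ?\<phi> 1 = 2 * of_real pi * \<i> * of_real (s gchoose j)"
      unfolding real_power_coeff[symmetric] by simp
    ultimately show ?thesis unfolding t_def by (intro has_contour_integral_lmul) simp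
  qed
  obtain B where B: "\<And>\<zeta>. \<zeta> \<in> sphere 1 (1/2) \<Longrightarrow> norm (?\<phi> \<zeta>) \<le> B"
  proof -
    have "continuous_on (sphere 1 (1/2)) ?\<phi>" by (rule continuous_on_subset[OF cont]) auto
    then have "compact (?\<phi> ` sphere 1 (1/2))" by (intro compact_continuous_image) auto
    from compact_imp_bounded[OF this] show ?thesis using that unfolding bounded_iff by blast
  qed
  have sm: "summable (\<lambda>j. norm (inverse (3/2 - 1 :: complex) ^ Suc j * (fdiff ^^ j) u 0))"
    by (rule bshift_res_summable[OF a u]) simp
  have ul: "uniform_limit (sphere 1 (1/2)) (\<lambda>J \<zeta>. \<Sum>j<J. t j \<zeta>) (\<lambda>\<zeta>. \<Sum>j. t j \<zeta>) sequentially"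
  proof (rule Weierstrass_m_test)
    show "summable (\<lambda>j. B * norm (inverse (3/2 - 1 :: complex) ^ Suc j * (fdiff ^^ j) u 0))"
      by (intro summable_mult sm)
    fix j \<zeta> assume z: "\<zeta> \<in> sphere (1::complex) (1/2)"
    then have n: "norm (\<zeta> - 1) = 1/2" by (simp add: dist_norm norm_minus_commute)
    have "norm (t j \<zeta>) = norm (?\<phi> \<zeta>) * (2 ^ Suc j * norm ((fdiff ^^ j) u 0))"
      unfolding t_def b_def norm_mult norm_divide norm_power n complex_mod_cnj
      by (simp add: power_divide)
    also have "\<dots> \<le> B * (2 ^ Suc j * norm ((fdiff ^^ j) u 0))"
      by (intro mult_right_mono B z) auto
    also have "\<dots> = B * norm (inverse (3/2 - 1 :: complex) ^ Suc j * (fdiff ^^ j) u 0)"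
      by (simp add: norm_mult norm_power)
    finally show "norm (t j \<zeta>) \<le> B * norm (inverse (3/2 - 1 :: complex) ^ Suc j * (fdiff ^^ j) u 0)" .
  qed
  have "\<forall>\<^sub>F J in sequentially. (\<lambda>\<zeta>. \<Sum>j<J. t j \<zeta>) contour_integrable_on circlepath 1 (1/2)"
    using t_int by (intro always_eventually allI contour_integrable_sum) (auto simp: contour_integrable_on_def)
  from contour_integral_uniform_limit_circlepath(2)[OF this ul]
  have lim: "(\<lambda>J. contour_integral (circlepath 1 (1/2)) (\<lambda>\<zeta>. \<Sum>j<J. t j \<zeta>)) \<longlonglongrightarrow>
     contour_integral (circlepath 1 (1/2)) (\<lambda>\<zeta>. \<Sum>j. t j \<zeta>)" by simp
  have partial: "contour_integral (circlepath 1 (1/2)) (\<lambda>\<zeta>. \<Sum>j<J. t j \<zeta>) =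
     2 * of_real pi * \<i> * (\<Sum>j<J. of_real (s gchoose j) * b j)" for J
  proof -
    have "((\<lambda>\<zeta>. \<Sum>j<J. t j \<zeta>) has_contour_integral
        (\<Sum>j<J. b j * (2 * of_real pi * \<i> * of_real (s gchoose j)))) (circlepath 1 (1/2))"
      by (intro has_contour_integral_sum t_int) auto
    from contour_integral_unique[OF this] show ?thesis by (simp add: sum_distrib_left mult_ac)
  qed
  have lim': "(\<lambda>J. 2 * of_real pi * \<i> * (\<Sum>j<J. of_real (s gchoose j) * b j)) \<longlonglongrightarrow>
     2 * of_real pi * \<i> * cnj (newton u 0 s)"
  proof -
    have "(\<lambda>j. cnj (of_real (s gchoose j) * (fdiff ^^ j) u 0)) sums cnj (newton u 0 s)"
      unfolding sums_cnj newton_def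
      by (rule summable_sums[OF summable_norm_cancel[OF newton_summable[OF a u s]]])
    then have "(\<lambda>J. \<Sum>j<J. of_real (s gchoose j) * b j) \<longlonglongrightarrow> cnj (newton u 0 s)"
      by (simp add: sums_def b_def)
    then show ?thesis by (rule tendsto_mult_left)
  qed
  have "contour_integral (circlepath 1 (1/2)) (\<lambda>\<zeta>. \<Sum>j. t j \<zeta>) = 2 * of_real pi * \<i> * cnj (newton u 0 s)"
    by (rule LIMSEQ_unique[OF lim[unfolded partial] lim'])
  moreover have "contour_integral (circlepath 1 (1/2)) (\<lambda>\<zeta>. ?\<phi> \<zeta> * cnj (bshift_res (cnj \<zeta>) u 0)) =
     contour_integral (circlepath 1 (1/2)) (\<lambda>\<zeta>. \<Sum>j. t j \<zeta>)"
  proof (rule contour_integral_eq)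
    fix \<zeta> :: complex assume "\<zeta> \<in> path_image (circlepath 1 (1/2))"
    then have n: "norm (\<zeta> - 1) = 1/2" by (simp add: dist_norm norm_minus_commute)
    then have n': "norm (cnj \<zeta> - 1) = 1/2" by (metis complex_cnj_diff complex_cnj_one complex_mod_cnj)
    have "(\<lambda>j. inverse (cnj \<zeta> - 1) ^ Suc j * (fdiff ^^ j) u 0) sums bshift_res (cnj \<zeta>) u 0"
      unfolding bshift_res_def by (rule summable_sums[OF summable_norm_cancel[OF bshift_res_summable[OF a u n']]])
    then have "(\<lambda>j. cnj (inverse (cnj \<zeta> - 1) ^ Suc j * (fdiff ^^ j) u 0)) sums cnj (bshift_res (cnj \<zeta>) u 0)"
      by (subst sums_cnj)
    from sums_mult[OF this, of "?\<phi> \<zeta>"]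
    have "(\<lambda>j. t j \<zeta>) sums (?\<phi> \<zeta> * cnj (bshift_res (cnj \<zeta>) u 0))"
      by (simp add: t_def b_def field_simps)
    then show "?\<phi> \<zeta> * cnj (bshift_res (cnj \<zeta>) u 0) = (\<Sum>j. t j \<zeta>)" by (simp add: sums_iff)
  qed
  ultimately show ?thesis by simp
qed

text \<open>Sampling the orbit is sampling the interpolating function of the Taylor coefficients.\<close>

theorem comp_shift_power_kzero:
  assumes a: "a > 0" and s: "s \<ge> 0"
  shows "comp_shift_power a s (kzero a) \<in> model_space a"
    and "c \<in> model_seqs a \<Longrightarrow> hinner (series_fun c) (comp_shift_power a s (kzero a)) = newton c 0 s"
proof -
  have "\<exists>g\<in>model_seqs a. \<forall>u\<in>model_seqs a. sprod u g = newton u 0 s"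
  proof (rule model_seqs_riesz[OF a, where C = "exp (4 * a * (1 + s\<^sup>2)) * 2"])
    fix u v assume u: "u \<in> model_seqs a"
    show "newton (\<lambda>n. c * u n) 0 s = c * newton u 0 s" for c
      unfolding newton_def
      by (subst suminf_mult[OF summable_norm_cancel[OF newton_summable[OF a u s]], symmetric])
        (simp add: fdiff_pow_scale mult_ac)
    show "newton (\<lambda>n. u n + v n) 0 s = newton u 0 s + newton v 0 s" if v: "v \<in> model_seqs a"
      unfolding newton_def
      by (subst suminf_add[OF summable_norm_cancel[OF newton_summable[OF a u s]] summable_norm_cancel[OF newton_summable[OF a v s]]])
        (simp add: fdiff_pow_add distrib_left)
    have "(norm (newton u 0 s))\<^sup>2 \<le> exp (4 * a * (1 + s\<^sup>2)) * energy a u 0"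
      by (rule newton_bound[OF a u s]) auto
    also have "\<dots> \<le> exp (4 * a * (1 + s\<^sup>2)) * (2 * normsq u)"
      using energy_sum_le[OF a u, of 0] by (intro mult_left_mono) auto
    finally show "(norm (newton u 0 s))\<^sup>2 \<le> exp (4 * a * (1 + s\<^sup>2)) * 2 * normsq u" by simp
  qed auto
  then obtain g where g: "g \<in> model_seqs a" "\<And>u. u \<in> model_seqs a \<Longrightarrow> sprod u g = newton u 0 s" by blast
  let ?J = "\<lambda>u. contour_integral (circlepath 1 (1/2)) (\<lambda>\<zeta>. exp (of_real s * Ln \<zeta>) *
      hinner (resolvent (model_space a) (comp_shift a) \<zeta> (kzero a)) u) / (2 * of_real pi * \<i>)"
  have J: "?J (series_fun u) = sprod g u" if u: "u \<in> model_seqs a" for u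
  proof -
    have "contour_integral (circlepath 1 (1/2)) (\<lambda>\<zeta>. exp (of_real s * Ln \<zeta>) *
      hinner (resolvent (model_space a) (comp_shift a) \<zeta> (kzero a)) (series_fun u)) =
      contour_integral (circlepath 1 (1/2)) (\<lambda>\<zeta>. exp (of_real s * Ln \<zeta>) * cnj (bshift_res (cnj \<zeta>) u 0))"
    proof (rule contour_integral_eq)
      fix \<zeta> :: complex assume "\<zeta> \<in> path_image (circlepath 1 (1/2))"
      then have n: "norm (\<zeta> - 1) = 1/2" by (simp add: dist_norm norm_minus_commute)
      obtain r where r: "r \<in> model_seqs a" "resolvent (model_space a) (comp_shift a) \<zeta> (kzero a) = series_fun r"
        "\<And>u. u \<in> model_seqs a \<Longrightarrow> sprod r u = cnj (bshift_res (cnj \<zeta>) u 0)" using resolvent_kzero[OF a n] by blast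
      then show "exp (of_real s * Ln \<zeta>) * hinner (resolvent (model_space a) (comp_shift a) \<zeta> (kzero a)) (series_fun u) =
        exp (of_real s * Ln \<zeta>) * cnj (bshift_res (cnj \<zeta>) u 0)"
        using u by (simp add: hinner_series_fun model_seqs_sq_summable)
    qed
    moreover have "sprod g u = cnj (newton u 0 s)"
      using sprod_cnj[OF model_seqs_sq_summable[OF u] model_seqs_sq_summable[OF g(1)]] g(2)[OF u] by simp
    ultimately show ?thesis using power_contour_integral[OF a u s] by simp
  qed
  have "comp_shift_power a s (kzero a) = series_fun g"
    unfolding comp_shift_power_def holo_calc_def
  proof (rule the_equality)
    show "series_fun g \<in> model_space a \<and> (\<forall>u\<in>model_space a. hinner (series_fun g) u = ?J u)"
    proof (intro conjI ballI)
      show "series_fun g \<in> model_space a" using g(1) by (auto simp: model_space_eq[OF a])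
      fix u assume "u \<in> model_space a"
      then obtain v where v: "v \<in> model_seqs a" "u = series_fun v" by (auto simp: model_space_eq[OF a])
      show "hinner (series_fun g) u = ?J u" unfolding v(2) J[OF v(1)]
        by (intro hinner_series_fun model_seqs_sq_summable[OF g(1)] model_seqs_sq_summable[OF v(1)])
    qed
  next
    fix f assume f: "f \<in> model_space a \<and> (\<forall>u\<in>model_space a. hinner f u = ?J u)"
    then obtain v where v: "v \<in> model_seqs a" "f = series_fun v" by (auto simp: model_space_eq[OF a])
    have "v = g"
    proof (rule model_seqs_eqI[OF v(1) g(1)])
      fix x assume x: "x \<in> model_seqs a"
      then have "hinner f (series_fun x) = ?J (series_fun x)" using f by (auto simp: model_space_eq[OF a])
      then show "sprod v x = sprod g x" using J[OF x] x v by (simp add: hinner_series_fun model_seqs_sq_summable)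
    qed
    then show "f = series_fun g" using v by simp
  qed
  then show "comp_shift_power a s (kzero a) \<in> model_space a"
    and "c \<in> model_seqs a \<Longrightarrow> hinner (series_fun c) (comp_shift_power a s (kzero a)) = newton c 0 s"
    using g by (auto simp: model_space_eq[OF a] hinner_series_fun model_seqs_sq_summable)
qed

section \<open>A discrete Remez inequality\<close>

text \<open>The difference of the two sides has degree less than \<open>m\<close> and \<open>m\<close> zeros.\<close>

lemma lagrange_interpolation:
  fixes Q :: "complex poly" and y :: "nat \<Rightarrow> complex"
  assumes inj: "inj_on y {..<m}" and deg: "degree Q < m"
  shows "poly Q t = (\<Sum>i<m. poly Q (y i) * (\<Prod>j\<in>{..<m} - {i}. (t - y j) / (y i - y j)))"
proof -
  define l where "l = (\<lambda>i. \<Prod>j\<in>{..<m} - {i}. [:- y j / (y i - y j), 1 / (y i - y j):])"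
  have l: "poly (l i) t = (\<Prod>j\<in>{..<m} - {i}. (t - y j) / (y i - y j))" for i t
    by (simp add: l_def poly_prod diff_divide_distrib)
  have deg_l: "degree (l i) \<le> m - 1" if "i < m" for i
  proof -
    have "degree (l i) \<le> (\<Sum>j\<in>{..<m} - {i}. degree [:- y j / (y i - y j), 1 / (y i - y j):])"
      unfolding l_def using degree_prod_sum_le[of "{..<m} - {i}" "\<lambda>j. [:- y j / (y i - y j), 1 / (y i - y j):]"]
      by (simp add: o_def)
    also have "\<dots> \<le> (\<Sum>j\<in>{..<m} - {i}. 1)" by (intro sum_mono) auto
    finally show ?thesis using that by simp
  qed
  define R where "R = Q - (\<Sum>i<m. smult (poly Q (y i)) (l i))"
  have "degree R < m"
  proof -
    have "degree (\<Sum>i<m. smult (poly Q (y i)) (l i)) \<le> m - 1"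
      using deg_l by (intro degree_sum_le) (auto intro!: order_trans[OF degree_smult_le])
    then have "degree R \<le> m - 1" unfolding R_def using deg by (intro degree_diff_le) auto
    then show ?thesis using deg by linarith
  qed
  have root: "poly R (y k) = 0" if k: "k < m" for k
  proof -
    have "poly (l i) (y k) = (if i = k then 1 else 0)" if "i < m" for i
    proof (cases "i = k")
      case True
      have "(\<Prod>j\<in>{..<m} - {i}. (y i - y j) / (y i - y j)) = 1"
        using inj that by (intro prod.neutral) (auto simp: inj_on_def)
      then show ?thesis using True by (simp add: l)
    next
      case False
      then show ?thesis unfolding l using k by (auto intro!: prod_zero)
    qed
    then have "(\<Sum>i<m. poly Q (y i) * poly (l i) (y k)) = (\<Sum>i<m. if i = k then poly Q (y i) else 0)"
      by (intro sum.cong) auto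
    then show ?thesis using k by (simp add: R_def poly_sum)
  qed
  have "R = 0"
  proof (rule ccontr)
    assume "R \<noteq> 0"
    then have "card (y ` {..<m}) \<le> card {x. poly R x = 0}"
      using root by (intro card_mono poly_roots_finite) auto
    also have "\<dots> \<le> degree R" using \<open>R \<noteq> 0\<close> by (rule card_poly_roots_bound)
    finally show False using \<open>degree R < m\<close> card_image[OF inj] by simp
  qed
  then have "poly R t = 0" by simp
  then have "poly Q t = (\<Sum>i<m. poly Q (y i) * poly (l i) t)"
    unfolding R_def by (simp add: poly_sum)
  then show ?thesis by (simp only: l)
qed

lemma prod_distances_fact:
  assumes "i < m"
  shows "(\<Prod>j\<in>{..<m} - {i}. \<bar>real i - real j\<bar>) = fact i * fact (m - 1 - i)"
proof -
  have split: "{..<m} - {i} = {..<i} \<union> {Suc i..<m}" using assms by auto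
  have "(\<Prod>j\<in>{..<m} - {i}. \<bar>real i - real j\<bar>) =
      (\<Prod>j<i. \<bar>real i - real j\<bar>) * (\<Prod>j\<in>{Suc i..<m}. \<bar>real i - real j\<bar>)"
    unfolding split by (intro prod.union_disjoint) auto
  also have "(\<Prod>j<i. \<bar>real i - real j\<bar>) = (\<Prod>j\<in>{1..i}. real j)"
    by (rule prod.reindex_bij_witness[of _ "\<lambda>j. i - j" "\<lambda>j. i - j"]) auto
  also have "\<dots> = fact i" by (simp add: fact_prod)
  also have "(\<Prod>j\<in>{Suc i..<m}. \<bar>real i - real j\<bar>) = (\<Prod>j\<in>{1..m - 1 - i}. real j)"
    by (rule prod.reindex_bij_witness[of _ "\<lambda>j. i + j" "\<lambda>j. j - i"]) (use assms in auto)
  also have "\<dots> = fact (m - 1 - i)" by (simp add: fact_prod)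
  finally show ?thesis .
qed

lemma separated_interpolation_bound:
  fixes Q :: "complex poly" and y :: "nat \<Rightarrow> real"
  assumes deg: "degree Q < m" and \<delta>: "\<delta> > 0"
    and sep: "\<And>i j. i < j \<Longrightarrow> j < m \<Longrightarrow> y j - y i \<ge> \<delta> * (real j - real i)"
    and y: "\<And>i. i < m \<Longrightarrow> \<bar>t - y i\<bar> \<le> \<Lambda>"
  shows "(norm (poly Q (of_real t)))\<^sup>2 \<le>
     ((2 * \<Lambda> / \<delta>) ^ (m - 1) / fact (m - 1))\<^sup>2 * (\<Sum>i<m. (norm (poly Q (of_real (y i))))\<^sup>2)"
proof -
  define S where "S = (\<Sum>i<m. (norm (poly Q (of_real (y i))))\<^sup>2)"
  have m: "m > 0" using deg by simp
  have \<Lambda>0: "\<Lambda> \<ge> 0" using y[of 0] m by linarith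
  have dist: "\<bar>y i - y j\<bar> \<ge> \<delta> * \<bar>real i - real j\<bar>" if "i < m" "j < m" for i j
    using sep[of i j] sep[of j i] that by (cases i j rule: linorder_cases) (auto simp: abs_if algebra_simps)
  have inj: "inj_on (\<lambda>i. complex_of_real (y i)) {..<m}"
  proof (rule inj_onI)
    fix i j assume ij: "i \<in> {..<m}" "j \<in> {..<m}" "complex_of_real (y i) = of_real (y j)"
    then have "\<delta> * \<bar>real i - real j\<bar> \<le> 0" using dist[of i j] by simp
    then show "i = j" using \<delta> by (simp add: mult_le_0_iff)
  qed
  have bi: "norm (poly Q (of_real (y i))) \<le> sqrt S" if "i < m" for i
    unfolding S_def using that by (intro real_le_rsqrt member_le_sum) auto
  have factor: "norm (\<Prod>j\<in>{..<m} - {i}. (complex_of_real t - of_real (y j)) / (of_real (y i) - of_real (y j)))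
      \<le> (\<Lambda> / \<delta>) ^ (m - 1) / fact (m - 1) * real ((m - 1) choose i)" if i: "i < m" for i
  proof -
    have card: "card ({..<m} - {i}) = m - 1" using i by simp
    have "norm (\<Prod>j\<in>{..<m} - {i}. (complex_of_real t - of_real (y j)) / (of_real (y i) - of_real (y j))) =
        (\<Prod>j\<in>{..<m} - {i}. \<bar>t - y j\<bar> / \<bar>y i - y j\<bar>)"
      unfolding prod_norm[symmetric] norm_divide of_real_diff[symmetric] norm_of_real ..
    also have "\<dots> \<le> (\<Prod>j\<in>{..<m} - {i}. \<Lambda> / (\<delta> * \<bar>real i - real j\<bar>))"
      using i \<delta> \<Lambda>0 y dist by (intro prod_mono conjI frac_le mult_pos_pos) auto
    also have "\<dots> = (\<Prod>j\<in>{..<m} - {i}. \<Lambda> / \<delta>) / (\<Prod>j\<in>{..<m} - {i}. \<bar>real i - real j\<bar>)"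
      unfolding prod_dividef[symmetric] by (simp add: divide_divide_eq_left)
    also have "\<dots> = (\<Lambda> / \<delta>) ^ (m - 1) / (fact i * fact (m - 1 - i))"
      unfolding prod_distances_fact[OF i] prod_constant card ..
    also have "\<dots> = (\<Lambda> / \<delta>) ^ (m - 1) / fact (m - 1) * real ((m - 1) choose i)"
      using i by (subst binomial_fact) (auto simp: field_simps)
    finally show ?thesis .
  qed
  let ?K = "(\<Lambda> / \<delta>) ^ (m - 1) / fact (m - 1)"
  have K0: "?K \<ge> 0" using \<Lambda>0 \<delta> by auto
  have S0: "S \<ge> 0" unfolding S_def by (simp add: sum_nonneg)
  have "norm (poly Q (of_real t)) \<le> (\<Sum>i<m. sqrt S * (?K * real ((m - 1) choose i)))"
    unfolding lagrange_interpolation[OF inj deg, of "of_real t"]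
  proof (rule sum_norm_le)
    fix i assume "i \<in> {..<m}"
    then show "norm (poly Q (of_real (y i)) * (\<Prod>j\<in>{..<m} - {i}. (complex_of_real t - of_real (y j)) / (of_real (y i) - of_real (y j))))
        \<le> sqrt S * (?K * real ((m - 1) choose i))"
      unfolding norm_mult using bi factor by (intro mult_mono) (auto simp: S0)
  qed
  also have "\<dots> = sqrt S * ?K * (\<Sum>i<m. real ((m - 1) choose i))"
    by (simp add: sum_distrib_left mult.assoc)
  also have "(\<Sum>i<m. real ((m - 1) choose i)) = 2 ^ (m - 1)"
  proof -
    have "{..<m} = {..m - 1}" using m by auto
    then show ?thesis using choose_row_sum[of "m - 1"] by (metis of_nat_sum of_nat_power of_nat_numeral)
  qed
  finally have "norm (poly Q (of_real t)) \<le> sqrt S * ?K * 2 ^ (m - 1)" .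
  then have "(norm (poly Q (of_real t)))\<^sup>2 \<le> (sqrt S * ?K * 2 ^ (m - 1))\<^sup>2" by (intro power_mono) auto
  also have "\<dots> = ((2 * \<Lambda> / \<delta>) ^ (m - 1) / fact (m - 1))\<^sup>2 * S"
    using S0 by (simp add: power_mult_distrib power_divide)
  finally show ?thesis unfolding S_def .
qed

text \<open>A polynomial of degree less than \<open>m\<close> is controlled by its mean square over a finite family of
  points that do not accumulate. Sort the points; every \<open>r\<close>-th point gives a node set with
  separation proportional to \<open>r\<close>, and averaging over the \<open>r\<close> offsets uses all points.\<close>

lemma discrete_remez:
  fixes Q :: "complex poly" and x :: "'i \<Rightarrow> real" and M :: real
  assumes deg: "degree Q < m" and E: "finite E" and M: "M > 0"
    and cnt: "\<And>u v. u \<le> v \<Longrightarrow> real (card {k\<in>E. u \<le> x k \<and> x k \<le> v}) \<le> M * (v - u + 2)"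
    and r: "real r \<ge> 4 * M" and rm: "r * m \<le> card E"
    and \<Lambda>: "\<And>k. k \<in> E \<Longrightarrow> \<bar>t - x k\<bar> \<le> \<Lambda>"
  shows "real r * (norm (poly Q (of_real t)))\<^sup>2 \<le>
     ((4 * M * \<Lambda> / real r) ^ (m - 1) / fact (m - 1))\<^sup>2 * (\<Sum>k\<in>E. (norm (poly Q (of_real (x k))))\<^sup>2)"
proof -
  obtain xs where xs: "set xs = E" "distinct xs" using finite_distinct_list[OF E] by blast
  define ys where "ys = sort_key x xs"
  have ys: "set ys = E" "distinct ys" "sorted (map x ys)" using xs by (auto simp: ys_def)
  have len: "length ys = card E" using ys distinct_card by metis
  define e where "e = (\<lambda>i. ys ! i)"
  have eE: "e i \<in> E" if "i < card E" for i using ys that len by (auto simp: e_def)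
  have einj: "e i = e j \<longleftrightarrow> i = j" if "i < card E" "j < card E" for i j
    using nth_eq_iff_index_eq[OF ys(2)] that len by (simp add: e_def)
  have mono: "x (e i) \<le> x (e j)" if "i \<le> j" "j < card E" for i j
    using sorted_nth_mono[OF ys(3) that(1)] that len by (simp add: e_def)
  have bij: "bij_betw e {..<card E} E"
    unfolding e_def len[symmetric] using bij_betw_nth[OF ys(2) refl ys(1)[symmetric]] .
  have gap: "real (j - i + 1) \<le> M * (x (e j) - x (e i) + 2)" if "i \<le> j" "j < card E" for i j
  proof -
    have "e ` {i..j} \<subseteq> {k\<in>E. x (e i) \<le> x k \<and> x k \<le> x (e j)}"
      using that eE mono by auto
    then have "card (e ` {i..j}) \<le> card {k\<in>E. x (e i) \<le> x k \<and> x k \<le> x (e j)}"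
      using E by (intro card_mono) auto
    moreover have "card (e ` {i..j}) = card {i..j}" using einj that by (intro card_image inj_onI) auto
    ultimately have "real (j - i + 1) \<le> real (card {k\<in>E. x (e i) \<le> x k \<and> x k \<le> x (e j)})"
      using that by simp
    also have "\<dots> \<le> M * (x (e j) - x (e i) + 2)" by (rule cnt[OF mono[OF that]])
    finally show ?thesis .
  qed
  have r0: "real r > 0" using r M by linarith
  define \<delta> where "\<delta> = real r / (2 * M)"
  have \<delta>: "\<delta> > 0" using r0 M by (simp add: \<delta>_def)
  have idx: "p + i * r < card E" if "p < r" "i < m" for p i
  proof -
    have "p + i * r < r + i * r" using that by simp
    also have "\<dots> = Suc i * r" by simp
    also have "\<dots> \<le> m * r" using that by (intro mult_le_mono1) auto
    finally show ?thesis using rm by (simp add: mult.commute)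
  qed
  have one: "(norm (poly Q (of_real t)))\<^sup>2 \<le> ((2 * \<Lambda> / \<delta>) ^ (m - 1) / fact (m - 1))\<^sup>2 *
      (\<Sum>i<m. (norm (poly Q (of_real (x (e (p + i * r))))))\<^sup>2)" if p: "p < r" for p
  proof (rule separated_interpolation_bound[OF deg \<delta>])
    fix i j assume ij: "i < j" "j < m"
    define d where "d = real j - real i"
    have d1: "d \<ge> 1" using ij by (auto simp: d_def)
    have "real (p + j * r - (p + i * r) + 1) = real r * d + 1"
      using ij mult_le_mono1[of i j r] by (simp add: d_def of_nat_diff algebra_simps)
    then have "real r * d \<le> M * (x (e (p + j * r)) - x (e (p + i * r)) + 2)"
      using gap[of "p + i * r" "p + j * r"] idx[OF p ij(2)] ij by simp
    then have g: "real r * d / M \<le> x (e (p + j * r)) - x (e (p + i * r)) + 2"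
      using M by (simp add: divide_le_eq mult.commute)
    define w where "w = real r * d / (2 * M)"
    have "4 * M * 1 \<le> real r * d" using r d1 M by (intro mult_mono) auto
    then have "2 \<le> w" using M by (simp add: w_def le_divide_eq)
    moreover have "real r * d / M = 2 * w" using M by (simp add: w_def)
    moreover have "\<delta> * (real j - real i) = w" by (simp add: \<delta>_def d_def w_def)
    moreover define X where "X = x (e (p + j * r)) - x (e (p + i * r))"
    ultimately show "\<delta> * (real j - real i) \<le> x (e (p + j * r)) - x (e (p + i * r))"
      using g unfolding X_def[symmetric] by linarith
  qed (use \<Lambda> eE idx p in auto)
  define f where "f = (\<lambda>l. (norm (poly Q (of_real (x (e l)))))\<^sup>2)"
  define A where "A = ((2 * \<Lambda> / \<delta>) ^ (m - 1) / fact (m - 1))\<^sup>2"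
  have "real r * (norm (poly Q (of_real t)))\<^sup>2 = (\<Sum>p<r. (norm (poly Q (of_real t)))\<^sup>2)" by simp
  also have "\<dots> \<le> (\<Sum>p<r. A * (\<Sum>i<m. f (p + i * r)))"
    unfolding A_def f_def by (intro sum_mono one) auto
  also have "\<dots> = A * (\<Sum>i<m. \<Sum>p<r. f (p + i * r))"
    by (subst sum.swap) (simp add: sum_distrib_left)
  finally have avg: "real r * (norm (poly Q (of_real t)))\<^sup>2 \<le> A * (\<Sum>i<m. \<Sum>p<r. f (p + i * r))" .
  have "(\<Sum>i<m. \<Sum>p<r. f (p + i * r)) = (\<Sum>i<m. sum f {i * r..<i * r + r})"
  proof (rule sum.cong[OF refl])
    fix i show "(\<Sum>p<r. f (p + i * r)) = sum f {i * r..<i * r + r}"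
      using sum.shift_bounds_nat_ivl[of f 0 "i * r" r] by (simp add: lessThan_atLeast0 add.commute)
  qed
  also have "\<dots> = sum f {..<m * r}" by (rule sum.nat_group)
  also have "\<dots> \<le> sum f {..<card E}" using rm by (intro sum_mono2) (auto simp: f_def mult.commute)
  also have "\<dots> = (\<Sum>k\<in>E. (norm (poly Q (of_real (x k))))\<^sup>2)"
    unfolding f_def by (rule sum.reindex_bij_betw[OF bij])
  finally have le: "A * (\<Sum>i<m. \<Sum>p<r. f (p + i * r)) \<le> A * (\<Sum>k\<in>E. (norm (poly Q (of_real (x k))))\<^sup>2)"
    by (intro mult_left_mono) (auto simp: A_def)
  have "2 * \<Lambda> / \<delta> = 4 * M * \<Lambda> / real r" by (simp add: \<delta>_def)
  then have "A = ((4 * M * \<Lambda> / real r) ^ (m - 1) / fact (m - 1))\<^sup>2" by (simp only: A_def)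
  then show ?thesis using order_trans[OF avg le] by (simp only:)
qed

section \<open>Sampling families\<close>

text \<open>Bounded unit-cell multiplicity with a named bound. Requiring the bound to be at least \<open>1\<close> keeps
  it usable as a denominator.\<close>

definition cell_mult :: "'i set \<Rightarrow> ('i \<Rightarrow> real) \<Rightarrow> nat \<Rightarrow> bool" where
  "cell_mult I s M \<longleftrightarrow> M \<ge> 1 \<and> (\<forall>k\<in>I. 0 \<le> s k) \<and>
     (\<forall>n. finite {k\<in>I. nat \<lfloor>s k\<rfloor> = n} \<and> card {k\<in>I. nat \<lfloor>s k\<rfloor> = n} \<le> M)"

lemma bounded_cell_mult_imp:
  assumes "temporal_multiseq I s" "bounded_cell_mult I s"
  obtains M where "cell_mult I s M"
proof -
  have s0: "0 \<le> s k" if "k \<in> I" for k using assms(1) that by (auto simp: temporal_multiseq_def)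
  obtain M where M: "\<And>n. finite {k\<in>I. s k \<in> {real n..<real n + 1}} \<and> card {k\<in>I. s k \<in> {real n..<real n + 1}} \<le> M"
    using assms(2) unfolding bounded_cell_mult_def by blast
  have "{k\<in>I. nat \<lfloor>s k\<rfloor> = n} = {k\<in>I. s k \<in> {real n..<real n + 1}}" for n
  proof -
    have "nat \<lfloor>s k\<rfloor> = n \<longleftrightarrow> s k \<in> {real n..<real n + 1}" if "k \<in> I" for k
      using s0[OF that] by (auto simp: nat_eq_iff floor_eq_iff)
    then show ?thesis by auto
  qed
  then have "cell_mult I s (max 1 M)" using M s0 by (auto simp: cell_mult_def le_max_iff_disj)
  then show ?thesis using that by blast
qed

lemma cell_mult_sum:
  fixes g :: "nat \<Rightarrow> real"
  assumes M: "cell_mult I s M" and F: "finite F" "F \<subseteq> I" and g: "\<And>n. g n \<ge> 0"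
  shows "(\<Sum>k\<in>F. g (nat \<lfloor>s k\<rfloor>)) \<le> real M * (\<Sum>n\<in>(\<lambda>k. nat \<lfloor>s k\<rfloor>) ` F. g n)"
proof -
  let ?c = "\<lambda>k. nat \<lfloor>s k\<rfloor>"
  have "(\<Sum>k\<in>F. g (?c k)) = (\<Sum>n\<in>?c ` F. \<Sum>k\<in>{k\<in>F. ?c k = n}. g (?c k))"
    by (rule sum.image_gen[OF F(1)])
  also have "\<dots> = (\<Sum>n\<in>?c ` F. real (card {k\<in>F. ?c k = n}) * g n)"
    by (intro sum.cong refl) simp
  also have "\<dots> \<le> (\<Sum>n\<in>?c ` F. real M * g n)"
  proof (intro sum_mono mult_right_mono g)
    fix n
    have "card {k\<in>F. ?c k = n} \<le> card {k\<in>I. ?c k = n}"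
      using M F by (intro card_mono) (auto simp: cell_mult_def)
    also have "\<dots> \<le> M" using M by (auto simp: cell_mult_def)
    finally show "real (card {k\<in>F. ?c k = n}) \<le> real M" by simp
  qed
  finally show ?thesis by (simp add: sum_distrib_left)
qed

lemma cell_mult_card:
  assumes M: "cell_mult I s M"
  shows "finite {k\<in>I. nat \<lfloor>s k\<rfloor> \<in> {p..<q}}" and "card {k\<in>I. nat \<lfloor>s k\<rfloor> \<in> {p..<q}} \<le> M * (q - p)"
proof -
  have eq: "{k\<in>I. nat \<lfloor>s k\<rfloor> \<in> {p..<q}} = (\<Union>n\<in>{p..<q}. {k\<in>I. nat \<lfloor>s k\<rfloor> = n})" by auto
  show "finite {k\<in>I. nat \<lfloor>s k\<rfloor> \<in> {p..<q}}" unfolding eq using M by (auto simp: cell_mult_def)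
  have "card {k\<in>I. nat \<lfloor>s k\<rfloor> \<in> {p..<q}} \<le> (\<Sum>n\<in>{p..<q}. card {k\<in>I. nat \<lfloor>s k\<rfloor> = n})"
    unfolding eq by (rule card_UN_le) auto
  also have "\<dots> \<le> (\<Sum>n\<in>{p..<q}. M)" using M by (intro sum_mono) (auto simp: cell_mult_def)
  finally show "card {k\<in>I. nat \<lfloor>s k\<rfloor> \<in> {p..<q}} \<le> M * (q - p)" by (simp add: mult.commute)
qed

lemma cell_mult_interval:
  assumes M: "cell_mult I s M" and uv: "u \<le> v"
  shows "real (card {k\<in>I. u \<le> s k \<and> s k \<le> v}) \<le> real M * (v - u + 2)"
proof (cases "0 \<le> v")
  case True
  let ?p = "nat \<lfloor>max u 0\<rfloor>" and ?q = "Suc (nat \<lfloor>v\<rfloor>)"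
  have s0: "0 \<le> s k" if "k \<in> I" for k using M that by (auto simp: cell_mult_def)
  have "{k\<in>I. u \<le> s k \<and> s k \<le> v} \<subseteq> {k\<in>I. nat \<lfloor>s k\<rfloor> \<in> {?p..<?q}}"
    using s0 by (auto intro!: nat_mono floor_mono simp: less_Suc_eq_le)
  then have "card {k\<in>I. u \<le> s k \<and> s k \<le> v} \<le> M * (?q - ?p)"
    using cell_mult_card[OF M, of ?p ?q] card_mono[of "{k\<in>I. nat \<lfloor>s k\<rfloor> \<in> {?p..<?q}}"] by (meson order_trans)
  then have "real (card {k\<in>I. u \<le> s k \<and> s k \<le> v}) \<le> real M * real (?q - ?p)"
    by (metis of_nat_le_iff of_nat_mult)
  also have "real (?q - ?p) \<le> v - u + 2"
  proof -
    have "?p \<le> ?q" using uv True by (intro le_SucI nat_mono floor_mono) auto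
    then have "real (?q - ?p) = real ?q - real ?p" by (rule of_nat_diff)
    moreover have "real ?q \<le> v + 1" using True by simp
    moreover have "real ?p \<ge> u - 1" using real_of_int_floor_ge_diff_one[of "max u 0"] by (simp, linarith)
    ultimately show ?thesis by linarith
  qed
  finally show ?thesis by (simp add: mult_left_mono)
next
  case False
  then have empty: "{k\<in>I. u \<le> s k \<and> s k \<le> v} = {}" using M by (force simp: cell_mult_def)
  show ?thesis unfolding empty using uv by simp
qed

text \<open>Each sample is read off from the Newton series started at the left end of its cell.\<close>

lemma newton_cell:
  assumes "a > 0" "c \<in> model_seqs a" "s \<ge> 0"
  obtains \<sigma> where "0 \<le> \<sigma>" "\<sigma> \<le> 1" "s = real (nat \<lfloor>s\<rfloor>) + \<sigma>" "newton c 0 s = newton c (nat \<lfloor>s\<rfloor>) \<sigma>"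
proof -
  define \<sigma> where "\<sigma> = s - real (nat \<lfloor>s\<rfloor>)"
  have "0 \<le> \<sigma>" "\<sigma> \<le> 1" using assms(3) unfolding \<sigma>_def by (simp, linarith)+
  moreover have "s = real (nat \<lfloor>s\<rfloor>) + \<sigma>" by (simp add: \<sigma>_def)
  moreover have "newton c 0 s = newton c (nat \<lfloor>s\<rfloor>) \<sigma>"
    using newton_base[OF assms(1,2) \<open>0 \<le> \<sigma>\<close>, of 0 "nat \<lfloor>s\<rfloor>"] by (simp add: \<sigma>_def)
  ultimately show ?thesis using that by blast
qed

lemma bessel_bound:
  assumes a: "a > 0" and c: "c \<in> model_seqs a" and M: "cell_mult I s M" and F: "finite F" "F \<subseteq> I"
  shows "(\<Sum>k\<in>F. (norm (newton c 0 (s k)))\<^sup>2) \<le> real M * exp (4 * a) * 2 * normsq c"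
proof -
  have "(\<Sum>k\<in>F. (norm (newton c 0 (s k)))\<^sup>2) \<le> (\<Sum>k\<in>F. exp (4 * a) * energy a c (nat \<lfloor>s k\<rfloor>))"
  proof (rule sum_mono)
    fix k assume "k \<in> F"
    then have s0: "s k \<ge> 0" using M F by (auto simp: cell_mult_def)
    obtain \<sigma> where \<sigma>: "0 \<le> \<sigma>" "\<sigma> \<le> 1" "newton c 0 (s k) = newton c (nat \<lfloor>s k\<rfloor>) \<sigma>"
      using newton_cell[OF a c s0] by metis
    have "\<sigma>\<^sup>2 \<le> 1 * real (Suc (nat \<lfloor>s k\<rfloor>))" using \<sigma> power_le_one[of \<sigma> 2] by simp
    from newton_bound[OF a c \<sigma>(1) this] show "(norm (newton c 0 (s k)))\<^sup>2 \<le> exp (4 * a) * energy a c (nat \<lfloor>s k\<rfloor>)"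
      using \<sigma>(3) by simp
  qed
  also have "\<dots> = exp (4 * a) * (\<Sum>k\<in>F. energy a c (nat \<lfloor>s k\<rfloor>))" by (simp add: sum_distrib_left)
  also have "\<dots> \<le> exp (4 * a) * (real M * (\<Sum>n\<in>(\<lambda>k. nat \<lfloor>s k\<rfloor>) ` F. energy a c n))"
    by (intro mult_left_mono cell_mult_sum[OF M F] energy_nonneg a c) auto
  also have "\<dots> \<le> exp (4 * a) * (real M * (2 * normsq c))"
    using F by (intro mult_left_mono energy_sum_finite_le a c) auto
  finally show ?thesis by (simp add: mult_ac)
qed

lemma samples_summable:
  assumes a: "a > 0" and c: "c \<in> model_seqs a" and M: "cell_mult I s M"
  shows "(\<lambda>k. (norm (newton c 0 (s k)))\<^sup>2) summable_on I"
    and "(\<Sum>\<^sub>\<infinity>k\<in>I. (norm (newton c 0 (s k)))\<^sup>2) \<le> real M * exp (4 * a) * 2 * normsq c"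
proof -
  show sm: "(\<lambda>k. (norm (newton c 0 (s k)))\<^sup>2) summable_on I"
    by (rule nonneg_bdd_above_summable_on) (auto intro!: bdd_aboveI2 bessel_bound[OF a c M])
  show "(\<Sum>\<^sub>\<infinity>k\<in>I. (norm (newton c 0 (s k)))\<^sup>2) \<le> real M * exp (4 * a) * 2 * normsq c"
    by (rule infsum_le_finite_sums[OF sm]) (rule bessel_bound[OF a c M])
qed

text \<open>The upper frame bound always holds under bounded multiplicity, so only the lower one matters.\<close>

definition lower_frame :: "real \<Rightarrow> 'i set \<Rightarrow> ('i \<Rightarrow> real) \<Rightarrow> bool" where
  "lower_frame a I s \<longleftrightarrow>
     (\<exists>A>0. \<forall>c\<in>model_seqs a. A * normsq c \<le> (\<Sum>\<^sub>\<infinity>k\<in>I. (norm (newton c 0 (s k)))\<^sup>2))"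

lemma hframe_iff_lower_frame:
  assumes a: "a > 0" and M: "cell_mult I s M"
  shows "hframe (model_space a) I (\<lambda>k. comp_shift_power a (s k) (kzero a)) \<longleftrightarrow> lower_frame a I s"
proof -
  let ?f = "\<lambda>k. comp_shift_power a (s k) (kzero a)"
  have s0: "0 \<le> s k" if "k \<in> I" for k using M that by (auto simp: cell_mult_def)
  have mem: "\<forall>k\<in>I. ?f k \<in> model_space a" using comp_shift_power_kzero(1)[OF a] s0 by blast
  have sprod: "(norm (hinner (series_fun c) (?f k)))\<^sup>2 = (norm (newton c 0 (s k)))\<^sup>2" if "c \<in> model_seqs a" "k \<in> I" for c k
    using comp_shift_power_kzero(2)[OF a s0[OF that(2)] that(1)] by simp
  have sum_eq: "(\<Sum>\<^sub>\<infinity>k\<in>I. (norm (hinner (series_fun c) (?f k)))\<^sup>2) = (\<Sum>\<^sub>\<infinity>k\<in>I. (norm (newton c 0 (s k)))\<^sup>2)"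
    if "c \<in> model_seqs a" for c using sprod that by (intro infsum_cong) auto
  have smm: "(\<lambda>k. (norm (hinner (series_fun c) (?f k)))\<^sup>2) summable_on I" if "c \<in> model_seqs a" for c
    using samples_summable(1)[OF a that M] sprod[OF that] by (subst summable_on_cong) auto
  have nm: "(hnorm (series_fun c))\<^sup>2 = normsq c" if "c \<in> model_seqs a" for c
    using hnorm_series_fun[OF model_seqs_sq_summable[OF that]] .
  show ?thesis
  proof
    assume "hframe (model_space a) I ?f"
    then obtain A B where "0 < A" and A: "\<And>h. h \<in> model_space a \<Longrightarrow>
        A * (hnorm h)\<^sup>2 \<le> (\<Sum>\<^sub>\<infinity>k\<in>I. (norm (hinner h (?f k)))\<^sup>2)" unfolding hframe_def by blast
    have "A * normsq c \<le> (\<Sum>\<^sub>\<infinity>k\<in>I. (norm (newton c 0 (s k)))\<^sup>2)" if "c \<in> model_seqs a" for c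
      using A[of "series_fun c"] sum_eq[OF that] nm[OF that] that by (auto simp: model_space_eq[OF a])
    then show "lower_frame a I s" using \<open>0 < A\<close> unfolding lower_frame_def by blast
  next
    assume "lower_frame a I s"
    then obtain A where A: "A > 0" "\<And>c. c \<in> model_seqs a \<Longrightarrow> A * normsq c \<le> (\<Sum>\<^sub>\<infinity>k\<in>I. (norm (newton c 0 (s k)))\<^sup>2)"
      unfolding lower_frame_def by blast
    define B where "B = max A (real M * exp (4 * a) * 2)"
    have "(\<lambda>k. (norm (hinner h (?f k)))\<^sup>2) summable_on I \<and>
        A * (hnorm h)\<^sup>2 \<le> (\<Sum>\<^sub>\<infinity>k\<in>I. (norm (hinner h (?f k)))\<^sup>2) \<and>
        (\<Sum>\<^sub>\<infinity>k\<in>I. (norm (hinner h (?f k)))\<^sup>2) \<le> B * (hnorm h)\<^sup>2" if h: "h \<in> model_space a" for h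
    proof -
      obtain c where c: "c \<in> model_seqs a" "h = series_fun c" using h by (auto simp: model_space_eq[OF a])
      have "real M * exp (4 * a) * 2 * normsq c \<le> B * normsq c"
        unfolding B_def by (intro mult_right_mono normsq_nonneg model_seqs_sq_summable[OF c(1)]) auto
      then show ?thesis unfolding c(2) sum_eq[OF c(1)] nm[OF c(1)]
        using smm[OF c(1)] A(2)[OF c(1)] samples_summable(2)[OF a c(1) M] by auto
    qed
    then show "hframe (model_space a) I ?f"
      unfolding hframe_def using mem A(1) by (intro conjI exI[of _ A] exI[of _ B]) (auto simp: B_def)
  qed
qed

section \<open>Density implies the lower frame bound\<close>

text \<open>The cells \<open>[n, n+1)\<close> with \<open>L i \<le> sqrt n < L (i+1)\<close>. In the variable \<open>sqrt s\<close>, equivalently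
  in \<open>\<omega>(s)\<close>, these are intervals of constant length \<open>L\<close> containing about \<open>2 L\<^sup>2 i\<close> cells.\<close>

definition block :: "'i set \<Rightarrow> ('i \<Rightarrow> real) \<Rightarrow> nat \<Rightarrow> nat \<Rightarrow> 'i set" where
  "block I s L i = {k\<in>I. nat \<lfloor>s k\<rfloor> \<in> {(L * i)\<^sup>2..<(L * (i + 1))\<^sup>2}}"

definition sqrt_dense :: "'i set \<Rightarrow> ('i \<Rightarrow> real) \<Rightarrow> bool" where
  "sqrt_dense I s \<longleftrightarrow> (\<exists>L\<ge>1. \<exists>\<gamma>>0. \<exists>i0. \<forall>i\<ge>i0. \<gamma> * real i \<le> real (card (block I s L i)))"

lemma card_block_le:
  assumes "cell_mult I s M"
  shows "finite (block I s L i)" "card (block I s L i) \<le> M * (L\<^sup>2 * (2 * i + 1))"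
proof -
  have "(L * (i + 1))\<^sup>2 - (L * i)\<^sup>2 = L\<^sup>2 * (2 * i + 1)" by (simp add: power2_eq_square algebra_simps)
  then show "finite (block I s L i)" "card (block I s L i) \<le> M * (L\<^sup>2 * (2 * i + 1))"
    using cell_mult_card[OF assms, of "(L * i)\<^sup>2" "(L * (i + 1))\<^sup>2"] by (auto simp: block_def)
qed

lemma block_disjoint:
  assumes "i \<noteq> j"
  shows "block I s L i \<inter> block I s L j = {}"
proof -
  have "False" if ij: "i < j" and k: "k \<in> block I s L i" "k \<in> block I s L j" for i j k
  proof -
    have "(L * (i + 1))\<^sup>2 \<le> (L * j)\<^sup>2" using ij by (intro power_mono mult_le_mono2) auto
    moreover have "nat \<lfloor>s k\<rfloor> < (L * (i + 1))\<^sup>2" "(L * j)\<^sup>2 \<le> nat \<lfloor>s k\<rfloor>"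
      using k by (simp_all add: block_def)
    ultimately show False by linarith
  qed
  then show ?thesis using assms by (metis disjoint_iff nat_neq_iff)
qed

definition newton_poly :: "(nat \<Rightarrow> complex) \<Rightarrow> nat \<Rightarrow> nat \<Rightarrow> complex poly" where
  "newton_poly c N m = (\<Sum>j<m. smult ((fdiff ^^ j) c N / fact j) (\<Prod>l<j. [:- of_nat (N + l), 1:]))"

lemma degree_newton_poly: "m \<ge> 1 \<Longrightarrow> degree (newton_poly c N m) < m"
proof -
  assume m: "m \<ge> 1"
  have deg: "degree (\<Prod>l<j. [:- of_nat (N + l), 1 :: complex:]) \<le> m - 1" if "j < m" for j
    using degree_prod_sum_le[of "{..<j}" "\<lambda>l. [:- of_nat (N + l), 1 :: complex:]"] that by (simp add: o_def)
  have "degree (newton_poly c N m) \<le> m - 1" unfolding newton_poly_def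
    by (intro degree_sum_le) (use deg in \<open>auto intro!: order_trans[OF degree_smult_le]\<close>)
  then show ?thesis using m by linarith
qed

lemma poly_newton_poly:
  "poly (newton_poly c N m) (of_real x) = (\<Sum>j<m. of_real ((x - real N) gchoose j) * (fdiff ^^ j) c N)"
proof -
  have "of_real ((x - real N) gchoose j) = (\<Prod>l<j. complex_of_real x - of_nat N - of_nat l) / fact j" for j
    by (simp add: gbinomial_prod_rev lessThan_atLeast0)
  then show ?thesis by (simp add: newton_poly_def poly_sum poly_prod algebra_simps)
qed

lemma newton_poly_remainder:
  assumes "a > 0" "c \<in> model_seqs a" "real N \<le> x" "(x - real N)\<^sup>2 \<le> C * real (Suc N)" "C \<ge> 1"
  shows "(norm (newton c 0 x - poly (newton_poly c N m) (of_real x)))\<^sup>2 \<le> exp_tail m (4 * a * C) * energy a c N"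
proof -
  have "newton c 0 x = newton c N (x - real N)"
    using newton_base[OF assms(1,2), of "x - real N" 0 N] assms(3) by simp
  then show ?thesis using newton_remainder[OF assms(1,2) _ assms(4,5), of m] assms(3)
    by (simp add: poly_newton_poly)
qed

text \<open>The Remez inequality applied to a polynomial that approximates the interpolating function up to a
  squared error \<open>\<delta>\<close>, both at the sampling points and at the target.\<close>

lemma window_estimate:
  fixes f :: "real \<Rightarrow> complex"
  assumes M: "cell_mult I s M" and E: "finite E" "E \<subseteq> I" and deg: "degree Q < m"
    and r: "r \<ge> 4 * M" and rm: "r * m \<le> card E"
    and \<Lambda>: "\<And>k. k \<in> E \<Longrightarrow> \<bar>t - s k\<bar> \<le> \<Lambda>"
    and \<delta>t: "(norm (f t - poly Q (of_real t)))\<^sup>2 \<le> \<delta>"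
    and \<delta>s: "\<And>k. k \<in> E \<Longrightarrow> (norm (f (s k) - poly Q (of_real (s k))))\<^sup>2 \<le> \<delta>"
    and A: "((4 * real M * \<Lambda> / real r) ^ (m - 1) / fact (m - 1))\<^sup>2 \<le> A"
  shows "real r * (norm (f t))\<^sup>2 \<le> 4 * A * (\<Sum>k\<in>E. (norm (f (s k)))\<^sup>2) + (4 * A * real (card E) + 2 * real r) * \<delta>"
proof -
  let ?A = "((4 * real M * \<Lambda> / real r) ^ (m - 1) / fact (m - 1))\<^sup>2"
  have M1: "M \<ge> 1" using M by (simp add: cell_mult_def)
  have "real r * (norm (poly Q (of_real t)))\<^sup>2 \<le> ?A * (\<Sum>k\<in>E. (norm (poly Q (of_real (s k))))\<^sup>2)"
  proof (rule discrete_remez[OF deg E(1) _ _ _ rm \<Lambda>])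
    fix u v :: real assume uv: "u \<le> v"
    have "real (card {k\<in>E. u \<le> s k \<and> s k \<le> v}) \<le> real (card {k\<in>I. u \<le> s k \<and> s k \<le> v})"
    proof -
      have "finite {k\<in>I. u \<le> s k \<and> s k \<le> v}"
      proof (rule finite_subset)
        show "{k\<in>I. u \<le> s k \<and> s k \<le> v} \<subseteq> {k\<in>I. nat \<lfloor>s k\<rfloor> \<in> {0..<Suc (nat \<lfloor>v\<rfloor>)}}"
          by (auto intro!: nat_mono floor_mono simp: less_Suc_eq_le)
      qed (rule cell_mult_card[OF M])
      then show ?thesis using E by (intro of_nat_mono card_mono) auto
    qed
    also have "\<dots> \<le> real M * (v - u + 2)" by (rule cell_mult_interval[OF M uv])
    finally show "real (card {k\<in>E. u \<le> s k \<and> s k \<le> v}) \<le> real M * (v - u + 2)" .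
  qed (use M1 r in auto)
  also have "\<dots> \<le> A * (\<Sum>k\<in>E. (norm (poly Q (of_real (s k))))\<^sup>2)"
    by (intro mult_right_mono A sum_nonneg) auto
  also have "\<dots> \<le> A * (\<Sum>k\<in>E. 2 * (norm (f (s k)))\<^sup>2 + 2 * \<delta>)"
  proof (intro mult_left_mono sum_mono)
    fix k assume k: "k \<in> E"
    have "(norm (poly Q (of_real (s k))))\<^sup>2 \<le> 2 * (norm (f (s k)))\<^sup>2 + 2 * (norm (poly Q (of_real (s k)) - f (s k)))\<^sup>2"
      using norm_add_sq_le[of "f (s k)" "poly Q (of_real (s k)) - f (s k)"] by simp
    then show "(norm (poly Q (of_real (s k))))\<^sup>2 \<le> 2 * (norm (f (s k)))\<^sup>2 + 2 * \<delta>"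
      using \<delta>s[OF k] by (simp add: norm_minus_commute)
  qed (use A order_trans[OF zero_le_power2] in blast)
  finally have P: "real r * (norm (poly Q (of_real t)))\<^sup>2 \<le>
      A * (2 * (\<Sum>k\<in>E. (norm (f (s k)))\<^sup>2) + real (card E) * (2 * \<delta>))"
    by (simp add: sum.distrib sum_distrib_left)
  have "(norm (f t))\<^sup>2 \<le> 2 * (norm (poly Q (of_real t)))\<^sup>2 + 2 * \<delta>"
    using norm_add_sq_le[of "poly Q (of_real t)" "f t - poly Q (of_real t)"] \<delta>t by simp
  then have "real r * (norm (f t))\<^sup>2 \<le> real r * (2 * (norm (poly Q (of_real t)))\<^sup>2 + 2 * \<delta>)"
    by (intro mult_left_mono) auto
  also have "\<dots> = 2 * (real r * (norm (poly Q (of_real t)))\<^sup>2) + 2 * real r * \<delta>" by (simp add: algebra_simps)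
  finally show ?thesis using P by (simp add: algebra_simps)
qed

definition remez_const :: "real \<Rightarrow> nat \<Rightarrow> real" where
  "remez_const b m = ((b * real m) ^ (m - 1) / fact (m - 1))\<^sup>2"

text \<open>A single term of the exponential series.\<close>

lemma power_le_exp_fact: "real m ^ m \<le> exp 1 ^ m * fact m"
proof -
  have "real m ^ m / fact m \<le> (\<Sum>n. real m ^ n / fact n)"
    using exp_tail_summable[of "real m" 0] by (intro order_trans[OF _ sum_le_suminf[of _ "{m}"]]) auto
  also have "\<dots> = exp (real m)" unfolding exp_def by (simp add: field_simps)
  also have "\<dots> = exp 1 ^ m" by (simp add: exp_of_nat_mult[symmetric])
  finally show ?thesis by (simp add: divide_le_eq)
qed

lemma remez_const_le:
  assumes "b \<ge> 1" "m \<ge> 1"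
  shows "remez_const b m \<le> ((b * exp 1)\<^sup>2) ^ m"
proof -
  obtain k where k: "m = Suc k" using assms(2) by (cases m) auto
  have "real m ^ k / fact k = real m ^ m / fact m"
    by (simp only: k power_Suc fact_Suc) (simp del: of_nat_Suc)
  also have "\<dots> \<le> exp 1 ^ m" using power_le_exp_fact[of m] by (simp add: divide_le_eq)
  finally have "b ^ k * (real m ^ k / fact k) \<le> b ^ m * exp 1 ^ m"
    using assms by (intro mult_mono power_increasing) (auto simp: k)
  then have "(b * real m) ^ k / fact k \<le> (b * exp 1) ^ m"
    by (simp add: power_mult_distrib)
  then have "((b * real m) ^ k / fact k)\<^sup>2 \<le> ((b * exp 1) ^ m)\<^sup>2"
    using assms by (intro power_mono) auto
  moreover have "((b * exp 1) ^ m)\<^sup>2 = ((b * exp 1)\<^sup>2) ^ m" by (metis power_mult mult.commute)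
  moreover have "m - 1 = k" by (simp add: k)
  ultimately show ?thesis unfolding remez_const_def by (simp only:)
qed

text \<open>The Taylor remainder of order \<open>m\<close> decays like \<open>1 / m!\<close>, while the Remez constant grows only
  geometrically.\<close>

lemma remez_exp_tail_tendsto:
  assumes b: "b \<ge> 1" and \<rho>: "\<rho> \<ge> 0" and k: "k1 \<ge> 0" "k2 \<ge> 0"
  shows "(\<lambda>m. (k1 * real m * remez_const b m + k2) * exp_tail m \<rho>) \<longlonglongrightarrow> 0"
proof (rule real_tendsto_sandwich[OF _ _ tendsto_const])
  let ?q = "2 * (b * exp 1)\<^sup>2"
  have "1 * 1 \<le> b * exp 1" using b by (intro mult_mono) auto
  then have "1 \<le> (b * exp 1)\<^sup>2" by (intro one_le_power) simp
  then have q1: "?q \<ge> 1" by linarith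
  let ?u = "\<lambda>m. (k1 + k2) * exp \<rho> * ((?q * \<rho>) ^ m / fact m)"
  have "(\<lambda>m. (?q * \<rho>) ^ m / fact m) \<longlonglongrightarrow> 0"
    using summable_LIMSEQ_zero[OF exp_tail_summable[of "?q * \<rho>" 0]] by simp
  from tendsto_mult_right_zero[OF this, of "(k1 + k2) * exp \<rho>"] show "?u \<longlonglongrightarrow> 0" .
  show "\<forall>\<^sub>F m in sequentially. (k1 * real m * remez_const b m + k2) * exp_tail m \<rho> \<le> ?u m"
    using eventually_ge_at_top[of 1]
  proof eventually_elim
    case (elim m)
    have "real m * remez_const b m \<le> 2 ^ m * ((b * exp 1)\<^sup>2) ^ m"
      using elim of_nat_less_two_power[of m, where 'a = real]
      by (intro mult_mono remez_const_le b) (auto simp: remez_const_def)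
    also have "\<dots> = ?q ^ m" by (simp add: power_mult_distrib)
    finally have "k1 * (real m * remez_const b m) \<le> k1 * ?q ^ m" by (intro mult_left_mono k)
    moreover have "k2 * 1 \<le> k2 * ?q ^ m" using q1 by (intro mult_left_mono k one_le_power)
    ultimately have "k1 * real m * remez_const b m + k2 \<le> (k1 + k2) * ?q ^ m" by (simp add: algebra_simps)
    then have "(k1 * real m * remez_const b m + k2) * exp_tail m \<rho> \<le> ((k1 + k2) * ?q ^ m) * (\<rho> ^ m / fact m * exp \<rho>)"
      using q1 k \<rho> by (intro mult_mono exp_tail_le exp_tail_nonneg) auto
    also have "\<dots> = ?u m" by (simp add: power_mult_distrib)
    finally show ?case .
  qed
  show "\<forall>\<^sub>F m in sequentially. 0 \<le> (k1 * real m * remez_const b m + k2) * exp_tail m \<rho>"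
    using k \<rho> by (intro always_eventually allI mult_nonneg_nonneg add_nonneg_nonneg exp_tail_nonneg) (auto simp: remez_const_def)
qed

lemma exists_below_average:
  fixes f :: "nat \<Rightarrow> real"
  assumes "finite S" "S \<noteq> {}"
  shows "\<exists>x\<in>S. real (card S) * f x \<le> sum f S"
proof -
  have "Min (f ` S) \<in> f ` S" using assms by (intro Min_in) auto
  then obtain x where x: "x \<in> S" "f x = Min (f ` S)" by auto
  have "real (card S) * f x \<le> sum f S"
    using assms x by (intro sum_bounded_below) auto
  then show ?thesis using x by blast
qed

definition samples :: "'i set \<Rightarrow> ('i \<Rightarrow> real) \<Rightarrow> (nat \<Rightarrow> complex) \<Rightarrow> real" where
  "samples E s c = (\<Sum>k\<in>E. (norm (newton c 0 (s k)))\<^sup>2)"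

text \<open>One block, expanded about the point of least energy in the preceding block. The distance to that
  point is \<open>O(L\<^sup>2 i)\<close>, that is \<open>O(L sqrt n)\<close>, which is the range where the Newton remainder is small.
  Taking the least energy replaces it by its mean over about as many cells as the block has, so that
  summing over blocks costs a bounded factor.\<close>

lemma block_estimate:
  assumes a: "a > 0" and c: "c \<in> model_seqs a" and M: "cell_mult I s M" and L: "L \<ge> 1"
    and \<gamma>: "\<gamma> > 0" and i: "i \<ge> 2" and dense: "\<gamma> * real i \<le> real (card (block I s L i))"
    and m: "m \<ge> 1" and big: "\<gamma> * real i \<ge> 8 * real M * real m"
    and h: "h = 6 * real M * (real L)\<^sup>2 * real m / \<gamma>"
    and A: "A = remez_const (24 * real M * (real L)\<^sup>2 / \<gamma>) m"
  shows "(\<Sum>n\<in>{(L * i)\<^sup>2..<(L * (i + 1))\<^sup>2}. (norm (c n))\<^sup>2) \<le>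
     4 * h * A * samples (block I s L i) s c +
     3 * (4 * A * h + 2) * exp_tail m (256 * a * (real L)\<^sup>2) *
       (\<Sum>n\<in>{(L * (i - 1))\<^sup>2..<(L * i)\<^sup>2}. energy a c n)"
proof -
  let ?E = "block I s L i"
  have M1: "real M \<ge> 1" using M by (simp add: cell_mult_def)
  have L1: "real L \<ge> 1" using L by simp
  have i0: "real i \<ge> 2" using i by simp
  have m1: "real m \<ge> 1" using m by simp
  define \<Lambda> where "\<Lambda> = (real L)\<^sup>2 * (2 * real i + 1)"
  have LL: "(real L)\<^sup>2 \<ge> 1" using L1 by simp
  have iL: "1 * (real L)\<^sup>2 \<le> real i * (real L)\<^sup>2" using i0 by (intro mult_right_mono) auto
  from iL have \<Lambda>3: "\<Lambda> \<le> 3 * (real L)\<^sup>2 * real i" unfolding \<Lambda>_def by (simp add: algebra_simps)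
  have \<Lambda>0: "\<Lambda> \<ge> 0" unfolding \<Lambda>_def by simp
  \<comment> \<open>\<open>r\<close> disjoint node sets of \<open>m\<close> points each fit into the block.\<close>
  define r where "r = nat \<lfloor>\<gamma> * real i / real m\<rfloor>"
  have gm: "\<gamma> * real i / real m \<ge> 8 * real M" using big m1 by (simp add: le_divide_eq)
  have r_le: "real r \<le> \<gamma> * real i / real m" unfolding r_def using gm M1 by (simp)
  have r_ge: "real r \<ge> \<gamma> * real i / (2 * real m)"
  proof -
    have "real r \<ge> \<gamma> * real i / real m - 1" unfolding r_def using gm M1 by linarith
    moreover have "\<gamma> * real i / real m = 2 * (\<gamma> * real i / (2 * real m))" by simp
    ultimately show ?thesis using gm M1 by linarith
  qed
  have r4: "r \<ge> 4 * M"
  proof -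
    have "\<gamma> * real i / (2 * real m) = (\<gamma> * real i / real m) / 2" by simp
    then have "real r \<ge> 4 * real M" using r_ge gm by linarith
    then show ?thesis by linarith
  qed
  have r0: "real r > 0" using r4 M1 by linarith
  have rm: "r * m \<le> card ?E"
  proof -
    have "real r * real m \<le> \<gamma> * real i" using r_le m1 by (simp add: le_divide_eq)
    then have "real (r * m) \<le> real (card ?E)" using dense by simp
    then show ?thesis by linarith
  qed
  let ?S = "{(L * (i - 1))\<^sup>2..<(L * i)\<^sup>2}"
  have card_S: "real (card ?S) = (real L)\<^sup>2 * (2 * real i - 1)"
  proof -
    obtain j where j: "i = Suc j" using i by (cases i) auto
    have "card ?S = L\<^sup>2 * (2 * j + 1)" by (simp add: j power2_eq_square algebra_simps)
    then show ?thesis by (simp add: j algebra_simps)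
  qed
  have "L * (i - 1) < L * i" using i L by simp
  then have "(L * (i - 1))\<^sup>2 < (L * i)\<^sup>2" by (intro power_strict_mono) auto
  then have "(L * (i - 1))\<^sup>2 \<in> ?S" by (simp only: atLeastLessThan_iff order_refl simp_thms)
  then have "?S \<noteq> {}" by blast
  then obtain N where N: "N \<in> ?S" "real (card ?S) * energy a c N \<le> sum (energy a c) ?S"
    using exists_below_average[of ?S "energy a c"] by auto
  define \<epsilon> where "\<epsilon> = exp_tail m (256 * a * (real L)\<^sup>2)"
  define \<delta> where "\<delta> = \<epsilon> * energy a c N"
  have \<epsilon>0: "\<epsilon> \<ge> 0" unfolding \<epsilon>_def using a by (intro exp_tail_nonneg) auto
  have \<delta>0: "\<delta> \<ge> 0" unfolding \<delta>_def using \<epsilon>0 energy_nonneg[OF a c] by simp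
  have N_ge: "real N \<ge> ((real L) * (real i - 1))\<^sup>2"
  proof -
    have "real ((L * (i - 1))\<^sup>2) \<le> real N" using N(1) by (intro of_nat_mono) simp
    then show ?thesis using i by (simp add: of_nat_diff)
  qed
  have N_lt: "real N \<le> (real L * real i)\<^sup>2"
  proof -
    have "real N \<le> real ((L * i)\<^sup>2)" using N(1) by (intro of_nat_mono) simp
    then show ?thesis by simp
  qed
  have rem: "(norm (newton c 0 x - poly (newton_poly c N m) (of_real x)))\<^sup>2 \<le> \<delta>"
    if x: "(real L * real i)\<^sup>2 \<le> x" "x \<le> (real L * (real i + 1))\<^sup>2" for x
  proof -
    have "x - real N \<le> (real L * (real i + 1))\<^sup>2 - ((real L) * (real i - 1))\<^sup>2" using x N_ge by linarith
    also have "\<dots> = 4 * (real L)\<^sup>2 * real i" by (simp add: power2_eq_square algebra_simps)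
    finally have up: "x - real N \<le> 4 * (real L)\<^sup>2 * real i" .
    have lo: "real N \<le> x" using x N_lt by linarith
    have "(x - real N)\<^sup>2 \<le> (4 * (real L)\<^sup>2 * real i)\<^sup>2" using up lo by (intro power_mono) auto
    also have "\<dots> = 64 * (real L)\<^sup>2 * (real L * (real i / 2))\<^sup>2" by (simp add: power2_eq_square)
    also have "\<dots> \<le> 64 * (real L)\<^sup>2 * (real L * (real i - 1))\<^sup>2"
      using i0 by (intro mult_left_mono power_mono) auto
    also have "\<dots> \<le> 64 * (real L)\<^sup>2 * real (Suc N)" using N_ge by (intro mult_left_mono) auto
    finally have "(x - real N)\<^sup>2 \<le> 64 * (real L)\<^sup>2 * real (Suc N)" .
    from newton_poly_remainder[OF a c lo this, of m] show ?thesis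
      using LL unfolding \<delta>_def \<epsilon>_def by (simp add: mult_ac)
  qed
  have E_pts: "(real L * real i)\<^sup>2 \<le> s k \<and> s k \<le> (real L * (real i + 1))\<^sup>2" if "k \<in> ?E" for k
  proof -
    have k: "k \<in> I" "(L * i)\<^sup>2 \<le> nat \<lfloor>s k\<rfloor>" "nat \<lfloor>s k\<rfloor> < (L * (i + 1))\<^sup>2" using that by (auto simp: block_def)
    have s0: "s k \<ge> 0" using M k(1) by (simp add: cell_mult_def)
    have "real ((L * i)\<^sup>2) \<le> real (nat \<lfloor>s k\<rfloor>)" using k(2) by (rule of_nat_mono)
    moreover have "real (nat \<lfloor>s k\<rfloor>) + 1 \<le> real ((L * (i + 1))\<^sup>2)" using k(3) by linarith
    moreover have "real (nat \<lfloor>s k\<rfloor>) \<le> s k" "s k \<le> real (nat \<lfloor>s k\<rfloor>) + 1" using s0 by (simp, linarith)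
    ultimately have "real ((L * i)\<^sup>2) \<le> s k" "s k \<le> real ((L * (i + 1))\<^sup>2)" by linarith+
    then show ?thesis by (simp add: distrib_left add.commute)
  qed
  have len: "(real L * (real i + 1))\<^sup>2 - (real L * real i)\<^sup>2 = \<Lambda>"
    by (simp add: \<Lambda>_def power2_eq_square algebra_simps)
  have ratio: "x / real r \<le> (2 * real m * x) / (\<gamma> * real i)" if "x \<ge> 0" for x
  proof -
    have "x / real r \<le> x / (\<gamma> * real i / (2 * real m))"
      using that r_ge r0 \<gamma> i0 m1 by (intro divide_left_mono mult_pos_pos divide_pos_pos) auto
    then show ?thesis by (simp add: mult_ac)
  qed
  have A_ge: "((4 * real M * \<Lambda> / real r) ^ (m - 1) / fact (m - 1))\<^sup>2 \<le> A"
  proof -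
    have "4 * real M * \<Lambda> / real r \<le> (2 * real m * (4 * real M * \<Lambda>)) / (\<gamma> * real i)"
      using \<Lambda>0 by (intro ratio) auto
    also have "\<dots> \<le> (2 * real m * (4 * real M * (3 * (real L)\<^sup>2 * real i))) / (\<gamma> * real i)"
      using \<Lambda>3 \<gamma> i0 by (intro divide_right_mono mult_left_mono) auto
    also have "\<dots> = 24 * real M * (real L)\<^sup>2 / \<gamma> * real m" using \<gamma> i0 by (simp add: field_simps)
    finally show ?thesis unfolding A remez_const_def
      using \<Lambda>0 r0 by (intro power_mono divide_right_mono) auto
  qed
  have A0: "A \<ge> 0" by (simp add: A remez_const_def)
  have h0: "h \<ge> 0" using \<gamma> by (simp add: h)
  have cardE: "real (card ?E) / real r \<le> h"
  proof -
    have "real (card ?E) \<le> real M * \<Lambda>"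
      using of_nat_mono[OF card_block_le(2)[OF M, of L i], where 'a = real] by (simp add: \<Lambda>_def algebra_simps)
    also have "\<dots> \<le> real M * (3 * (real L)\<^sup>2 * real i)" using \<Lambda>3 by (intro mult_left_mono) auto
    finally have "real (card ?E) / real r \<le> (2 * real m * (real M * (3 * (real L)\<^sup>2 * real i))) / (\<gamma> * real i)"
      using ratio[of "real (card ?E)"] \<gamma> i0 by (intro order_trans[OF ratio divide_right_mono] mult_left_mono) auto
    also have "\<dots> = h" using \<gamma> i0 by (simp add: h field_simps)
    finally show ?thesis .
  qed
  have \<Lambda>r: "\<Lambda> / real r \<le> h"
  proof -
    have "\<Lambda> / real r \<le> (2 * real m * (3 * (real L)\<^sup>2 * real i)) / (\<gamma> * real i)"
      using \<Lambda>3 \<Lambda>0 \<gamma> i0 by (intro order_trans[OF ratio divide_right_mono] mult_left_mono) auto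
    also have "\<dots> = 1 * (6 * (real L)\<^sup>2 * real m / \<gamma>)" using \<gamma> i0 by (simp add: field_simps)
    also have "\<dots> \<le> real M * (6 * (real L)\<^sup>2 * real m / \<gamma>)" using M1 \<gamma> by (intro mult_right_mono) auto
    finally show ?thesis by (simp add: h mult_ac)
  qed
  let ?\<Sigma> = "samples ?E s c"
  have \<Sigma>0: "?\<Sigma> \<ge> 0" by (simp add: samples_def sum_nonneg)
  have pt: "(norm (c n))\<^sup>2 \<le> 4 * A * ?\<Sigma> / real r + (4 * A * h + 2) * \<delta>"
    if n: "n \<in> {(L * i)\<^sup>2..<(L * (i + 1))\<^sup>2}" for n
  proof -
    have n1: "(real L * real i)\<^sup>2 \<le> real n" "real n \<le> (real L * (real i + 1))\<^sup>2"
    proof -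
      have "real ((L * i)\<^sup>2) \<le> real n" "real n \<le> real ((L * (i + 1))\<^sup>2)"
        using n by (simp_all only: of_nat_le_iff atLeastLessThan_iff less_imp_le)
      then show "(real L * real i)\<^sup>2 \<le> real n" "real n \<le> (real L * (real i + 1))\<^sup>2" by (simp_all add: distrib_left add.commute)
    qed
    have "real r * (norm (newton c 0 (real n)))\<^sup>2 \<le> 4 * A * (\<Sum>k\<in>?E. (norm (newton c 0 (s k)))\<^sup>2) +
        (4 * A * real (card ?E) + 2 * real r) * \<delta>"
    proof (rule window_estimate[where Q = "newton_poly c N m" and f = "newton c 0",
          OF M card_block_le(1)[OF M] _ degree_newton_poly[OF m] r4 rm _ rem[OF n1] _ A_ge])
      show "\<bar>real n - s k\<bar> \<le> \<Lambda>" if "k \<in> ?E" for k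
        using E_pts[OF that] n1 len by linarith
      show "block I s L i \<subseteq> I" by (auto simp: block_def)
    qed (use rem E_pts in blast)
    then have "real r * (norm (c n))\<^sup>2 \<le> 4 * A * ?\<Sigma> + (4 * A * real (card ?E) + 2 * real r) * \<delta>"
      by (simp add: newton_nat[OF a c] samples_def)
    then have "(norm (c n))\<^sup>2 \<le> (4 * A * ?\<Sigma> + (4 * A * real (card ?E) + 2 * real r) * \<delta>) / real r"
      using r0 by (simp add: le_divide_eq mult.commute)
    also have "\<dots> = 4 * A * ?\<Sigma> / real r + (4 * A * (real (card ?E) / real r) + 2) * \<delta>"
      using r0 by (simp add: field_simps)
    also have "\<dots> \<le> 4 * A * ?\<Sigma> / real r + (4 * A * h + 2) * \<delta>"
      using cardE A0 \<delta>0 by (intro add_left_mono mult_right_mono add_right_mono mult_left_mono) auto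
    finally show ?thesis .
  qed
  have card_block: "real (card {(L * i)\<^sup>2..<(L * (i + 1))\<^sup>2}) = \<Lambda>"
  proof -
    have "card {(L * i)\<^sup>2..<(L * (i + 1))\<^sup>2} = L\<^sup>2 * (2 * i + 1)" by (simp add: power2_eq_square algebra_simps)
    then show ?thesis by (simp add: \<Lambda>_def algebra_simps)
  qed
  have "(\<Sum>n\<in>{(L * i)\<^sup>2..<(L * (i + 1))\<^sup>2}. (norm (c n))\<^sup>2) \<le>
      real (card {(L * i)\<^sup>2..<(L * (i + 1))\<^sup>2}) * (4 * A * ?\<Sigma> / real r + (4 * A * h + 2) * \<delta>)"
    by (rule sum_bounded_above) (rule pt)
  also have "\<dots> = 4 * A * ?\<Sigma> * (\<Lambda> / real r) + (4 * A * h + 2) * \<epsilon> * (\<Lambda> * energy a c N)"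
    unfolding card_block \<delta>_def by (simp add: algebra_simps)
  also have "\<dots> \<le> 4 * A * ?\<Sigma> * h + (4 * A * h + 2) * \<epsilon> * (3 * sum (energy a c) ?S)"
  proof (intro add_mono mult_left_mono \<Lambda>r)
    have "\<Lambda> \<le> 3 * real (card ?S)" unfolding card_S \<Lambda>_def using iL by (simp add: algebra_simps)
    then have "\<Lambda> * energy a c N \<le> 3 * real (card ?S) * energy a c N"
      by (intro mult_right_mono energy_nonneg a c)
    also have "\<dots> \<le> 3 * sum (energy a c) ?S" using mult_left_mono[OF N(2), of 3] by (simp only: mult.assoc)
    finally show "\<Lambda> * energy a c N \<le> 3 * sum (energy a c) ?S" .
  qed (use A0 \<Sigma>0 \<epsilon>0 h0 in auto)
  finally show ?thesis by (simp only: \<epsilon>_def mult_ac)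
qed

lemma samples_le_infsum:
  assumes "a > 0" "c \<in> model_seqs a" "cell_mult I s M" "finite E" "E \<subseteq> I"
  shows "samples E s c \<le> (\<Sum>\<^sub>\<infinity>k\<in>I. (norm (newton c 0 (s k)))\<^sup>2)"
  unfolding samples_def using assms by (intro finite_sum_le_infsum samples_summable) auto

lemma sum_blocks:
  fixes f :: "nat \<Rightarrow> real"
  assumes "i1 \<le> J"
  shows "(\<Sum>i\<in>{i1..<J}. \<Sum>n\<in>{(L * i)\<^sup>2..<(L * (i + 1))\<^sup>2}. f n) = (\<Sum>n\<in>{(L * i1)\<^sup>2..<(L * J)\<^sup>2}. f n)"
  using assms
proof (induction J rule: dec_induct)
  case (step J)
  have "(L * i1)\<^sup>2 \<le> (L * J)\<^sup>2" "(L * J)\<^sup>2 \<le> (L * (J + 1))\<^sup>2" using step by (auto intro!: power_mono)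
  then show ?case using step sum.atLeastLessThan_concat[of "(L * i1)\<^sup>2" "(L * J)\<^sup>2" "(L * (J + 1))\<^sup>2" f]
    by simp
qed simp

text \<open>The block estimates summed: blocks are disjoint, so the samples and the energies add up to at most
  the full sums.\<close>

lemma high_frequency_estimate:
  assumes a: "a > 0" and M: "cell_mult I s M" and L: "L \<ge> 1" and \<gamma>: "\<gamma> > 0"
    and dense: "\<And>i. i \<ge> i0 \<Longrightarrow> \<gamma> * real i \<le> real (card (block I s L i))"
    and m: "m \<ge> 1"
    and h: "h = 6 * real M * (real L)\<^sup>2 * real m / \<gamma>"
    and A: "A = remez_const (24 * real M * (real L)\<^sup>2 / \<gamma>) m"
  obtains N1 where "\<And>c N. c \<in> model_seqs a \<Longrightarrow> (\<Sum>n\<in>{N1..<N}. (norm (c n))\<^sup>2) \<le>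
     4 * h * A * (\<Sum>\<^sub>\<infinity>k\<in>I. (norm (newton c 0 (s k)))\<^sup>2) +
     6 * (4 * A * h + 2) * exp_tail m (256 * a * (real L)\<^sup>2) * normsq c"
proof -
  define i1 where "i1 = max (max i0 2) (nat \<lceil>8 * real M * real m / \<gamma>\<rceil>)"
  have A0: "A \<ge> 0" by (simp add: A remez_const_def)
  have h0: "h \<ge> 0" using \<gamma> by (simp add: h)
  have big: "\<gamma> * real i \<ge> 8 * real M * real m" if "i \<ge> i1" for i
  proof -
    have "real i \<ge> real (nat \<lceil>8 * real M * real m / \<gamma>\<rceil>)" using that unfolding i1_def by simp
    then have "real i \<ge> 8 * real M * real m / \<gamma>" using real_nat_ceiling_ge order_trans by blast
    then show ?thesis using \<gamma> by (simp add: divide_le_eq mult.commute)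
  qed
  have i12: "i1 \<ge> 2" by (simp add: i1_def)
  show ?thesis
  proof (rule that[of "(L * i1)\<^sup>2"])
    fix c N assume c: "c \<in> model_seqs a"
    let ?S = "\<Sum>\<^sub>\<infinity>k\<in>I. (norm (newton c 0 (s k)))\<^sup>2"
    let ?\<epsilon> = "exp_tail m (256 * a * (real L)\<^sup>2)"
    have \<epsilon>0: "?\<epsilon> \<ge> 0" using a by (intro exp_tail_nonneg) auto
    define J where "J = max i1 N"
    have i1J: "i1 \<le> J" by (simp add: J_def)
    have NJ: "N \<le> (L * J)\<^sup>2"
    proof -
      have "N \<le> J" by (simp add: J_def)
      also have "J \<le> L * J" using L by simp
      also have "L * J \<le> (L * J)\<^sup>2" by (simp add: power2_eq_square)
      finally show ?thesis .
    qed
    have "(\<Sum>n\<in>{(L * i1)\<^sup>2..<N}. (norm (c n))\<^sup>2) \<le> (\<Sum>n\<in>{(L * i1)\<^sup>2..<(L * J)\<^sup>2}. (norm (c n))\<^sup>2)"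
      using NJ by (intro sum_mono2) auto
    also have "\<dots> = (\<Sum>i\<in>{i1..<J}. \<Sum>n\<in>{(L * i)\<^sup>2..<(L * (i + 1))\<^sup>2}. (norm (c n))\<^sup>2)"
      using sum_blocks[OF i1J] by simp
    also have "\<dots> \<le> (\<Sum>i\<in>{i1..<J}. 4 * h * A * samples (block I s L i) s c +
        3 * (4 * A * h + 2) * ?\<epsilon> * (\<Sum>n\<in>{(L * (i - 1))\<^sup>2..<(L * i)\<^sup>2}. energy a c n))"
      by (intro sum_mono block_estimate[OF a c M L \<gamma> _ _ m _ h A] dense big) (auto simp: i1_def)
    also have "\<dots> = 4 * h * A * (\<Sum>i\<in>{i1..<J}. samples (block I s L i) s c) +
        3 * (4 * A * h + 2) * ?\<epsilon> * (\<Sum>i\<in>{i1..<J}. \<Sum>n\<in>{(L * (i - 1))\<^sup>2..<(L * i)\<^sup>2}. energy a c n)"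
      by (simp only: sum.distrib sum_distrib_left)
    also have "\<dots> \<le> 4 * h * A * ?S + 3 * (4 * A * h + 2) * ?\<epsilon> * (2 * normsq c)"
    proof (intro add_mono mult_left_mono)
      have "(\<Sum>i\<in>{i1..<J}. samples (block I s L i) s c) = samples (\<Union>i\<in>{i1..<J}. block I s L i) s c"
        unfolding samples_def
      proof (rule sum.UNION_disjoint[symmetric])
        show "\<forall>i\<in>{i1..<J}. \<forall>j\<in>{i1..<J}. i \<noteq> j \<longrightarrow> block I s L i \<inter> block I s L j = {}"
          by (simp add: block_disjoint)
      qed (use card_block_le(1)[OF M] in auto)
      also have "\<dots> \<le> ?S"
        using card_block_le(1)[OF M] by (intro samples_le_infsum[OF a c M]) (auto simp: block_def)
      finally show "(\<Sum>i\<in>{i1..<J}. samples (block I s L i) s c) \<le> ?S" .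
      have "(\<Sum>i\<in>{i1..<J}. \<Sum>n\<in>{(L * (i - 1))\<^sup>2..<(L * i)\<^sup>2}. energy a c n) =
         (\<Sum>i\<in>{i1 - 1..<J - 1}. \<Sum>n\<in>{(L * i)\<^sup>2..<(L * (i + 1))\<^sup>2}. energy a c n)"
      proof (rule sum.reindex_bij_witness[of _ "\<lambda>i. i + 1" "\<lambda>i. i - 1"])
        fix i assume "i \<in> {i1..<J}"
        then have "i \<ge> 1" using i12 by simp
        then show "(\<Sum>n\<in>{(L * (i - 1))\<^sup>2..<(L * (i - 1 + 1))\<^sup>2}. energy a c n) =
            (\<Sum>n\<in>{(L * (i - 1))\<^sup>2..<(L * i)\<^sup>2}. energy a c n)" by simp
      qed (use i12 in auto)
      also have "\<dots> = (\<Sum>n\<in>{(L * (i1 - 1))\<^sup>2..<(L * (J - 1))\<^sup>2}. energy a c n)"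
        using i1J by (intro sum_blocks) auto
      also have "\<dots> \<le> 2 * normsq c" by (rule energy_sum_finite_le[OF a c]) simp
      finally show "(\<Sum>i\<in>{i1..<J}. \<Sum>n\<in>{(L * (i - 1))\<^sup>2..<(L * i)\<^sup>2}. energy a c n) \<le> 2 * normsq c" .
    qed (use A0 h0 \<epsilon>0 in auto)
    also have "\<dots> = 4 * h * A * ?S + 6 * (4 * A * h + 2) * ?\<epsilon> * normsq c"
      by (simp add: algebra_simps)
    finally show "(\<Sum>n\<in>{(L * i1)\<^sup>2..<N}. (norm (c n))\<^sup>2) \<le> 4 * h * A * ?S + 6 * (4 * A * h + 2) * ?\<epsilon> * normsq c" .
  qed
qed

lemma gbinomial_abs_bound:
  assumes "0 \<le> x" "x \<le> \<kappa> * real j"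
  shows "\<bar>x gchoose j\<bar> \<le> ((\<kappa> + 1) * exp 1) ^ j"
proof -
  have "\<bar>x gchoose j\<bar> = (\<Prod>i<j. \<bar>x - real i\<bar>) / fact j"
    by (simp add: gbinomial_prod_rev abs_prod lessThan_atLeast0)
  also have "\<dots> \<le> (\<Prod>i<j. x + real j) / fact j"
    using assms by (intro divide_right_mono prod_mono) auto
  also have "\<dots> = (x + real j) ^ j / fact j" by simp
  also have "\<dots> \<le> ((\<kappa> + 1) * real j) ^ j / fact j"
    using assms by (intro divide_right_mono power_mono) (auto simp: algebra_simps)
  also have "\<dots> = (\<kappa> + 1) ^ j * (real j ^ j / fact j)" by (simp add: power_mult_distrib)
  also have "\<dots> \<le> (\<kappa> + 1) ^ j * exp 1 ^ j"
  proof (cases "j = 0")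
    case False
    then have "\<kappa> \<ge> 0" using assms by (metis mult_neg_pos not_le of_nat_0_less_iff order_trans not_gr_zero)
    then show ?thesis using power_le_exp_fact[of j] by (intro mult_left_mono) (auto simp: divide_le_eq)
  qed simp
  finally show ?thesis by (simp add: power_mult_distrib)
qed

text \<open>The first \<open>(2LH)\<^sup>2\<close> cells contain a number of sampling points proportional to their number;
  comparing with the Newton polynomial at \<open>0\<close> and letting \<open>H\<close> grow controls any fixed coefficient.
  In particular no nonzero element has all its samples zero.\<close>

lemma low_frequency_estimate:
  assumes a: "a > 0" and M: "cell_mult I s M" and L: "L \<ge> 1" and \<gamma>: "\<gamma> > 0"
    and dense: "\<And>i. i \<ge> i0 \<Longrightarrow> \<gamma> * real i \<le> real (card (block I s L i))"
    and \<eta>: "\<eta> > 0"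
  obtains C where "C \<ge> 0" "\<And>c n. c \<in> model_seqs a \<Longrightarrow> n < N1 \<Longrightarrow>
     (norm (c n))\<^sup>2 \<le> C * (\<Sum>\<^sub>\<infinity>k\<in>I. (norm (newton c 0 (s k)))\<^sup>2) + \<eta> * normsq c"
proof -
  have M1: "real M \<ge> 1" using M by (simp add: cell_mult_def)
  have LL: "(real L)\<^sup>2 \<ge> 1" using L by simp
  define \<kappa> where "\<kappa> = max 1 (32 * (real L)\<^sup>2 * real M / \<gamma>)"
  have \<kappa>1: "\<kappa> \<ge> 1" by (simp add: \<kappa>_def)
  define B where "B = ((\<kappa> + 1) * exp 1)\<^sup>2"
  have "(\<lambda>m. (2 * \<kappa> * real m * remez_const \<kappa> m + 4) * exp_tail m (4 * a * B)) \<longlonglongrightarrow> 0"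
    using a \<kappa>1 by (intro remez_exp_tail_tendsto) (auto simp: B_def)
  from order_tendstoD(2)[OF this \<eta>] obtain m0 where
    m0: "\<And>m. m \<ge> m0 \<Longrightarrow> (2 * \<kappa> * real m * remez_const \<kappa> m + 4) * exp_tail m (4 * a * B) < \<eta>"
    unfolding eventually_sequentially by blast
  define K where "K = 8 * real M * real (max m0 1) / \<gamma>"
  define H where "H = max (max i0 N1) (nat \<lceil>K\<rceil> + 1)"
  have H1: "H \<ge> 1" "H \<ge> i0" "H \<ge> N1" by (auto simp: H_def)
  have "nat \<lceil>K\<rceil> \<le> H" unfolding H_def by (intro max.coboundedI2) (rule le_add1)
  then have "K \<le> real H" using real_nat_ceiling_ge[of K] by linarith
  moreover have HH: "real H \<le> (real H)\<^sup>2" using H1 by (simp add: power2_eq_square)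
  ultimately have "K \<le> (real H)\<^sup>2" by linarith
  then have "K * \<gamma> \<le> (real H)\<^sup>2 * \<gamma>" using \<gamma> by (intro mult_right_mono) auto
  then have gH: "\<gamma> * (real H)\<^sup>2 \<ge> 8 * real M * real (max m0 1)"
    using \<gamma> by (simp add: K_def mult.commute)
  define q where "q = \<gamma> * (real H)\<^sup>2 / (4 * real M)"
  \<comment> \<open>The largest degree for which node sets at every \<open>4M\<close>-th point fit; it tends to infinity with \<open>H\<close>.\<close>
  define m where "m = nat \<lfloor>q\<rfloor>"
  have q: "q \<ge> 2 * real (max m0 1)" using gH M1 by (simp add: q_def le_divide_eq mult_ac)
  then have q2: "q \<ge> 2" by (smt (verit) max.cobounded2 of_nat_1 of_nat_mono)
  have m_le: "real m \<le> q" unfolding m_def using q2 by simp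
  have half: "x / 2 \<le> real (nat \<lfloor>x\<rfloor>)" if "x \<ge> 2" for x :: real using that by linarith
  have m_ge: "real m \<ge> q / 2" unfolding m_def by (rule half[OF q2])
  have mm0: "m \<ge> max m0 1"
  proof -
    have "real m \<ge> real (max m0 1)" using m_ge q by linarith
    then show ?thesis by linarith
  qed
  define E where "E = {k\<in>I. nat \<lfloor>s k\<rfloor> \<in> {0..<(2 * L * H)\<^sup>2}}"
  have E: "finite E" "card E \<le> M * (2 * L * H)\<^sup>2" "E \<subseteq> I"
    using cell_mult_card[OF M, of 0 "(2 * L * H)\<^sup>2"] by (auto simp: E_def)
  define \<Lambda> where "\<Lambda> = (2 * real L * real H)\<^sup>2"
  have \<Lambda>\<kappa>: "\<Lambda> \<le> \<kappa> * real m"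
  proof -
    have "\<Lambda> = 32 * (real L)\<^sup>2 * real M / \<gamma> * (q / 2)"
      using \<gamma> M1 by (simp add: q_def \<Lambda>_def power_mult_distrib field_simps)
    also have "\<dots> \<le> \<kappa> * real m" using m_ge q2 \<gamma> M1 by (intro mult_mono) (auto simp: \<kappa>_def)
    finally show ?thesis .
  qed
  have rm: "4 * M * m \<le> card E"
  proof -
    have sub: "(\<Union>i\<in>{H..<2 * H}. block I s L i) \<subseteq> E"
    proof
      fix k assume "k \<in> (\<Union>i\<in>{H..<2 * H}. block I s L i)"
      then obtain i where i: "i < 2 * H" "k \<in> block I s L i" by auto
      have "(L * (i + 1))\<^sup>2 \<le> (L * (2 * H))\<^sup>2" using i by (intro power_mono mult_le_mono2) auto
      moreover have "k \<in> I" "nat \<lfloor>s k\<rfloor> < (L * (i + 1))\<^sup>2" using i by (simp_all add: block_def)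
      ultimately have "k \<in> I" "nat \<lfloor>s k\<rfloor> < (L * (2 * H))\<^sup>2" by linarith+
      then show "k \<in> E" by (simp add: E_def mult_ac)
    qed

    have "\<gamma> * (real H)\<^sup>2 = (\<Sum>i\<in>{H..<2 * H}. \<gamma> * real H)" by (simp add: power2_eq_square)
    also have "\<dots> \<le> (\<Sum>i\<in>{H..<2 * H}. real (card (block I s L i)))"
    proof (rule sum_mono)
      fix i assume i: "i \<in> {H..<2 * H}"
      have "\<gamma> * real H \<le> \<gamma> * real i" using i \<gamma> by (intro mult_left_mono) auto
      also have "\<dots> \<le> real (card (block I s L i))" using i H1 by (intro dense) auto
      finally show "\<gamma> * real H \<le> real (card (block I s L i))" .
    qed
    also have "\<dots> = real (card (\<Union>i\<in>{H..<2 * H}. block I s L i))"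
      unfolding of_nat_sum[symmetric]
      by (subst card_UN_disjoint) (simp_all add: card_block_le(1)[OF M] block_disjoint)
    also have "\<dots> \<le> real (card E)" by (intro of_nat_mono card_mono E sub)
    finally have "\<gamma> * (real H)\<^sup>2 \<le> real (card E)" .
    moreover have "real (4 * M * m) \<le> \<gamma> * (real H)\<^sup>2"
      using m_le M1 by (simp add: q_def le_divide_eq mult_ac)
    ultimately show ?thesis by linarith
  qed
  define A where "A = remez_const \<kappa> m"
  have A0: "A \<ge> 0" by (simp add: A_def remez_const_def)
  have \<Lambda>0: "\<Lambda> \<ge> 0" by (simp add: \<Lambda>_def)
  have A_ge: "((4 * real M * \<Lambda> / real (4 * M)) ^ (m - 1) / fact (m - 1))\<^sup>2 \<le> A"
  proof -
    have "4 * real M * \<Lambda> / real (4 * M) = \<Lambda>" using M1 by simp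
    then show ?thesis unfolding A_def remez_const_def
      using \<Lambda>0 \<Lambda>\<kappa> by (simp only:) (intro power_mono divide_right_mono, auto)
  qed
  show ?thesis
  proof (rule that[OF A0])
    fix c n assume c: "c \<in> model_seqs a" and n: "n < N1"
    let ?S = "\<Sum>\<^sub>\<infinity>k\<in>I. (norm (newton c 0 (s k)))\<^sup>2"
    define \<epsilon> where "\<epsilon> = exp_tail m (4 * a * B)"
    define \<delta> where "\<delta> = \<epsilon> * (2 * normsq c)"
    have \<epsilon>0: "\<epsilon> \<ge> 0" unfolding \<epsilon>_def using a by (intro exp_tail_nonneg) (auto simp: B_def)
    have nc: "normsq c \<ge> 0" by (rule normsq_nonneg[OF model_seqs_sq_summable[OF c]])
    have rem: "(norm (newton c 0 x - poly (newton_poly c 0 m) (of_real x)))\<^sup>2 \<le> \<delta>"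
      if x: "0 \<le> x" "x \<le> \<Lambda>" for x
    proof -
      have bb: "(norm (complex_of_real (x gchoose j)))\<^sup>2 * fact j \<le> 1 * B ^ j * pochhammer (real (Suc 0)) j"
        if j: "j \<ge> m" for j
      proof -
        have "x \<le> \<kappa> * real j" using x \<Lambda>\<kappa> j \<kappa>1 by (smt (verit) mult_left_mono of_nat_mono)
        from gbinomial_abs_bound[OF x(1) this] have "\<bar>x gchoose j\<bar>\<^sup>2 \<le> (((\<kappa> + 1) * exp 1) ^ j)\<^sup>2"
          by (intro power_mono) auto
        also have "\<dots> = B ^ j" by (simp add: B_def power_mult[symmetric] mult.commute)
        finally show ?thesis by (simp add: pochhammer_fact[symmetric])
      qed
      have "newton c 0 x - poly (newton_poly c 0 m) (of_real x) =
          (\<Sum>j. of_real (x gchoose (j + m)) * (fdiff ^^ (j + m)) c 0)"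
        unfolding newton_def poly_newton_poly
        using suminf_split_initial_segment[OF summable_norm_cancel[OF newton_summable[OF a c x(1), of 0]], of m] by simp
      then have "(norm (newton c 0 x - poly (newton_poly c 0 m) (of_real x)))\<^sup>2 \<le> 1 * \<epsilon> * energy a c 0"
        using difference_series(2)[OF a c, where C = B and D = 1 and m = m and N = 0 and
            b = "\<lambda>j. complex_of_real (x gchoose j)", OF _ _ bb] unfolding \<epsilon>_def by (simp add: B_def)
      also have "\<dots> \<le> 1 * \<epsilon> * (2 * normsq c)"
        using energy_sum_le[OF a c, of 0] \<epsilon>0 by (intro mult_left_mono) auto
      finally show ?thesis by (simp add: \<delta>_def)
    qed
    have E_pts: "0 \<le> s k \<and> s k \<le> \<Lambda>" if "k \<in> E" for k
    proof -
      have k: "k \<in> I" "nat \<lfloor>s k\<rfloor> < (2 * L * H)\<^sup>2" using that by (auto simp: E_def)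
      have s0: "s k \<ge> 0" using M k(1) by (simp add: cell_mult_def)
      have "real (nat \<lfloor>s k\<rfloor>) + 1 \<le> real ((2 * L * H)\<^sup>2)" using k(2) by linarith
      moreover have "s k \<le> real (nat \<lfloor>s k\<rfloor>) + 1" using s0 by linarith
      ultimately have "s k \<le> real ((2 * L * H)\<^sup>2)" by linarith
      then show ?thesis using s0 by (simp add: \<Lambda>_def)
    qed
    have n\<Lambda>: "real n \<le> \<Lambda>"
    proof -
      have "real n \<le> real H" using n H1 by simp
      also have "\<dots> \<le> 4 * (real L)\<^sup>2 * (real H)\<^sup>2"
        using HH LL mult_mono[of 1 "4 * (real L)\<^sup>2" "(real H)\<^sup>2" "(real H)\<^sup>2"] by linarith
      finally show ?thesis by (simp add: \<Lambda>_def power_mult_distrib)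
    qed
    have "real (4 * M) * (norm (newton c 0 (real n)))\<^sup>2 \<le> 4 * A * (\<Sum>k\<in>E. (norm (newton c 0 (s k)))\<^sup>2) +
        (4 * A * real (card E) + 2 * real (4 * M)) * \<delta>"
    proof (rule window_estimate[where Q = "newton_poly c 0 m" and f = "newton c 0",
          OF M E(1,3) degree_newton_poly order_refl rm _ rem[OF of_nat_0_le_iff n\<Lambda>] _ A_ge])
      show "\<bar>real n - s k\<bar> \<le> \<Lambda>" if "k \<in> E" for k
        using E_pts[OF that] n\<Lambda> by linarith
    qed (use mm0 rem E_pts in auto)
    then have "4 * real M * (norm (c n))\<^sup>2 \<le> 4 * A * samples E s c + (4 * A * real (card E) + 8 * real M) * \<delta>"
      by (simp add: newton_nat[OF a c] samples_def)
    also have "\<dots> \<le> 4 * real M * (A * samples E s c) + (4 * A * (real M * (\<kappa> * real m)) + 8 * real M) * \<delta>"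
    proof (intro add_mono mult_right_mono mult_left_mono)
      have "1 * (A * samples E s c) \<le> real M * (A * samples E s c)"
        using M1 A0 by (intro mult_right_mono mult_nonneg_nonneg) (auto simp: samples_def sum_nonneg)
      then show "4 * A * samples E s c \<le> 4 * real M * (A * samples E s c)" by simp
      have "real (card E) \<le> real (M * (2 * L * H)\<^sup>2)" using E(2) by (rule of_nat_mono)
      then have "real (card E) \<le> real M * \<Lambda>" by (simp add: \<Lambda>_def)
      also have "\<dots> \<le> real M * (\<kappa> * real m)" using \<Lambda>\<kappa> by (intro mult_left_mono) auto
      finally show "real (card E) \<le> real M * (\<kappa> * real m)" .
    qed (use A0 \<epsilon>0 nc in \<open>auto simp: \<delta>_def\<close>)
    also have "\<dots> = 4 * real M * (A * samples E s c + (A * \<kappa> * real m + 2) * \<delta>)"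
      by (simp add: algebra_simps)
    finally have "(norm (c n))\<^sup>2 \<le> A * samples E s c + (A * \<kappa> * real m + 2) * \<delta>"
      using M1 by simp
    also have "\<dots> = A * samples E s c + ((2 * \<kappa> * real m * A + 4) * \<epsilon>) * normsq c"
      by (simp add: \<delta>_def algebra_simps)
    also have "\<dots> \<le> A * ?S + \<eta> * normsq c"
      using m0[of m] mm0 nc A0 samples_le_infsum[OF a c M E(1,3)]
      by (intro add_mono mult_left_mono mult_right_mono) (auto simp: A_def \<epsilon>_def)
    finally show "(norm (c n))\<^sup>2 \<le> A * ?S + \<eta> * normsq c" .
  qed
qed

text \<open>Choose \<open>m\<close> so that the energy term at high frequencies costs at most a quarter of the squared
  norm; this fixes the finitely many low coefficients, which together cost another quarter.\<close>

theorem dense_imp_lower_frame: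
  assumes a: "a > 0" and M: "cell_mult I s M" and dense: "sqrt_dense I s"
  shows "lower_frame a I s"
proof -
  have M1: "real M \<ge> 1" using M by (simp add: cell_mult_def)
  obtain L \<gamma> i0 where L: "L \<ge> 1" and \<gamma>: "\<gamma> > 0"
    and dense: "\<And>i. i \<ge> i0 \<Longrightarrow> \<gamma> * real i \<le> real (card (block I s L i))"
    using dense unfolding sqrt_dense_def by blast
  define b where "b = 24 * real M * (real L)\<^sup>2 / \<gamma>"
  define b' where "b' = max 1 b"
  have b0: "b \<ge> 0" using \<gamma> by (simp add: b_def)
  define k where "k = 6 * real M * (real L)\<^sup>2 / \<gamma>"
  have k0: "k \<ge> 0" using \<gamma> by (simp add: k_def)
  let ?\<epsilon> = "\<lambda>m. exp_tail m (256 * a * (real L)\<^sup>2)"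
  have \<epsilon>0: "?\<epsilon> m \<ge> 0" for m using a by (intro exp_tail_nonneg) auto
  have "(\<lambda>m. (24 * k * real m * remez_const b' m + 12) * ?\<epsilon> m) \<longlonglongrightarrow> 0"
    using a k0 by (intro remez_exp_tail_tendsto) (auto simp: b'_def)
  from order_tendstoD(2)[OF this, of "1/4"] obtain m' where
    m': "\<And>m. m \<ge> m' \<Longrightarrow> (24 * k * real m * remez_const b' m + 12) * ?\<epsilon> m < 1/4"
    unfolding eventually_sequentially by auto
  define m where "m = max m' 1"
  define h where "h = 6 * real M * (real L)\<^sup>2 * real m / \<gamma>"
  define A where "A = remez_const b m"
  have A0: "A \<ge> 0" by (simp add: A_def remez_const_def)
  have h0: "h \<ge> 0" using \<gamma> by (simp add: h_def)
  have hk: "h = k * real m" by (simp add: h_def k_def)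
  have small: "6 * (4 * A * h + 2) * ?\<epsilon> m \<le> 1/4"
  proof -
    have "A \<le> remez_const b' m" unfolding A_def remez_const_def b'_def
      using b0 by (intro power_mono divide_right_mono mult_right_mono) auto
    then have "24 * k * real m * A + 12 \<le> 24 * k * real m * remez_const b' m + 12"
      using k0 by (intro add_right_mono mult_left_mono) auto
    then have "(24 * k * real m * A + 12) * ?\<epsilon> m \<le> (24 * k * real m * remez_const b' m + 12) * ?\<epsilon> m"
      by (intro mult_right_mono \<epsilon>0)
    also have "\<dots> \<le> 1/4" using m'[of m] by (simp add: m_def)
    finally show ?thesis unfolding hk by (simp add: algebra_simps)
  qed
  obtain N1 where N1: "\<And>c N. c \<in> model_seqs a \<Longrightarrow> (\<Sum>n\<in>{N1..<N}. (norm (c n))\<^sup>2) \<le>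
     4 * h * A * (\<Sum>\<^sub>\<infinity>k\<in>I. (norm (newton c 0 (s k)))\<^sup>2) + 6 * (4 * A * h + 2) * ?\<epsilon> m * normsq c"
    using high_frequency_estimate[OF a M L \<gamma> dense _ h_def A_def[unfolded b_def]] by (auto simp: m_def)
  define \<eta> where "\<eta> = 1 / (4 * (real N1 + 1))"
  have \<eta>: "\<eta> > 0" by (simp add: \<eta>_def)
  obtain C where C: "C \<ge> 0" "\<And>c n. c \<in> model_seqs a \<Longrightarrow> n < N1 \<Longrightarrow>
     (norm (c n))\<^sup>2 \<le> C * (\<Sum>\<^sub>\<infinity>k\<in>I. (norm (newton c 0 (s k)))\<^sup>2) + \<eta> * normsq c"
    using low_frequency_estimate[OF a M L \<gamma> dense \<eta>, where ?N1.0 = N1] by blast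
  define D where "D = 2 * (real N1 * C + 4 * h * A) + 1"
  have D: "D > 0" using C(1) h0 A0 by (simp add: D_def add_nonneg_pos)
  have main: "normsq c \<le> D * (\<Sum>\<^sub>\<infinity>k\<in>I. (norm (newton c 0 (s k)))\<^sup>2)" if c: "c \<in> model_seqs a" for c
  proof -
    let ?S = "\<Sum>\<^sub>\<infinity>k\<in>I. (norm (newton c 0 (s k)))\<^sup>2"
    have S0: "?S \<ge> 0" by (rule infsum_nonneg) auto
    have nc: "normsq c \<ge> 0" by (rule normsq_nonneg[OF model_seqs_sq_summable[OF c]])
    have "normsq c \<le> (real N1 * C + 4 * h * A) * ?S + (1/2) * normsq c"
    proof (rule sqsumI_bound(2))
      fix N
      have "(\<Sum>n\<le>N. (norm (c n))\<^sup>2) \<le> (\<Sum>n\<in>{..<N1} \<union> {N1..<Suc N}. (norm (c n))\<^sup>2)"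
        by (intro sum_mono2) auto
      also have "\<dots> = (\<Sum>n<N1. (norm (c n))\<^sup>2) + (\<Sum>n\<in>{N1..<Suc N}. (norm (c n))\<^sup>2)"
        by (intro sum.union_disjoint) auto
      also have "(\<Sum>n<N1. (norm (c n))\<^sup>2) \<le> (\<Sum>n<N1. C * ?S + \<eta> * normsq c)"
        by (intro sum_mono C c) auto
      also have "\<dots> = real N1 * C * ?S + (real N1 * \<eta>) * normsq c" by (simp add: algebra_simps)
      also have "(real N1 * \<eta>) * normsq c \<le> (1/4) * normsq c"
        by (intro mult_right_mono nc) (simp add: \<eta>_def field_simps)
      also have "(\<Sum>n\<in>{N1..<Suc N}. (norm (c n))\<^sup>2) \<le> 4 * h * A * ?S + (1/4) * normsq c"
        by (rule order_trans[OF N1[OF c] add_left_mono[OF mult_right_mono[OF small nc]]])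
      finally show "(\<Sum>n\<le>N. (norm (c n))\<^sup>2) \<le> (real N1 * C + 4 * h * A) * ?S + (1/2) * normsq c"
        by (simp add: algebra_simps)
    qed
    then have "normsq c \<le> 2 * ((real N1 * C + 4 * h * A) * ?S)" by linarith
    also have "\<dots> = 2 * (real N1 * C + 4 * h * A) * ?S" by simp
    also have "\<dots> \<le> D * ?S" using S0 by (intro mult_right_mono) (auto simp: D_def)
    finally show ?thesis .
  qed
  show ?thesis unfolding lower_frame_def
    by (rule exI[of _ "1 / D"]) (use D main in \<open>auto simp: divide_le_eq mult.commute\<close>)
qed

section \<open>Asymptotics of the Laguerre functions at the endpoint\<close>

lemma eventually_bounded_imp_bounded:
  fixes f :: "nat \<Rightarrow> real"
  assumes "\<And>n. n \<ge> N \<Longrightarrow> f n \<le> C"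
  obtains C' where "C' \<ge> C" "\<And>n. f n \<le> C'"
proof (rule that)
  let ?C = "Max (insert C (f ` {..N}))"
  show "?C \<ge> C" by (rule Max_ge) auto
  fix n
  show "f n \<le> ?C"
  proof (cases "n \<le> N")
    case True
    then show ?thesis by (intro Max_ge) auto
  next
    case False
    then have "f n \<le> C" by (intro assms) auto
    also have "C \<le> ?C" by (rule Max_ge) auto
    finally show ?thesis .
  qed
qed

text \<open>The logarithms of such a sequence have summable increments.\<close>

lemma slowly_varying_bounded:
  fixes V :: "nat \<Rightarrow> real"
  assumes pos: "\<And>k. k \<ge> k0 \<Longrightarrow> V k > 0" and C: "C \<ge> 0"
    and step: "\<And>k. k \<ge> k0 \<Longrightarrow> \<bar>V k - V (Suc k)\<bar> \<le> C * real (Suc k) powr (-3/2) * V (Suc k)"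
  obtains k1 b B where "k1 \<ge> k0" "b > 0" "\<And>k. k \<ge> k1 \<Longrightarrow> b \<le> V k \<and> V k \<le> B"
proof -
  let ?x = "\<lambda>k. C * real (Suc k) powr (-3/2)"
  have lim: "?x \<longlonglongrightarrow> 0" by real_asymp
  from order_tendstoD(2)[OF this, of "1/2"] obtain k' where k': "\<And>k. k \<ge> k' \<Longrightarrow> ?x k < 1/2"
    unfolding eventually_sequentially by auto
  define k1 where "k1 = max k0 k'"
  have sm: "summable ?x"
    using summable_mult[of "\<lambda>k. real k powr (-3/2)" C] summable_real_powr_iff[of "-3/2"]
      summable_Suc_iff[of "\<lambda>k. C * real k powr (-3/2)"] by simp
  have x0: "?x k \<ge> 0" for k using C by simp
  have lnstep: "\<bar>ln (V k) - ln (V (Suc k))\<bar> \<le> 2 * ?x k" if k: "k \<ge> k1" for k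
  proof -
    have p: "V k > 0" "V (Suc k) > 0" using pos k by (auto simp: k1_def)
    define \<xi> where "\<xi> = V k / V (Suc k) - 1"
    have "\<bar>\<xi>\<bar> = \<bar>V k - V (Suc k)\<bar> / V (Suc k)" using p by (simp add: \<xi>_def diff_divide_distrib[symmetric] field_simps abs_divide)
    also have "\<dots> \<le> ?x k" using step[of k] k p by (simp add: divide_le_eq k1_def)
    finally have \<xi>: "\<bar>\<xi>\<bar> \<le> ?x k" .
    then have \<xi>2: "\<bar>\<xi>\<bar> \<le> 1/2" using k'[of k] k by (simp add: k1_def)
    have "ln (V k) - ln (V (Suc k)) = ln (1 + \<xi>)" using p by (simp add: \<xi>_def ln_div)
    moreover have "\<bar>ln (1 + \<xi>) - \<xi>\<bar> \<le> 2 * \<xi>\<^sup>2" by (rule abs_ln_one_plus_x_minus_x_bound[OF \<xi>2])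
    moreover have "2 * \<xi>\<^sup>2 \<le> \<bar>\<xi>\<bar>"
    proof -
      have "2 * \<xi>\<^sup>2 = 2 * \<bar>\<xi>\<bar> * \<bar>\<xi>\<bar>" by (simp add: power2_eq_square)
      also have "\<dots> \<le> 1 * \<bar>\<xi>\<bar>" using \<xi>2 by (intro mult_right_mono) auto
      finally show ?thesis by simp
    qed
    ultimately show ?thesis using \<xi> by linarith
  qed
  define S where "S = 2 * suminf ?x"
  have bnd: "\<bar>ln (V k1) - ln (V (k1 + l))\<bar> \<le> S" for l
  proof -
    have "\<bar>ln (V k1) - ln (V (k1 + l))\<bar> \<le> (\<Sum>j<l. \<bar>ln (V (k1 + j)) - ln (V (Suc (k1 + j)))\<bar>)"
      by (induction l) auto
    also have "\<dots> \<le> (\<Sum>j<l. 2 * ?x (k1 + j))" by (intro sum_mono lnstep) auto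
    also have "\<dots> = 2 * (\<Sum>k\<in>(\<lambda>j. k1 + j) ` {..<l}. ?x k)"
      by (subst sum.reindex) (auto simp: inj_on_def sum_distrib_left)
    also have "\<dots> \<le> 2 * suminf ?x" by (intro mult_left_mono sum_le_suminf sm x0) auto
    finally show ?thesis by (simp add: S_def)
  qed
  have p1: "V k1 > 0" using pos by (simp add: k1_def)
  show ?thesis
  proof (rule that[of k1 "V k1 * exp (- S)" "V k1 * exp S"])
    show "k1 \<ge> k0" by (simp add: k1_def)
    show "V k1 * exp (- S) > 0" using p1 by simp
    fix k assume k: "k \<ge> k1"
    then obtain l where l: "k = k1 + l" using le_Suc_ex by blast
    have pk: "V k > 0" using pos k by (simp add: k1_def)
    have "ln (V k1 * exp (- S)) \<le> ln (V k)" "ln (V k) \<le> ln (V k1 * exp S)"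
      using bnd[of l] p1 by (auto simp: ln_mult l)
    then show "V k1 * exp (- S) \<le> V k \<and> V k \<le> V k1 * exp S" using p1 pk by simp
  qed
qed

text \<open>The pair \<open>(v, \<lambda>)\<close> with \<open>v\<^sub>n = n t\<^sub>n\<close> obeys \<open>v\<^sub>n\<^sub>+\<^sub>1 = v\<^sub>n - 2a \<lambda>\<^sub>n\<close>,
  \<open>\<lambda>\<^sub>n\<^sub>+\<^sub>1 = \<lambda>\<^sub>n + v\<^sub>n\<^sub>+\<^sub>1 / (n + 1)\<close>: an oscillator with slowly varying frequency.
  Its quadratic energy has exact increments.\<close>

definition scaled_theta :: "real \<Rightarrow> nat \<Rightarrow> real" where "scaled_theta a n = real n * theta_coeff a n"

definition osc_energy :: "real \<Rightarrow> nat \<Rightarrow> real" where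
  "osc_energy a n = (scaled_theta a n)\<^sup>2 - 2 * a * (scaled_theta a n * laguerre a n) + a * (2 * real n + 1) * (laguerre a n)\<^sup>2"

text \<open>The cross term makes the increments proportional to the energy itself, up to summable relative
  errors: it averages out the exchange between the two parts of the energy during an oscillation.\<close>

definition osc_energy' :: "real \<Rightarrow> nat \<Rightarrow> real" where
  "osc_energy' a n = osc_energy a n + scaled_theta a n * laguerre a n / 2"

lemma scaled_theta_Suc: "scaled_theta a (Suc n) = scaled_theta a n - 2 * a * laguerre a n"
  using theta_coeff_recurrence[of n a] by (simp add: scaled_theta_def)

lemma osc_energy_Suc: "osc_energy a (Suc n) = osc_energy a n + a * ((laguerre a n)\<^sup>2 + (laguerre a (Suc n))\<^sup>2)"
proof -
  define l where "l = laguerre a (Suc n)"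
  define t where "t = theta_coeff a (Suc n)"
  have L: "laguerre a n = l - t" by (simp add: l_def t_def laguerre_Suc)
  have V': "scaled_theta a (Suc n) = real (Suc n) * t" by (simp add: scaled_theta_def t_def)
  have V: "scaled_theta a n = real (Suc n) * t + 2 * a * (l - t)" using scaled_theta_Suc[of a n] by (simp add: V' L)
  show ?thesis unfolding osc_energy_def V V' L l_def[symmetric]
    by (simp add: power2_eq_square algebra_simps)
qed

lemma osc_energy'_Suc: "osc_energy' a (Suc n) = osc_energy' a n + a * (laguerre a (Suc n))\<^sup>2 + (scaled_theta a (Suc n))\<^sup>2 / (2 * real (Suc n))"
proof -
  define l where "l = laguerre a (Suc n)"
  define t where "t = theta_coeff a (Suc n)"
  have L: "laguerre a n = l - t" by (simp add: l_def t_def laguerre_Suc)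
  have V': "scaled_theta a (Suc n) = real (Suc n) * t" by (simp add: scaled_theta_def t_def)
  have V: "scaled_theta a n = real (Suc n) * t + 2 * a * (l - t)" using scaled_theta_Suc[of a n] by (simp add: V' L)
  have Q: "(real (Suc n) * t)\<^sup>2 / (2 * real (Suc n)) = real (Suc n) * t\<^sup>2 / 2"
    by (simp add: power2_eq_square del: of_nat_Suc)
  show ?thesis unfolding osc_energy'_def osc_energy_Suc V V' L l_def[symmetric] Q
    by (simp add: power2_eq_square field_simps)
qed

lemma osc_energy'_increment:
  "osc_energy' a (Suc n) - osc_energy' a n = osc_energy a (Suc n) / (2 * real (Suc n)) +
     a * (scaled_theta a (Suc n) * laguerre a (Suc n)) / real (Suc n) - a * (laguerre a (Suc n))\<^sup>2 / (2 * real (Suc n))"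
proof -
  have "k > 0 \<Longrightarrow> a * l\<^sup>2 + v\<^sup>2 / (2 * k) =
      (v\<^sup>2 - 2 * a * (v * l) + a * (2 * k + 1) * l\<^sup>2) / (2 * k) + a * (v * l) / k - a * l\<^sup>2 / (2 * k)"
    for k v l :: real
    by (simp add: field_simps)
  from this[of "real (Suc n)"] show ?thesis unfolding osc_energy'_Suc osc_energy_def by simp
qed

lemma osc_energy_pos:
  assumes "a > 0"
  shows "osc_energy a n > 0"
proof (induction n)
  case (Suc n)
  then show ?case unfolding osc_energy_Suc using assms by (simp add: add_pos_nonneg)
qed (use assms in \<open>simp add: osc_energy_def scaled_theta_def\<close>)

lemma osc_energy_ge:
  assumes a: "a > 0" and k: "real k + 1 \<ge> 2 * a"
  shows "osc_energy a k \<ge> (scaled_theta a k)\<^sup>2 / 2 + a * real k * (laguerre a k)\<^sup>2"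
proof -
  let ?v = "scaled_theta a k" and ?l = "laguerre a k"
  have "osc_energy a k - ((?v)\<^sup>2 / 2 + a * real k * ?l\<^sup>2) = (?v - 2 * a * ?l)\<^sup>2 / 2 + a * ?l\<^sup>2 * (real k + 1 - 2 * a)"
    by (simp add: osc_energy_def power2_eq_square field_simps)
  also have "\<dots> \<ge> 0" using a k by simp
  finally show ?thesis by simp
qed

lemma osc_energy_cross:
  assumes a: "a > 0" and k: "real k + 1 \<ge> 2 * a"
  shows "sqrt (2 * a * real k) * \<bar>scaled_theta a k * laguerre a k\<bar> \<le> osc_energy a k"
proof -
  let ?v = "\<bar>scaled_theta a k\<bar>" and ?l = "\<bar>laguerre a k\<bar>" and ?s = "sqrt (2 * a * real k)"
  have s2: "?s * ?s = 2 * a * real k" using a by simp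
  have sq: "(v - s * l)\<^sup>2 / 2 = v\<^sup>2 / 2 - s * (v * l) + (s * s) * l\<^sup>2 / 2" for v s l :: real
    by (simp add: power2_eq_square field_simps)
  have "0 \<le> (?v - ?s * ?l)\<^sup>2 / 2" by simp
  also have "\<dots> = ?v\<^sup>2 / 2 - ?s * (?v * ?l) + (?s * ?s) * ?l\<^sup>2 / 2" by (rule sq)
  also have "\<dots> = (scaled_theta a k)\<^sup>2 / 2 - ?s * (?v * ?l) + a * real k * (laguerre a k)\<^sup>2"
    unfolding s2 by simp
  finally show ?thesis using osc_energy_ge[OF assms] by (simp add: abs_mult)
qed

text \<open>The increments of \<open>osc_energy'\<close> are \<open>osc_energy' / (2k)\<close> with a relative error \<open>O(k powr (-1/2))\<close>, so
  \<open>osc_energy'\<^sup>2 / k\<close> is slowly varying.\<close>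

lemma osc_energy_asymptotics:
  assumes a: "a > 0"
  shows "\<exists>b>0. \<exists>B k1. \<forall>k\<ge>k1. b * sqrt (real k) \<le> osc_energy a k \<and> osc_energy a k \<le> B * sqrt (real k)"
proof -
  define k0 where "k0 = nat \<lceil>2 * a + 1 / (2 * a)\<rceil> + 1"
  have k0: "real k + 1 \<ge> 2 * a" "2 * a * real k \<ge> 1" "k \<ge> 1" if "k \<ge> k0" for k
  proof -
    have "real k \<ge> 2 * a + 1 / (2 * a)" using that unfolding k0_def by linarith
    moreover have "1 / (2 * a) > 0" using a by simp
    ultimately have "real k \<ge> 2 * a" "real k \<ge> 1 / (2 * a)" using a by linarith+
    then show "real k + 1 \<ge> 2 * a" "2 * a * real k \<ge> 1" using a by (auto simp: divide_le_eq mult_ac)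
    show "k \<ge> 1" using that by (simp add: k0_def)
  qed
  let ?E = "osc_energy a" and ?Y = "osc_energy' a" and ?w = "\<lambda>k. scaled_theta a k * laguerre a k"
  have w_le: "\<bar>?w k\<bar> \<le> ?E k / sqrt (2 * a * real k)" if "k \<ge> k0" for k
  proof -
    have "sqrt (2 * a * real k) > 0" using k0(2)[OF that] by (subst real_sqrt_gt_0_iff) linarith
    then show ?thesis using osc_energy_cross[OF a k0(1)[OF that]] by (simp only: pos_le_divide_eq mult.commute)
  qed
  have w_le1: "\<bar>?w k\<bar> \<le> ?E k" if "k \<ge> k0" for k
  proof -
    have "?E k / sqrt (2 * a * real k) \<le> ?E k / 1"
      using osc_energy_pos[OF a, of k] k0(2)[OF that] by (intro divide_left_mono) auto
    then show ?thesis using w_le[OF that] by simp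
  qed
  have Y: "?E k / 2 \<le> ?Y k" "?Y k \<le> 2 * ?E k" if "k \<ge> k0" for k
    using w_le1[OF that] osc_energy_pos[OF a, of k] unfolding osc_energy'_def by linarith+
  have Y0: "?Y k > 0" if "k \<ge> k0" for k using Y(1)[OF that] osc_energy_pos[OF a, of k] by linarith
  define C1 where "C1 = 2 * ((a + 1/4) / sqrt (2 * a) + 1/2)"
  have C1: "C1 \<ge> 0" using a by (simp add: C1_def)
  have powr32: "real k powr (-3/2) = 1 / (real k * sqrt (real k))" if "k \<ge> 1" for k
  proof -
    have "real k powr (-3/2) = real k powr (-1) * real k powr (-(1/2))"
      by (subst powr_add[symmetric]) simp
    then show ?thesis using that by (simp add: powr_minus powr_half_sqrt field_simps)
  qed
  have \<eta>: "\<bar>?Y (Suc k) - ?Y k - ?Y (Suc k) / (2 * real (Suc k))\<bar> \<le> C1 * real (Suc k) powr (-3/2) * ?Y (Suc k)"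
    if k: "k \<ge> k0" for k
  proof -
    define n where "n = Suc k"
    have n0: "n \<ge> k0" using k by (simp add: n_def)
    have n1: "real n \<ge> 1" using k0(3)[OF n0] by simp
    have sq: "sqrt (real n) \<le> real n"
    proof -
      have "sqrt (real n) * 1 \<le> sqrt (real n) * sqrt (real n)" using n1 by (intro mult_left_mono) auto
      then show ?thesis by simp
    qed
    have "?Y n - ?Y k - ?Y n / (2 * real n) = (a - 1/4) * ?w n / real n - a * (laguerre a n)\<^sup>2 / (2 * real n)"
    proof -
      have "?Y n / (2 * real n) = ?E n / (2 * real n) + ?w n / (4 * real n)"
        by (simp add: osc_energy'_def add_divide_distrib)
      moreover have "(a - 1/4) * ?w n / real n = a * ?w n / real n - ?w n / (4 * real n)"
        by (simp add: left_diff_distrib diff_divide_distrib)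
      ultimately show ?thesis using osc_energy'_increment[of a k] unfolding n_def[symmetric] by linarith
    qed
    then have "\<bar>?Y n - ?Y k - ?Y n / (2 * real n)\<bar> \<le> \<bar>(a - 1/4) * ?w n / real n\<bar> + \<bar>a * (laguerre a n)\<^sup>2 / (2 * real n)\<bar>"
      by linarith
    also have "\<bar>(a - 1/4) * ?w n / real n\<bar> \<le> (a + 1/4) * (?E n / sqrt (2 * a * real n)) / real n"
    proof -
      have "\<bar>(a - 1/4) * ?w n / real n\<bar> = \<bar>a - 1/4\<bar> * \<bar>?w n\<bar> / real n" by (simp add: abs_mult)
      also have "\<dots> \<le> (a + 1/4) * (?E n / sqrt (2 * a * real n)) / real n"
        using a by (intro divide_right_mono mult_mono w_le n0) auto
      finally show ?thesis .
    qed
    also have "\<bar>a * (laguerre a n)\<^sup>2 / (2 * real n)\<bar> \<le> ?E n / (2 * (real n * real n))"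
    proof -
      have "a * real n * (laguerre a n)\<^sup>2 \<le> ?E n"
        using osc_energy_ge[OF a k0(1)[OF n0]] zero_le_power2[of "scaled_theta a n"] by linarith
      then have "a * real n * (laguerre a n)\<^sup>2 / (2 * (real n * real n)) \<le> ?E n / (2 * (real n * real n))"
        by (intro divide_right_mono) auto
      moreover have "\<bar>a * (laguerre a n)\<^sup>2 / (2 * real n)\<bar> = a * real n * (laguerre a n)\<^sup>2 / (2 * (real n * real n))"
        using n1 a by simp
      ultimately show ?thesis by simp
    qed
    also have "?E n / (2 * (real n * real n)) \<le> ?E n / (2 * (real n * sqrt (real n)))"
      using n1 sq osc_energy_pos[OF a, of n] by (intro divide_left_mono mult_left_mono) auto
    finally have "\<bar>?Y n - ?Y k - ?Y n / (2 * real n)\<bar> \<le>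
        (a + 1/4) * (?E n / sqrt (2 * a * real n)) / real n + ?E n / (2 * (real n * sqrt (real n)))" by simp
    also have "\<dots> = ((a + 1/4) / sqrt (2 * a) + 1/2) * real n powr (-3/2) * ?E n"
    proof -
      have "A * (E / (s * r)) / q + E / (2 * (q * r)) = (A / s + 1/2) * (1 / (q * r)) * E"
        if "s > 0" "r > 0" "q > 0" for A E s r q :: real
        using that by (simp add: field_simps)
      moreover have "sqrt (2 * a * real n) = sqrt (2 * a) * sqrt (real n)" by (rule real_sqrt_mult)
      ultimately show ?thesis using n1 a powr32[OF k0(3)[OF n0]] by simp
    qed
    also have "\<dots> \<le> ((a + 1/4) / sqrt (2 * a) + 1/2) * real n powr (-3/2) * (2 * ?Y n)"
      using Y(1)[OF n0] a by (intro mult_left_mono) auto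
    finally show ?thesis by (simp only: C1_def n_def mult_ac)
  qed
  define V where "V = (\<lambda>k. (?Y k)\<^sup>2 / real k)"
  define C2 where "C2 = 2 * (2 * C1 + (1/2 + C1)\<^sup>2)"
  have Vstep: "\<bar>V k - V (Suc k)\<bar> \<le> C2 * real (Suc k) powr (-3/2) * V (Suc k)" if k: "k \<ge> k0" for k
  proof -
    define n where "n = real (Suc k)"
    define y where "y = ?Y (Suc k)"
    define p where "p = n powr (-3/2)"
    have k1: "real k \<ge> 1" using k0(3)[OF k] by simp
    have n2: "n \<ge> 2" using k1 by (simp add: n_def)
    have y0: "y > 0" using Y0[of "Suc k"] k by (simp add: y_def)
    have p: "p = 1 / (n * sqrt n)" unfolding p_def n_def using powr32[of "Suc k"] by simp
    have sqn: "1 \<le> sqrt n" using n2 by simp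
    have p_n: "p \<le> 1 / n" unfolding p using n2 sqn by (intro divide_left_mono) (auto intro: mult_pos_pos)
    have nn_p: "1 / (n * n) \<le> p"
    proof -
      have "sqrt n * 1 \<le> sqrt n * sqrt n" using sqn by (intro mult_left_mono) auto
      also have "\<dots> = n" using n2 by simp
      finally have "n * sqrt n \<le> n * n" using n2 by (intro mult_left_mono) auto
      then show ?thesis unfolding p using n2 by (intro divide_left_mono mult_pos_pos) auto
    qed
    have p0: "p \<ge> 0" by (simp add: p_def)
    define \<delta> where "\<delta> = (y - ?Y k) / y"
    have Yk: "?Y k = y * (1 - \<delta>)" using y0 by (simp add: \<delta>_def field_simps)
    define e where "e = \<delta> - 1 / (2 * n)"
    have e: "\<bar>e\<bar> \<le> C1 * p"
    proof -
      have "e = (y - ?Y k - y / (2 * n)) / y" using y0 n2 by (simp add: e_def \<delta>_def field_simps)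
      then have "\<bar>e\<bar> = \<bar>y - ?Y k - y / (2 * n)\<bar> / y" using y0 by (simp add: abs_divide)
      also have "\<dots> \<le> C1 * p" using \<eta>[OF k] y0 by (simp add: divide_le_eq y_def n_def p_def)
      finally show ?thesis .
    qed
    have \<delta>: "\<bar>\<delta>\<bar> \<le> (1/2 + C1) / n"
    proof -
      have "C1 * p \<le> C1 * (1 / n)" by (intro mult_left_mono p_n C1)
      moreover have "\<bar>1 / (2 * n)\<bar> = 1 / (2 * n)" using n2 by simp
      ultimately have "\<bar>\<delta>\<bar> \<le> 1 / (2 * n) + C1 * (1 / n)" using e unfolding e_def by linarith
      then show ?thesis by (simp add: add_divide_distrib)
    qed
    have "\<delta>\<^sup>2 \<le> ((1/2 + C1) / n)\<^sup>2" using \<delta> C1 n2 by (intro abs_le_square_iff[THEN iffD1]) auto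
    also have "\<dots> = (1/2 + C1)\<^sup>2 * (1 / (n * n))" by (simp add: power_divide power2_eq_square)
    also have "\<dots> \<le> (1/2 + C1)\<^sup>2 * p" by (intro mult_left_mono nn_p) auto
    finally have \<delta>2: "\<delta>\<^sup>2 \<le> (1/2 + C1)\<^sup>2 * p" .
    have kn: "real k = n - 1" by (simp add: n_def)
    have "V k - V (Suc k) = y\<^sup>2 / n * ((n / (n - 1)) * ((1 - \<delta>)\<^sup>2 - (1 - 1 / n)))"
      unfolding V_def Yk kn n_def[symmetric] y_def[symmetric] using n2 by (simp add: field_simps power2_eq_square)
    also have "(1 - \<delta>)\<^sup>2 - (1 - 1 / n) = - 2 * e + \<delta>\<^sup>2"
      using n2 by (simp add: e_def power2_eq_square algebra_simps)
    finally have "\<bar>V k - V (Suc k)\<bar> = y\<^sup>2 / n * ((n / (n - 1)) * \<bar>- 2 * e + \<delta>\<^sup>2\<bar>)"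
      using n2 by (simp add: abs_mult)
    also have "\<dots> \<le> y\<^sup>2 / n * (2 * ((2 * C1 + (1/2 + C1)\<^sup>2) * p))"
    proof (intro mult_left_mono mult_mono)
      show "n / (n - 1) \<le> 2" using n2 by (simp add: divide_le_eq)
      have "\<bar>- 2 * e + \<delta>\<^sup>2\<bar> \<le> 2 * \<bar>e\<bar> + \<delta>\<^sup>2" using zero_le_power2[of \<delta>] by linarith
      then show "\<bar>- 2 * e + \<delta>\<^sup>2\<bar> \<le> (2 * C1 + (1/2 + C1)\<^sup>2) * p" using e \<delta>2 by (simp add: algebra_simps)
    qed (use n2 in auto)
    also have "\<dots> = C2 * p * V (Suc k)" by (simp add: C2_def V_def y_def n_def)
    finally show ?thesis by (simp add: p_def n_def)
  qed
  have V0: "V k > 0" if "k \<ge> k0" for k using Y0[OF that] k0(3)[OF that] by (simp add: V_def)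
  have C2: "C2 \<ge> 0" using C1 by (simp add: C2_def)
  obtain k1 b B where kb: "k1 \<ge> k0" "b > 0" "\<And>k. k \<ge> k1 \<Longrightarrow> b \<le> V k \<and> V k \<le> B"
    using slowly_varying_bounded[OF V0 C2 Vstep] by blast
  have "\<forall>k\<ge>k1. sqrt b / 2 * sqrt (real k) \<le> ?E k \<and> ?E k \<le> 2 * sqrt B * sqrt (real k)"
  proof (intro allI impI conjI)
    fix k assume k: "k1 \<le> k"
    have kk0: "k \<ge> k0" using k kb(1) by simp
    have kp: "real k > 0" using k0(3)[OF kk0] by simp
    have "sqrt b \<le> sqrt (V k)" "sqrt (V k) \<le> sqrt B" using kb(3)[OF k] by auto
    moreover have "sqrt (V k) = ?Y k / sqrt (real k)" using Y0[OF kk0] by (simp add: V_def real_sqrt_divide)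
    ultimately have "sqrt b * sqrt (real k) \<le> ?Y k" "?Y k \<le> sqrt B * sqrt (real k)"
      using kp by (simp_all add: le_divide_eq divide_le_eq)
    then show "sqrt b / 2 * sqrt (real k) \<le> ?E k" "?E k \<le> 2 * sqrt B * sqrt (real k)"
      using Y[OF kk0] by auto
  qed
  moreover have "sqrt b / 2 > 0" using kb(2) by simp
  ultimately show ?thesis by blast
qed

lemma endpoint_bounds:
  assumes a: "a > 0"
  obtains C where "C > 0" "\<And>n. (scaled_theta a n)\<^sup>2 \<le> C * sqrt (real (Suc n))" "\<And>n. (laguerre a n)\<^sup>2 \<le> C / sqrt (real (Suc n))"
proof -
  obtain k1 b B where kb: "b > 0" "\<And>k. k \<ge> k1 \<Longrightarrow> b * sqrt (real k) \<le> osc_energy a k \<and> osc_energy a k \<le> B * sqrt (real k)"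
    using osc_energy_asymptotics[OF a] by blast
  define k2 where "k2 = max (max k1 1) (nat \<lceil>2 * a\<rceil>)"
  have k2: "k \<ge> k1" "real k \<ge> 1" "real k + 1 \<ge> 2 * a" if "k \<ge> k2" for k
  proof -
    show "k \<ge> k1" using that by (simp add: k2_def)
    have "k \<ge> 1" using that by (simp add: k2_def)
    then show "real k \<ge> 1" by simp
    have "nat \<lceil>2 * a\<rceil> \<le> k" using that by (metis k2_def max.bounded_iff)
    then show "real k + 1 \<ge> 2 * a" by linarith
  qed
  have v: "(scaled_theta a k)\<^sup>2 / sqrt (real (Suc k)) \<le> 2 * B" if k: "k \<ge> k2" for k
  proof -
    have "a * real k * (laguerre a k)\<^sup>2 \<ge> 0" using a by simp
    then have "(scaled_theta a k)\<^sup>2 \<le> 2 * (B * sqrt (real k))"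
      using osc_energy_ge[OF a k2(3)[OF k]] kb(2)[OF k2(1)[OF k]] by linarith
    also have "\<dots> \<le> 2 * (B * sqrt (real (Suc k)))"
    proof -
      have "0 < B * sqrt (real k)" using kb(2)[OF k2(1)[OF k]] osc_energy_pos[OF a, of k] by linarith
      then have "B > 0" using k2(2)[OF k] by (simp add: zero_less_mult_iff)
      then show ?thesis by (intro mult_left_mono) auto
    qed
    finally show ?thesis by (simp add: divide_le_eq del: of_nat_Suc)
  qed
  have l: "(laguerre a k)\<^sup>2 * sqrt (real (Suc k)) \<le> 2 * B / a" if k: "k \<ge> k2" for k
  proof -
    have k1: "real k \<ge> 1" by (rule k2(2)[OF k])
    have "a * real k * (laguerre a k)\<^sup>2 \<le> B * sqrt (real k)"
      using osc_energy_ge[OF a k2(3)[OF k]] kb(2)[OF k2(1)[OF k]] zero_le_power2[of "scaled_theta a k"] by linarith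
    moreover have "a * real k * (laguerre a k)\<^sup>2 = a * (laguerre a k)\<^sup>2 * (sqrt (real k) * sqrt (real k))" by simp
    ultimately have "(a * (laguerre a k)\<^sup>2 * sqrt (real k)) * sqrt (real k) \<le> B * sqrt (real k)"
      by (simp only: mult.assoc)
    then have "a * (laguerre a k)\<^sup>2 * sqrt (real k) \<le> B"
      by (rule mult_right_le_imp_le) (use k1 in simp)
    then have *: "(laguerre a k)\<^sup>2 * sqrt (real k) \<le> B / a" using a by (simp add: le_divide_eq mult_ac)
    have "sqrt (real (Suc k)) \<le> sqrt (4 * real k)" using k1 by (intro real_sqrt_le_mono) simp
    also have "\<dots> = 2 * sqrt (real k)" by (simp add: real_sqrt_mult)
    finally have "(laguerre a k)\<^sup>2 * sqrt (real (Suc k)) \<le> (laguerre a k)\<^sup>2 * (2 * sqrt (real k))" by (intro mult_left_mono) auto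
    moreover have "(laguerre a k)\<^sup>2 * (2 * sqrt (real k)) = 2 * ((laguerre a k)\<^sup>2 * sqrt (real k))" by simp
    moreover have "2 * B / a = 2 * (B / a)" by simp
    ultimately show ?thesis using * by linarith
  qed
  obtain C1 where C1: "\<And>n. (scaled_theta a n)\<^sup>2 / sqrt (real (Suc n)) \<le> C1"
    using eventually_bounded_imp_bounded[of k2 "\<lambda>n. (scaled_theta a n)\<^sup>2 / sqrt (real (Suc n))" "2 * B", OF v] by metis
  obtain C2 where C2: "\<And>n. (laguerre a n)\<^sup>2 * sqrt (real (Suc n)) \<le> C2"
    using eventually_bounded_imp_bounded[of k2 "\<lambda>n. (laguerre a n)\<^sup>2 * sqrt (real (Suc n))" "2 * B / a", OF l] by metis
  show ?thesis
  proof (rule that[of "max 1 (max C1 C2)"])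
    fix n
    have "(scaled_theta a n)\<^sup>2 / sqrt (real (Suc n)) \<le> max 1 (max C1 C2)" using C1[of n] by linarith
    then show "(scaled_theta a n)\<^sup>2 \<le> max 1 (max C1 C2) * sqrt (real (Suc n))" by (simp add: divide_le_eq del: of_nat_Suc)
    have "(laguerre a n)\<^sup>2 * sqrt (real (Suc n)) \<le> max 1 (max C1 C2)" using C2[of n] by linarith
    then show "(laguerre a n)\<^sup>2 \<le> max 1 (max C1 C2) / sqrt (real (Suc n))" by (simp add: le_divide_eq del: of_nat_Suc)
  qed simp
qed

text \<open>The diagonal at \<open>N\<close> is at least the sum of \<open>t\<^sub>j\<^sup>2 = v\<^sub>j\<^sup>2 / j\<^sup>2\<close> over \<open>N < j \<le> K N\<close>. The two
  increment formulas express the sum of \<open>v\<^sub>j\<^sup>2 / j\<close> through the energies at the ends, and a large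
  constant \<open>K\<close> makes the energy at \<open>K N\<close> dominate.\<close>

lemma model_kern_diag_lower:
  assumes a: "a > 0"
  obtains N0 c where "c > 0" "\<And>N. N \<ge> N0 \<Longrightarrow> model_kern a N N \<ge> c / sqrt (real N)"
proof -
  obtain k1 b B where kb: "b > 0" "\<And>k. k \<ge> k1 \<Longrightarrow> b * sqrt (real k) \<le> osc_energy a k \<and> osc_energy a k \<le> B * sqrt (real k)"
    using osc_energy_asymptotics[OF a] by blast
  have B0: "B > 0"
  proof -
    have "b * sqrt (real (Suc k1)) \<le> B * sqrt (real (Suc k1))"
      using kb(2)[of "Suc k1"] by linarith
    then show ?thesis using kb(1) by (simp del: of_nat_Suc)
  qed
  define K where "K = nat \<lceil>(8 * B / b)\<^sup>2\<rceil> + 2"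
  have K: "sqrt (real K) \<ge> 8 * B / b"
  proof (rule real_le_rsqrt)
    show "(8 * B / b)\<^sup>2 \<le> real K" unfolding K_def by linarith
  qed
  define N0 where "N0 = max (max k1 4) (nat \<lceil>2 * a + 8 / a\<rceil>)"
  have N0: "k \<ge> k1" "real k \<ge> 4" "real k + 1 \<ge> 2 * a" "2 * a * real k \<ge> 16" if "k \<ge> N0" for k
  proof -
    show "k \<ge> k1" using that by (simp add: N0_def)
    have "k \<ge> 4" using that by (simp add: N0_def)
    then show "real k \<ge> 4" by simp
    have "nat \<lceil>2 * a + 8 / a\<rceil> \<le> k" using that by (metis N0_def max.bounded_iff)
    then have k: "real k \<ge> 2 * a + 8 / a" by linarith
    have "8 / a > 0" using a by simp
    then show "real k + 1 \<ge> 2 * a" using k by linarith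
    have "real k \<ge> 8 / a" using k a by linarith
    then show "2 * a * real k \<ge> 16" using a by (simp add: divide_le_eq mult_ac)
  qed
  have w: "\<bar>scaled_theta a k * laguerre a k\<bar> \<le> osc_energy a k / 4" if k: "k \<ge> N0" for k
  proof -
    have "4 = sqrt 16" by simp
    also have "\<dots> \<le> sqrt (2 * a * real k)" using N0(4)[OF k] by (intro real_sqrt_le_mono)
    finally have "4 * \<bar>scaled_theta a k * laguerre a k\<bar> \<le> sqrt (2 * a * real k) * \<bar>scaled_theta a k * laguerre a k\<bar>"
      by (intro mult_right_mono) auto
    then show ?thesis using osc_energy_cross[OF a N0(3)[OF k]] by linarith
  qed
  have l: "a * (laguerre a k)\<^sup>2 \<le> osc_energy a k / 4" if k: "k \<ge> N0" for k
  proof -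
    have "4 * (a * (laguerre a k)\<^sup>2) \<le> real k * (a * (laguerre a k)\<^sup>2)"
      using N0(2)[OF k] a by (intro mult_right_mono) auto
    moreover have "real k * (a * (laguerre a k)\<^sup>2) = a * real k * (laguerre a k)\<^sup>2" by simp
    ultimately show ?thesis using osc_energy_ge[OF a N0(3)[OF k]] zero_le_power2[of "scaled_theta a k"]
      by linarith
  qed
  show ?thesis
  proof (rule that[of "2 * B / real K" N0])
    have "real K > 0" unfolding K_def by linarith
    then show "2 * B / real K > 0" using B0 by simp
    fix N assume N: "N \<ge> N0"
    define J where "J = K * N"
    have K2: "K \<ge> 2" by (simp add: K_def)
    have NJ: "N \<le> J" using K2 by (simp add: J_def)
    have JN0: "J \<ge> N0" using NJ N by simp
    have tel: "(\<Sum>j\<in>{N<..J}. (scaled_theta a j)\<^sup>2 / (2 * real j)) + (\<Sum>j\<in>{N<..J}. a * (laguerre a j)\<^sup>2) = osc_energy' a J - osc_energy' a N"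
      if "N \<le> J" for J using that
    proof (induction J rule: dec_induct)
      case (step J)
      have "{N<..Suc J} = insert (Suc J) {N<..J}" using step by auto
      then show ?case using step osc_energy'_Suc[of a J] by simp
    qed simp
    have tel2: "(\<Sum>j\<in>{N<..J}. a * (laguerre a j)\<^sup>2) = (osc_energy a J - osc_energy a N - a * (laguerre a N)\<^sup>2 + a * (laguerre a J)\<^sup>2) / 2"
      if "N \<le> J" for J using that
    proof (induction J rule: dec_induct)
      case (step J)
      have "{N<..Suc J} = insert (Suc J) {N<..J}" using step by auto
      then show ?case using step osc_energy_Suc[of a J] by (simp add: field_simps)
    qed simp
    have "(\<Sum>j\<in>{N<..J}. (scaled_theta a j)\<^sup>2 / (2 * real j)) =
      osc_energy' a J - osc_energy' a N - (osc_energy a J - osc_energy a N - a * (laguerre a N)\<^sup>2 + a * (laguerre a J)\<^sup>2) / 2"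
      using tel[OF NJ] tel2[OF NJ] by linarith
    also have "\<dots> \<ge> osc_energy a J / 4 - osc_energy a N"
    proof -
      have "a * (laguerre a N)\<^sup>2 \<ge> 0" using a by simp
      moreover have "scaled_theta a J * laguerre a J \<ge> - (osc_energy a J / 4)" "scaled_theta a N * laguerre a N \<le> osc_energy a N / 4"
        using w[OF N] w[OF JN0] by linarith+
      ultimately show ?thesis using l[OF JN0] osc_energy_pos[OF a, of N] unfolding osc_energy'_def
        by (simp add: field_simps)
    qed
    finally have S: "(\<Sum>j\<in>{N<..J}. (scaled_theta a j)\<^sup>2 / (2 * real j)) \<ge> osc_energy a J / 4 - osc_energy a N" .
    have "osc_energy a J / 4 - osc_energy a N \<ge> B * sqrt (real N)"
    proof -
      have "b * (8 * B / b) * sqrt (real N) \<le> b * sqrt (real K) * sqrt (real N)"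
        using K kb(1) by (intro mult_right_mono mult_left_mono) auto
      then have "8 * B * sqrt (real N) \<le> b * sqrt (real J)"
        using kb(1) by (simp add: J_def real_sqrt_mult mult_ac)
      then show ?thesis using kb(2)[OF N0(1)[OF JN0]] kb(2)[OF N0(1)[OF N]] by linarith
    qed
    then have S2: "B * sqrt (real N) \<le> (\<Sum>j\<in>{N<..J}. (scaled_theta a j)\<^sup>2 / (2 * real j))" using S by linarith
    have Np: "real N > 0" using N0(2)[OF N] by linarith
    have "(\<Sum>j\<in>{N<..J}. (scaled_theta a j)\<^sup>2 / (2 * real j)) \<le> (\<Sum>j\<in>{N<..J}. real J / 2 * (theta_coeff a j)\<^sup>2)"
    proof (rule sum_mono)
      fix j assume j: "j \<in> {N<..J}"
      then have "(scaled_theta a j)\<^sup>2 / (2 * real j) = real j / 2 * (theta_coeff a j)\<^sup>2"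
        by (simp add: scaled_theta_def power2_eq_square)
      also have "\<dots> \<le> real J / 2 * (theta_coeff a j)\<^sup>2" using j by (intro mult_right_mono) auto
      finally show "(scaled_theta a j)\<^sup>2 / (2 * real j) \<le> real J / 2 * (theta_coeff a j)\<^sup>2" .
    qed
    also have "\<dots> = real J / 2 * (\<Sum>j\<in>{N<..J}. (theta_coeff a j)\<^sup>2)" by (simp add: sum_distrib_left)
    also have "(\<Sum>j\<in>{N<..J}. (theta_coeff a j)\<^sup>2) = model_kern a N N - model_kern a J J" using NJ
    proof (induction J rule: dec_induct)
      case (step J)
      have "{N<..Suc J} = insert (Suc J) {N<..J}" using step by auto
      then show ?case using step model_kern_Suc_Suc[of a J J] by (simp add: power2_eq_square)
    qed simp
    also have "real J / 2 * (model_kern a N N - model_kern a J J) \<le> real J / 2 * model_kern a N N"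
      using model_kern_diag_nonneg[OF a, of J] by (intro mult_left_mono) auto
    finally have "B * sqrt (real N) \<le> real K * real N / 2 * model_kern a N N" using S2 by (simp add: J_def)
    then have "(2 * B) * sqrt (real N) \<le> real K * real N * model_kern a N N" by simp
    also have "\<dots> = (real K * sqrt (real N) * model_kern a N N) * sqrt (real N)" by simp
    finally have "2 * B \<le> real K * sqrt (real N) * model_kern a N N"
      by (rule mult_right_le_imp_le) (use Np in simp)
    then show "2 * B / real K / sqrt (real N) \<le> model_kern a N N"
      using Np K2 by (simp add: divide_le_eq mult_ac)
  qed
qed

section \<open>Off-diagonal decay of the kernel\<close>

text \<open>A Christoffel--Darboux formula: by induction along diagonals, as the increments of
  both sides from \<open>(m, n)\<close> to \<open>(m + 1, n + 1)\<close> agree.\<close>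

lemma model_kern_christoffel_darboux:
  "(real n - real m) * model_kern a m n = scaled_theta a m * laguerre a n - scaled_theta a n * laguerre a m"
proof (induction m n rule: diff_induct)
  case (1 m)
  then show ?case by (simp add: model_kern_0_right scaled_theta_def)
next
  case (2 n)
  then show ?case by (simp add: model_kern_0_left scaled_theta_def)
next
  case (3 m n)
  have "(real (Suc n) - real (Suc m)) * model_kern a (Suc m) (Suc n) =
     (real n - real m) * model_kern a m n - (real n - real m) * (theta_coeff a (Suc m) * theta_coeff a (Suc n))"
    unfolding model_kern_Suc_Suc by (simp add: algebra_simps)
  also have "\<dots> = scaled_theta a m * laguerre a n - scaled_theta a n * laguerre a m - (real n - real m) * (theta_coeff a (Suc m) * theta_coeff a (Suc n))"
    unfolding 3 ..
  also have "\<dots> = scaled_theta a (Suc m) * laguerre a (Suc n) - scaled_theta a (Suc n) * laguerre a (Suc m)"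
  proof -
    have V: "scaled_theta a m = real (Suc m) * theta_coeff a (Suc m) + 2 * a * laguerre a m"
      "scaled_theta a n = real (Suc n) * theta_coeff a (Suc n) + 2 * a * laguerre a n"
      using scaled_theta_Suc[of a m] scaled_theta_Suc[of a n] by (simp_all add: scaled_theta_def)
    show ?thesis unfolding V laguerre_Suc scaled_theta_def[of a "Suc _"] by (simp add: algebra_simps)
  qed
  finally show ?case .
qed

lemma sqrt_Suc_diff: "1 / (2 * sqrt (real (Suc n))) \<le> sqrt (real (Suc n)) - sqrt (real n)"
  and sqrt_Suc_diff_le: "sqrt (real (Suc n)) - sqrt (real n) \<le> 1"
proof -
  let ?p = "sqrt (real (Suc n))" and ?q = "sqrt (real n)"
  have q: "0 \<le> ?q" "?q \<le> ?p" "?p > 0" "?p \<ge> 1" by auto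
  have "(?p - ?q) * (?p + ?q) = 1" by (simp add: algebra_simps)
  moreover have "(?p - ?q) * (?p + ?q) \<le> (?p - ?q) * (2 * ?p)" using q by (intro mult_left_mono) auto
  ultimately show "1 / (2 * ?p) \<le> ?p - ?q" using q by (simp add: divide_le_eq)
  have "(?p - ?q) * 1 \<le> (?p - ?q) * (?p + ?q)" by (rule mult_left_mono) (use q in linarith)+
  then show "?p - ?q \<le> 1" using \<open>(?p - ?q) * (?p + ?q) = 1\<close> by (simp only: mult_1_right)
qed

lemma model_kern_off_diagonal:
  assumes C: "C > 0" and v: "\<And>n. (scaled_theta a n)\<^sup>2 \<le> C * sqrt (real (Suc n))"
    and l: "\<And>n. (laguerre a n)\<^sup>2 \<le> C / sqrt (real (Suc n))" and nm: "n \<noteq> N"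
  shows "(model_kern a n N)\<^sup>2 \<le> 2 * C\<^sup>2 / sqrt (real (Suc N)) *
     (1 / (sqrt (real (Suc n)) * (sqrt (real (Suc n)) - sqrt (real (Suc N)))\<^sup>2))"
proof -
  define \<rho> where "\<rho> = sqrt (real (Suc n))"
  define R where "R = sqrt (real (Suc N))"
  have pos: "\<rho> > 0" "R > 0" by (auto simp: \<rho>_def R_def)
  have sq: "real n - real N = (\<rho> - R) * (\<rho> + R)" by (simp add: \<rho>_def R_def algebra_simps)
  have ne: "\<rho> \<noteq> R" using nm by (simp add: \<rho>_def R_def)
  have "((real n - real N) * model_kern a N n)\<^sup>2 = (scaled_theta a N * laguerre a n - scaled_theta a n * laguerre a N)\<^sup>2"
    by (simp only: model_kern_christoffel_darboux)
  also have "\<dots> \<le> 2 * (scaled_theta a N * laguerre a n)\<^sup>2 + 2 * (scaled_theta a n * laguerre a N)\<^sup>2"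
    using sum_squares_ge_zero[of "scaled_theta a N * laguerre a n + scaled_theta a n * laguerre a N" 0]
    by (simp add: power2_eq_square algebra_simps)
  also have "\<dots> \<le> 2 * (C * R * (C / \<rho>)) + 2 * (C * \<rho> * (C / R))"
    unfolding power_mult_distrib \<rho>_def R_def using C v l
    by (intro add_mono mult_left_mono mult_mono) auto
  also have "\<dots> = 2 * C\<^sup>2 * (R\<^sup>2 + \<rho>\<^sup>2) / (\<rho> * R)" using pos by (simp add: field_simps power2_eq_square)
  also have "\<dots> \<le> 2 * C\<^sup>2 * (\<rho> + R)\<^sup>2 / (\<rho> * R)"
    using pos by (intro divide_right_mono mult_left_mono) (auto simp: power2_eq_square algebra_simps)
  finally have "(\<rho> - R)\<^sup>2 * (\<rho> + R)\<^sup>2 * (model_kern a n N)\<^sup>2 \<le> 2 * C\<^sup>2 * (\<rho> + R)\<^sup>2 / (\<rho> * R)"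
    unfolding sq by (simp add: power_mult_distrib model_kern_sym[of a n N])
  then have "(\<rho> + R)\<^sup>2 * ((\<rho> - R)\<^sup>2 * (model_kern a n N)\<^sup>2) \<le> (\<rho> + R)\<^sup>2 * (2 * C\<^sup>2 / (\<rho> * R))" by (simp add: mult_ac)
  then have "(\<rho> - R)\<^sup>2 * (model_kern a n N)\<^sup>2 \<le> 2 * C\<^sup>2 / (\<rho> * R)"
    by (rule mult_left_le_imp_le) (use pos in simp)
  moreover have "(\<rho> - R)\<^sup>2 > 0" using ne by simp
  ultimately have "(model_kern a n N)\<^sup>2 \<le> 2 * C\<^sup>2 / (\<rho> * R) / (\<rho> - R)\<^sup>2"
    by (simp only: pos_le_divide_eq mult.commute)
  then show ?thesis unfolding \<rho>_def[symmetric] R_def[symmetric] by (simp add: mult_ac)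
qed

text \<open>Both sums are compared with the telescoping increments of \<open>1 / |sqrt n - R|\<close>, because
  \<open>1 / sqrt n\<close> is comparable to the increment of \<open>sqrt n\<close>.\<close>

lemma left_sum_bound:
  assumes d: "d \<ge> 1" and p: "sqrt (real p) \<le> R - d"
  shows "(\<Sum>n<p. 1 / (sqrt (real (Suc n)) * (sqrt (real (Suc n)) - R)\<^sup>2)) \<le> 4 / d"
proof -
  define g where "g = (\<lambda>n. 1 / (R - sqrt (real n)))"
  have step: "1 / (sqrt (real (Suc n)) * (sqrt (real (Suc n)) - R)\<^sup>2) \<le> 4 * (g (Suc n) - g n)" if n: "n < p" for n
  proof -
    let ?\<rho> = "sqrt (real (Suc n))" and ?\<sigma> = "sqrt (real n)"
    have "?\<rho> \<le> sqrt (real p)" using n by simp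
    then have u: "R - ?\<rho> \<ge> d" using p by linarith
    have \<sigma>: "R - ?\<sigma> > 0" "R - ?\<sigma> \<le> 2 * (R - ?\<rho>)"
      using sqrt_Suc_diff_le[of n] u d by (simp_all add: algebra_simps) (smt (verit) real_sqrt_le_iff)+
    have \<rho>: "?\<rho> > 0" by simp
    have "4 * (g (Suc n) - g n) = 4 * (?\<rho> - ?\<sigma>) / ((R - ?\<rho>) * (R - ?\<sigma>))"
      unfolding g_def using u d \<sigma> by (simp add: diff_frac_eq)
    also have "\<dots> \<ge> 4 * (1 / (2 * ?\<rho>)) / ((R - ?\<rho>) * (2 * (R - ?\<rho>)))"
      using u d \<sigma> \<rho> sqrt_Suc_diff[of n] by (intro frac_le mult_left_mono mult_nonneg_nonneg mult_pos_pos) auto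
    also have "4 * (1 / (2 * ?\<rho>)) / ((R - ?\<rho>) * (2 * (R - ?\<rho>))) = 1 / (?\<rho> * (?\<rho> - R)\<^sup>2)"
    proof -
      have "4 * (1 / (2 * y)) / (x * (2 * x)) = 1 / (y * x\<^sup>2)" for x y :: real
        by (simp add: power2_eq_square)
      then show ?thesis by (simp only: power2_commute[of ?\<rho> R])
    qed
    finally show ?thesis .
  qed
  have "(\<Sum>n<p. 1 / (sqrt (real (Suc n)) * (sqrt (real (Suc n)) - R)\<^sup>2)) \<le> (\<Sum>n<p. 4 * (g (Suc n) - g n))"
    by (intro sum_mono step) auto
  also have "\<dots> = 4 * (g p - g 0)" by (simp only: sum_distrib_left[symmetric] sum_lessThan_telescope)
  also have "\<dots> \<le> 4 * g p"
  proof -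
    have "R \<ge> 0" using p d real_sqrt_ge_zero[of "real p"] by linarith
    then show ?thesis by (simp add: g_def)
  qed
  also have "\<dots> \<le> 4 * (1 / d)" unfolding g_def using p d by (intro mult_left_mono divide_left_mono mult_pos_pos) auto
  finally show ?thesis by simp
qed

lemma right_sum_bound:
  assumes d: "d \<ge> 1" and p: "sqrt (real p) - R \<ge> d"
  shows "(\<Sum>n\<in>{p..<P}. 1 / (sqrt (real (Suc n)) * (sqrt (real (Suc n)) - R)\<^sup>2)) \<le> 2 / d"
proof (cases "p \<le> P")
  case True
  define g where "g = (\<lambda>n. 1 / (sqrt (real n) - R))"
  have step: "1 / (sqrt (real (Suc n)) * (sqrt (real (Suc n)) - R)\<^sup>2) \<le> 2 * (g n - g (Suc n))" if n: "n \<ge> p" for n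
  proof -
    let ?\<rho> = "sqrt (real (Suc n))" and ?\<sigma> = "sqrt (real n)"
    have "sqrt (real p) \<le> ?\<sigma>" using n by simp
    then have u: "?\<sigma> - R \<ge> d" using p by linarith
    have \<rho>\<sigma>: "?\<sigma> \<le> ?\<rho>" by simp
    then have u': "?\<rho> - R \<ge> d" using u by linarith
    have \<rho>: "?\<rho> > 0" by simp
    have "2 * (g n - g (Suc n)) = 2 * (?\<rho> - ?\<sigma>) / ((?\<sigma> - R) * (?\<rho> - R))"
      unfolding g_def using u u' d by (simp add: diff_frac_eq)
    also have "\<dots> \<ge> 2 * (1 / (2 * ?\<rho>)) / ((?\<rho> - R) * (?\<rho> - R))"
      using u u' d \<rho>\<sigma> sqrt_Suc_diff[of n] by (intro frac_le mult_left_mono mult_right_mono mult_nonneg_nonneg mult_pos_pos) auto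
    also have "2 * (1 / (2 * ?\<rho>)) / ((?\<rho> - R) * (?\<rho> - R)) = 1 / (?\<rho> * (?\<rho> - R)\<^sup>2)"
      by (simp add: power2_eq_square)
    finally show ?thesis .
  qed
  have tele: "(\<Sum>n\<in>{p..<P}. g n - g (Suc n)) = g p - g P"
    using True by (induction P rule: dec_induct) auto
  have "(\<Sum>n\<in>{p..<P}. 1 / (sqrt (real (Suc n)) * (sqrt (real (Suc n)) - R)\<^sup>2)) \<le> (\<Sum>n\<in>{p..<P}. 2 * (g n - g (Suc n)))"
    by (intro sum_mono step) auto
  also have "\<dots> = 2 * (g p - g P)" by (simp only: sum_distrib_left[symmetric] tele)
  also have "\<dots> \<le> 2 * g p"
  proof -
    have "sqrt (real p) \<le> sqrt (real P)" using True by simp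
    then have "sqrt (real P) - R \<ge> 0" using p d by linarith
    then show ?thesis by (simp add: g_def)
  qed
  also have "\<dots> \<le> 2 * (1 / d)" unfolding g_def using p d by (intro mult_left_mono divide_left_mono mult_pos_pos) auto
  finally show ?thesis by simp
qed (use d in auto)

lemma model_kern_far_sum:
  assumes C: "C > 0" and v: "\<And>n. (scaled_theta a n)\<^sup>2 \<le> C * sqrt (real (Suc n))"
    and l: "\<And>n. (laguerre a n)\<^sup>2 \<le> C / sqrt (real (Suc n))"
    and d: "d \<ge> 1" and p: "sqrt (real p) \<le> sqrt (real (Suc N)) - d" and p': "sqrt (real p') - sqrt (real (Suc N)) \<ge> d"
    and A: "finite A" "\<And>n. n \<in> A \<Longrightarrow> n < p \<or> n \<ge> p'"
  shows "(\<Sum>n\<in>A. (model_kern a n N)\<^sup>2) \<le> 12 * C\<^sup>2 / (d * sqrt (real (Suc N)))"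
proof -
  let ?R = "sqrt (real (Suc N))"
  let ?f = "\<lambda>n. 1 / (sqrt (real (Suc n)) * (sqrt (real (Suc n)) - ?R)\<^sup>2)"
  have N: "n \<noteq> N" if "n < p \<or> n \<ge> p'" for n
  proof
    assume "n = N"
    show False using that
    proof
      assume "n < p"
      then have "?R \<le> sqrt (real p)" using \<open>n = N\<close> by simp
      then show False using p d by linarith
    next
      assume "n \<ge> p'"
      then have "sqrt (real p') \<le> ?R" using \<open>n = N\<close> by simp
      then show False using p' d by linarith
    qed
  qed
  obtain P where P: "A \<subseteq> {..<P}" using A(1) finite_nat_iff_bounded by blast
  have "(\<Sum>n\<in>A. (model_kern a n N)\<^sup>2) \<le> (\<Sum>n\<in>A. 2 * C\<^sup>2 / ?R * ?f n)"
    using A(2) N by (intro sum_mono model_kern_off_diagonal[OF C v l]) auto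
  also have "\<dots> = 2 * C\<^sup>2 / ?R * (\<Sum>n\<in>A. ?f n)" by (simp only: sum_distrib_left)
  also have "\<dots> \<le> 2 * C\<^sup>2 / ?R * (\<Sum>n\<in>{..<p} \<union> {p'..<P}. ?f n)"
    using A P by (intro mult_left_mono sum_mono2) (auto simp: subset_iff)
  also have "\<dots> \<le> 2 * C\<^sup>2 / ?R * ((\<Sum>n<p. ?f n) + (\<Sum>n\<in>{p'..<P}. ?f n))"
  proof (intro mult_left_mono)
    have "sum ?f ({..<p} \<union> {p'..<P}) + sum ?f ({..<p} \<inter> {p'..<P}) = sum ?f {..<p} + sum ?f {p'..<P}"
      by (intro sum.union_inter) auto
    moreover have "sum ?f ({..<p} \<inter> {p'..<P}) \<ge> 0" by (intro sum_nonneg) auto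
    ultimately show "sum ?f ({..<p} \<union> {p'..<P}) \<le> sum ?f {..<p} + sum ?f {p'..<P}" by linarith
  qed auto
  also have "\<dots> \<le> 2 * C\<^sup>2 / ?R * (4 / d + 2 / d)"
    by (intro mult_left_mono add_mono left_sum_bound[OF d p] right_sum_bound[OF d p']) auto
  also have "\<dots> = 12 * C\<^sup>2 / (d * ?R)" using d by (simp add: field_simps)
  finally show ?thesis .
qed

section \<open>The lower frame bound implies density\<close>

lemma gbinomial_unit_bound:
  assumes "0 \<le> (x::real)" "x \<le> 1"
  shows "\<bar>x gchoose j\<bar> \<le> 1"
proof (induction j)
  case (Suc j)
  have "\<bar>x - real j\<bar> \<le> real (Suc j)" using assms by auto
  then have "\<bar>x - real j\<bar> / real (Suc j) \<le> 1" by (simp add: divide_le_eq)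
  then have "\<bar>x gchoose j\<bar> * (\<bar>x - real j\<bar> / real (Suc j)) \<le> 1 * 1"
    using Suc by (intro mult_mono) auto
  then show ?case unfolding gbinomial_Suc_mult by (simp add: abs_mult del: of_nat_Suc)
qed simp

text \<open>The head of the Newton series at the left end \<open>n\<close> of the cell only involves the coefficients
  \<open>c n, \<dots>, c (n + J - 1)\<close>; the tail is a small multiple of the energy.\<close>

lemma sample_le_coefficients:
  assumes a: "a > 0" and c: "c \<in> model_seqs a" and s: "s \<ge> 0" and D: "D = 2 * ((real J * 2 ^ J)\<^sup>2 * real J)"
  shows "(norm (newton c 0 s))\<^sup>2 \<le> D * (\<Sum>i<J. (norm (c (nat \<lfloor>s\<rfloor> + i)))\<^sup>2) +
    2 * exp_tail J (4 * a) * energy a c (nat \<lfloor>s\<rfloor>)"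
proof -
  define n where "n = nat \<lfloor>s\<rfloor>"
  obtain \<sigma> where \<sigma>: "0 \<le> \<sigma>" "\<sigma> \<le> 1" "newton c 0 s = newton c n \<sigma>"
    using newton_cell[OF a c s] unfolding n_def by metis
  define P where "P = (\<Sum>j<J. of_real (\<sigma> gchoose j) * (fdiff ^^ j) c n)"
  define T where "T = (\<Sum>i<J. norm (c (n + i)))"
  have T0: "T \<ge> 0" unfolding T_def by (simp add: sum_nonneg)
  have dj: "norm ((fdiff ^^ j) c n) \<le> 2 ^ J * T" if j: "j < J" for j
  proof -
    have "norm ((fdiff ^^ j) c n) \<le> (\<Sum>i\<le>j. 2 ^ J * norm (c (n + i)))"
      unfolding fdiff_pow_eq_sum
    proof (rule sum_norm_le)
      fix i assume "i \<in> {..j}"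
      have "real (j choose i) \<le> 2 ^ j"
        using of_nat_mono[OF binomial_le_pow2[of j i], where 'a = real] by simp
      also have "\<dots> \<le> (2::real) ^ J" using j by (intro power_increasing) auto
      finally have "real (j choose i) * norm (c (n + i)) \<le> 2 ^ J * norm (c (n + i))" by (intro mult_right_mono) auto
      then show "norm ((- 1) ^ (j + i) * of_nat (j choose i) * c (n + i)) \<le> 2 ^ J * norm (c (n + i))"
        by (simp add: norm_mult norm_power)
    qed
    also have "\<dots> = 2 ^ J * (\<Sum>i\<le>j. norm (c (n + i)))" by (simp add: sum_distrib_left)
    also have "\<dots> \<le> 2 ^ J * T" unfolding T_def using j by (intro mult_left_mono sum_mono2) auto
    finally show ?thesis .
  qed
  have "norm P \<le> (\<Sum>j<J. 2 ^ J * T)"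
    unfolding P_def
  proof (rule sum_norm_le)
    fix j assume "j \<in> {..<J}"
    then have "\<bar>\<sigma> gchoose j\<bar> * norm ((fdiff ^^ j) c n) \<le> 1 * (2 ^ J * T)"
      by (intro mult_mono gbinomial_unit_bound \<sigma> dj) auto
    then show "norm (of_real (\<sigma> gchoose j) * (fdiff ^^ j) c n) \<le> 2 ^ J * T" by (simp add: norm_mult)
  qed
  then have "(norm P)\<^sup>2 \<le> (real J * 2 ^ J * T)\<^sup>2" by (intro power_mono) (auto simp: mult.assoc)
  also have "\<dots> = (real J * 2 ^ J)\<^sup>2 * T\<^sup>2" by (simp add: power_mult_distrib)
  also have "\<dots> \<le> (real J * 2 ^ J)\<^sup>2 * (real J * (\<Sum>i<J. (norm (c (n + i)))\<^sup>2))"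
    using sum_squared_le_sum_of_squares[of "\<lambda>i. norm (c (n + i))" "{..<J}"]
    by (intro mult_left_mono) (auto simp: T_def mult.commute)
  finally have P: "2 * (norm P)\<^sup>2 \<le> D * (\<Sum>i<J. (norm (c (n + i)))\<^sup>2)" by (simp add: D mult_ac)
  have "\<sigma>\<^sup>2 \<le> 1 * real (Suc n)" using \<sigma> power_le_one[of \<sigma> 2] by simp
  from newton_remainder[OF a c \<sigma>(1) this, of J]
  have R: "(norm (newton c n \<sigma> - P))\<^sup>2 \<le> exp_tail J (4 * a) * energy a c n" by (simp add: P_def)
  have "(norm (newton c n \<sigma>))\<^sup>2 \<le> 2 * (norm P)\<^sup>2 + 2 * (norm (newton c n \<sigma> - P))\<^sup>2"
    using norm_add_sq_le[of P "newton c n \<sigma> - P"] by simp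
  then show ?thesis using P R unfolding \<sigma>(3) n_def by linarith
qed

text \<open>Test the lower bound on the kernel column centred in a block: it has few samples of
  appreciable size outside the block, and inside the block each sample is small, so there must be
  many of them.\<close>

theorem lower_frame_imp_dense:
  assumes a: "a > 0" and M: "cell_mult I s M" and frame: "lower_frame a I s"
  shows "sqrt_dense I s"
proof -
  obtain A where A: "A > 0"
    and frame: "\<And>c. c \<in> model_seqs a \<Longrightarrow> A * normsq c \<le> (\<Sum>\<^sub>\<infinity>k\<in>I. (norm (newton c 0 (s k)))\<^sup>2)"
    using frame unfolding lower_frame_def by blast
  have M1: "real M \<ge> 1" using M by (simp add: cell_mult_def)
  obtain C where C: "C > 0" "\<And>n. (scaled_theta a n)\<^sup>2 \<le> C * sqrt (real (Suc n))" "\<And>n. (laguerre a n)\<^sup>2 \<le> C / sqrt (real (Suc n))"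
    using endpoint_bounds[OF a] by metis
  obtain N0 c0 where c0: "c0 > 0" "\<And>N. N \<ge> N0 \<Longrightarrow> model_kern a N N \<ge> c0 / sqrt (real N)"
    using model_kern_diag_lower[OF a] by metis
  have "(\<lambda>J. real M * (4 * exp_tail J (4 * a))) \<longlonglongrightarrow> real M * (4 * 0)"
    using a by (intro tendsto_intros exp_tail_tendsto) auto
  then have "eventually (\<lambda>J. real M * (4 * exp_tail J (4 * a)) < A / 4) sequentially"
    using A by (intro order_tendstoD(2)) auto
  then obtain J0 where J0: "\<And>J. J \<ge> J0 \<Longrightarrow> real M * (4 * exp_tail J (4 * a)) < A / 4"
    unfolding eventually_sequentially by blast
  \<comment> \<open>\<open>J\<close> makes the energy tails negligible over all samples; then the half-width \<open>q\<close> makes the samples outside the block negligible.\<close>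
  define J where "J = max J0 1"
  have J: "real M * (4 * exp_tail J (4 * a)) \<le> A / 4" "J \<ge> 1" using J0[of J] by (auto simp: J_def)
  define D where "D = 2 * ((real J * 2 ^ J)\<^sup>2 * real J)"
  have D: "D > 0" using J(2) by (simp add: D_def)
  define q0 where "q0 = 48 * real M * D * real J * C\<^sup>2 / (A * c0)"
  define q where "q = nat \<lceil>q0\<rceil> + 2"
  define d where "d = real q - 1"
  have d1: "d \<ge> 1" by (simp add: d_def q_def)
  have dq: "d \<ge> q0" unfolding d_def q_def by linarith
  define L where "L = 2 * q"
  have q2: "q \<ge> 2" by (simp add: q_def)
  define \<gamma> where "\<gamma> = A * real L / (2 * D * real J * (2 + 8 * a))"
  have "\<gamma> * real i \<le> real (card (block I s L i))" if i: "i \<ge> max N0 J" for i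
  proof -
    have iJ: "i \<ge> J" "i \<ge> N0" "i \<ge> 1" using i J(2) by auto
    \<comment> \<open>In the variable \<open>sqrt n\<close> this is the centre of the block.\<close>
    define N where "N = (q * (2 * i + 1))\<^sup>2"
    have sN: "sqrt (real N) = real q * (2 * real i + 1)" by (simp add: N_def) (simp add: algebra_simps)
    define R where "R = sqrt (real (Suc N))"
    have R: "real q * (2 * real i + 1) \<le> R" "R \<le> real q * (2 * real i + 1) + 1"
      using sqrt_Suc_diff_le[of N] real_sqrt_le_mono[of "real N" "real (Suc N)"] unfolding R_def sN[symmetric] by auto
    have R0: "R > 0" by (simp add: R_def)
    have "N \<ge> N0"
    proof -
      have "i \<le> q * (2 * i + 1)" using q2 by (simp add: trans_le_add2 mult_le_mono algebra_simps)
      also have "\<dots> \<le> N" unfolding N_def by (simp add: power2_eq_square)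
      finally show ?thesis using iJ by simp
    qed
    define \<kappa> where "\<kappa> = model_kern a N N"
    have \<kappa>: "\<kappa> \<ge> c0 / R"
    proof -
      have "real q * (2 * real i + 1) > 0" using q2 by (intro mult_pos_pos) auto
      then have "c0 / R \<le> c0 / sqrt (real N)"
        unfolding sN using c0(1) R(1) R0 by (intro divide_left_mono) auto
      then show ?thesis using c0(2)[OF \<open>N \<ge> N0\<close>] by (simp add: \<kappa>_def)
    qed
    then have \<kappa>0: "\<kappa> > 0" using c0(1) R0 by (smt (verit) divide_pos_pos)
    define c where "c = kern_column a N"
    have c: "c \<in> model_seqs a" unfolding c_def by (rule kern_column_in_model_seqs[OF a])
    have nc: "normsq c = \<kappa>"
    proof -
      have "complex_of_real (normsq c) = c N"
        using sprod_self[OF model_seqs_sq_summable[OF c]] sprod_kern_column[OF a c, of N] by (simp add: c_def)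
      then show ?thesis by (simp add: c_def kern_column_def \<kappa>_def)
    qed
    have cn: "(norm (c n))\<^sup>2 = (model_kern a n N)\<^sup>2" for n by (simp add: c_def kern_column_def)
    let ?cell = "\<lambda>k. nat \<lfloor>s k\<rfloor>"
    let ?B = "block I s L i"
    let ?g = "\<lambda>n. \<Sum>j<J. (norm (c (n + j)))\<^sup>2"
    define b where "b = D * (real J * ((2 + 8 * a) / (real L * real i) * \<kappa>))"
    have b0: "b \<ge> 0" using D a \<kappa>0 by (simp add: b_def)
    have inside: "D * ?g (?cell k) \<le> b" if k: "k \<in> ?B" for k
    proof -
      have lo: "(L * i)\<^sup>2 \<le> ?cell k" using k by (simp add: block_def)
      have "(norm (c (?cell k + j)))\<^sup>2 \<le> (2 + 8 * a) / (real L * real i) * \<kappa>" for j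
      proof -
        let ?n = "?cell k + j"
        have "real L * real i = sqrt (real ((L * i)\<^sup>2))" by simp
        also have "\<dots> \<le> sqrt (real (Suc ?n))" using lo by (intro real_sqrt_le_mono of_nat_mono) linarith
        finally have le: "real L * real i \<le> sqrt (real (Suc ?n))" .
        have "(norm (c ?n))\<^sup>2 \<le> model_kern a ?n ?n * normsq c" by (rule model_seqs_pointwise[OF a c])
        also have "\<dots> \<le> (2 + 8 * a) / sqrt (real (Suc ?n)) * \<kappa>"
          unfolding nc using \<kappa>0 by (intro mult_right_mono model_kern_diag_le[OF a]) auto
        also have "\<dots> \<le> (2 + 8 * a) / (real L * real i) * \<kappa>"
          using \<kappa>0 a le q2 iJ(3) by (intro mult_right_mono divide_left_mono mult_pos_pos) (auto simp: L_def)
        finally show ?thesis .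
      qed
      then have "?g (?cell k) \<le> (\<Sum>j<J. (2 + 8 * a) / (real L * real i) * \<kappa>)" by (intro sum_mono) auto
      then show ?thesis unfolding b_def using D by (intro mult_left_mono) auto
    qed
    have far: "(\<Sum>n\<in>S. (norm (c (n + j)))\<^sup>2) \<le> 12 * C\<^sup>2 / (d * R)"
      if S: "finite S" "\<And>n. n \<in> S \<Longrightarrow> n < (L * i)\<^sup>2 \<or> n \<ge> (L * (i + 1))\<^sup>2" and j: "j < J" for S j
    proof -
      have "(\<Sum>n\<in>S. (norm (c (n + j)))\<^sup>2) = (\<Sum>n\<in>(\<lambda>n. n + j) ` S. (model_kern a n N)\<^sup>2)"
        unfolding cn by (subst sum.reindex) (auto simp: inj_on_def)
      also have "\<dots> \<le> 12 * C\<^sup>2 / (d * sqrt (real (Suc N)))"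
      proof (rule model_kern_far_sum[OF C d1, where p = "(L * i)\<^sup>2 + J" and p' = "(L * (i + 1))\<^sup>2"])
        have "real ((L * i)\<^sup>2 + J) \<le> (real L * real i + 1)\<^sup>2"
        proof -
          have "real J \<le> real i" using iJ by simp
          also have "real i \<le> 2 * real L * real i + 1"
          proof -
            have "1 * real i \<le> (2 * real L) * real i" using q2 by (intro mult_right_mono) (auto simp: L_def)
            then show ?thesis by simp
          qed
          finally show ?thesis by (simp add: power2_eq_square algebra_simps)
        qed
        then have "sqrt (real ((L * i)\<^sup>2 + J)) \<le> real L * real i + 1" by (intro real_le_lsqrt) auto
        also have "\<dots> = real q * (2 * real i + 1) - d" by (simp add: L_def d_def algebra_simps)
        finally show "sqrt (real ((L * i)\<^sup>2 + J)) \<le> sqrt (real (Suc N)) - d" using R(1) by (simp add: R_def)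
        have "sqrt (real ((L * (i + 1))\<^sup>2)) = real q * (2 * real i + 1) + 1 + d"
          by (simp add: L_def d_def algebra_simps)
        then show "sqrt (real ((L * (i + 1))\<^sup>2)) - sqrt (real (Suc N)) \<ge> d" using R(2) by (simp add: R_def)
        show "finite ((\<lambda>n. n + j) ` S)" using S by simp
        fix n assume "n \<in> (\<lambda>n. n + j) ` S"
        then show "n < (L * i)\<^sup>2 + J \<or> n \<ge> (L * (i + 1))\<^sup>2" using S(2) j by fastforce
      qed
      finally show ?thesis by (simp add: R_def)
    qed
    have total: "(\<Sum>k\<in>F. (norm (newton c 0 (s k)))\<^sup>2) \<le> real (card ?B) * b + A / 4 * \<kappa> + A / 4 * \<kappa>"
      if F: "finite F" "F \<subseteq> I" for F
    proof -
      let ?\<tau> = "2 * exp_tail J (4 * a)"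
      have \<tau>0: "?\<tau> \<ge> 0" using a by (simp add: exp_tail_nonneg)
      have "(\<Sum>k\<in>F. (norm (newton c 0 (s k)))\<^sup>2) \<le> (\<Sum>k\<in>F. D * ?g (?cell k) + ?\<tau> * energy a c (?cell k))"
        using M F(2) by (intro sum_mono sample_le_coefficients[OF a c _ D_def]) (auto simp: cell_mult_def)
      also have "\<dots> = (\<Sum>k\<in>F. D * ?g (?cell k)) + ?\<tau> * (\<Sum>k\<in>F. energy a c (?cell k))"
        by (simp only: sum.distrib sum_distrib_left)
      also have "(\<Sum>k\<in>F. D * ?g (?cell k)) = (\<Sum>k\<in>F \<inter> ?B. D * ?g (?cell k)) + (\<Sum>k\<in>F - ?B. D * ?g (?cell k))"
        by (rule sum.Int_Diff[OF F(1)])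
      also have "(\<Sum>k\<in>F \<inter> ?B. D * ?g (?cell k)) \<le> real (card ?B) * b"
      proof -
        have "(\<Sum>k\<in>F \<inter> ?B. D * ?g (?cell k)) \<le> real (card (F \<inter> ?B)) * b"
          by (rule sum_bounded_above) (use inside in auto)
        also have "\<dots> \<le> real (card ?B) * b"
          using card_block_le(1)[OF M, of L i] by (intro mult_right_mono of_nat_mono card_mono b0) auto
        finally show ?thesis .
      qed
      also have "(\<Sum>k\<in>F - ?B. D * ?g (?cell k)) \<le> A / 4 * \<kappa>"
      proof -
        let ?S = "?cell ` (F - ?B)"
        have S: "finite ?S" "\<And>n. n \<in> ?S \<Longrightarrow> n < (L * i)\<^sup>2 \<or> n \<ge> (L * (i + 1))\<^sup>2"
          using F by (auto simp: block_def)
        have "(\<Sum>k\<in>F - ?B. D * ?g (?cell k)) = D * (\<Sum>k\<in>F - ?B. ?g (?cell k))" by (simp only: sum_distrib_left)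
        also have "\<dots> \<le> D * (real M * (\<Sum>n\<in>?S. ?g n))"
          using F D by (intro mult_left_mono cell_mult_sum[OF M]) (auto simp: sum_nonneg)
        also have "(\<Sum>n\<in>?S. ?g n) = (\<Sum>j<J. \<Sum>n\<in>?S. (norm (c (n + j)))\<^sup>2)" by (rule sum.swap)
        also have "D * (real M * (\<Sum>j<J. \<Sum>n\<in>?S. (norm (c (n + j)))\<^sup>2)) \<le>
            D * (real M * (\<Sum>j<J. 12 * C\<^sup>2 / (d * R)))"
          using D by (intro mult_left_mono sum_mono far S) auto
        also have "\<dots> = (48 * real M * D * real J * C\<^sup>2) / 4 / (d * R)" by simp
        also have "48 * real M * D * real J * C\<^sup>2 = q0 * (A * c0)" using A c0(1) by (simp add: q0_def)
        also have "q0 * (A * c0) / 4 / (d * R) \<le> d * (A * c0) / 4 / (d * R)"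
          using dq A c0(1) d1 R0 by (intro divide_right_mono mult_right_mono) auto
        also have "\<dots> = A / 4 * (c0 / R)" using d1 by simp
        also have "\<dots> \<le> A / 4 * \<kappa>" using A \<kappa> by (intro mult_left_mono) auto
        finally show ?thesis .
      qed
      also have "?\<tau> * (\<Sum>k\<in>F. energy a c (?cell k)) \<le> A / 4 * \<kappa>"
      proof -
        have "(\<Sum>k\<in>F. energy a c (?cell k)) \<le> real M * (\<Sum>n\<in>?cell ` F. energy a c n)"
          by (intro cell_mult_sum[OF M F] energy_nonneg a c)
        also have "\<dots> \<le> real M * (2 * normsq c)"
          using F by (intro mult_left_mono energy_sum_finite_le a c) auto
        finally have "?\<tau> * (\<Sum>k\<in>F. energy a c (?cell k)) \<le> ?\<tau> * (real M * (2 * normsq c))"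
          by (intro mult_left_mono \<tau>0)
        also have "\<dots> = real M * (4 * exp_tail J (4 * a)) * \<kappa>" by (simp add: nc)
        also have "\<dots> \<le> A / 4 * \<kappa>" using J(1) \<kappa>0 by (intro mult_right_mono) auto
        finally show ?thesis .
      qed
      finally show ?thesis by simp
    qed
    have "A * \<kappa> \<le> (\<Sum>\<^sub>\<infinity>k\<in>I. (norm (newton c 0 (s k)))\<^sup>2)" using frame[OF c] by (simp add: nc)
    also have "\<dots> \<le> real (card ?B) * b + A / 4 * \<kappa> + A / 4 * \<kappa>"
      by (rule infsum_le_finite_sums[OF samples_summable(1)[OF a c M] total])
    finally have "A / 2 * \<kappa> \<le> real (card ?B) * b" by simp
    also have "\<dots> = (real (card ?B) * (D * real J * (2 + 8 * a) / (real L * real i))) * \<kappa>" by (simp add: b_def)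
    finally have "A / 2 \<le> real (card ?B) * (D * real J * (2 + 8 * a) / (real L * real i))"
      by (rule mult_right_le_imp_le) (rule \<kappa>0)
    then have "A / 2 \<le> real (card ?B) * (D * real J * (2 + 8 * a)) / (real L * real i)" by simp
    moreover have Li: "real L * real i > 0" using q2 iJ(3) by (simp add: L_def)
    ultimately have "A / 2 * (real L * real i) \<le> real (card ?B) * (D * real J * (2 + 8 * a))"
      by (simp only: pos_le_divide_eq)
    moreover have "D * real J * (2 + 8 * a) > 0" using D J(2) a by simp
    ultimately have "A / 2 * (real L * real i) / (D * real J * (2 + 8 * a)) \<le> real (card ?B)"
      by (simp only: pos_divide_le_eq)
    then show ?thesis by (simp add: \<gamma>_def mult_ac)
  qed
  moreover have "\<gamma> > 0" using A D J(2) a q2 by (simp add: \<gamma>_def L_def)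
  moreover have "L \<ge> 1" using q2 by (simp add: L_def)
  ultimately show ?thesis unfolding sqrt_dense_def by blast
qed

section \<open>Invariance of the density\<close>

lemma block_iff_sqrt:
  assumes "s k \<ge> 0"
  shows "k \<in> block I s L i \<longleftrightarrow> k \<in> I \<and> real (L * i) \<le> sqrt (s k) \<and> sqrt (s k) < real (L * (i + 1))"
proof -
  have lo: "p\<^sup>2 \<le> nat \<lfloor>s k\<rfloor> \<longleftrightarrow> real p \<le> sqrt (s k)" for p
  proof -
    have "p\<^sup>2 \<le> nat \<lfloor>s k\<rfloor> \<longleftrightarrow> real (p\<^sup>2) \<le> s k" using assms by (simp add: le_nat_iff le_floor_iff)
    also have "\<dots> \<longleftrightarrow> real p \<le> sqrt (s k)"
      using assms real_sqrt_le_iff[of "(real p)\<^sup>2" "s k"] by simp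
    finally show ?thesis .
  qed
  show ?thesis unfolding block_def atLeastLessThan_iff mem_Collect_eq lo
    using lo[of "L * (i + 1)"] by (metis not_le)
qed

text \<open>A bounded displacement of \<open>sqrt s\<close> moves a block of length \<open>L\<close> inside a longer block, and the
  position \<open>i\<close> of the longer block is at most that of the shorter one.\<close>

lemma sqrt_dense_perturb:
  assumes Mt: "cell_mult I t M'" and Ms: "cell_mult I s M"
    and E: "\<And>k. k \<in> I \<Longrightarrow> \<bar>sqrt (t k) - sqrt (s k)\<bar> \<le> E" and dense: "sqrt_dense I s"
  shows "sqrt_dense I t"
proof -
  obtain L \<gamma> i0 where L: "L \<ge> 1" and \<gamma>: "\<gamma> > 0"
    and dense: "\<And>i. i \<ge> i0 \<Longrightarrow> \<gamma> * real i \<le> real (card (block I s L i))"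
    using dense unfolding sqrt_dense_def by blast
  define e where "e = nat \<lceil>E\<rceil>"
  have e: "\<bar>sqrt (t k) - sqrt (s k)\<bar> \<le> real e" if "k \<in> I" for k
    using E[OF that] real_nat_ceiling_ge[of E] unfolding e_def by linarith
  define L' where "L' = 2 * L + 2 * e"
  have "\<gamma> * real i \<le> real (card (block I t L' i))" if i: "i \<ge> i0" for i
  proof -
    \<comment> \<open>The first block of length \<open>L\<close> at distance at least \<open>e\<close> from the left end of the longer block.\<close>
    define j where "j = (L' * i + e) div L + 1"
    have j1: "L * j \<ge> L' * i + e" "L * j \<le> L' * i + e + L"
    proof -
      have "L * ((L' * i + e) div L) + (L' * i + e) mod L = L' * i + e" by simp
      moreover have "(L' * i + e) mod L < L" using L by simp
      ultimately show "L * j \<ge> L' * i + e" "L * j \<le> L' * i + e + L"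
        unfolding j_def distrib_left mult_1_right by linarith+
    qed
    have "L * i \<le> L' * i" unfolding L'_def by (intro mult_le_mono1) simp
    then have "L * i \<le> L * j" using j1(1) by linarith
    then have ij: "i \<le> j" using L by simp
    have sub: "block I s L j \<subseteq> block I t L' i"
    proof
      fix k assume k: "k \<in> block I s L j"
      then have kI: "k \<in> I" by (simp add: block_def)
      have s0: "s k \<ge> 0" "t k \<ge> 0" using Ms Mt kI by (auto simp: cell_mult_def)
      have ks: "real (L * j) \<le> sqrt (s k)" "sqrt (s k) < real (L * (j + 1))"
        using k block_iff_sqrt[of s k I L j] s0 by auto
      have "real (L' * i) + real e \<le> real (L * j)" using j1(1) by (metis of_nat_add of_nat_mono)
      then have lo: "real (L' * i) \<le> sqrt (t k)" using ks e[OF kI] by linarith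
      have "L * (j + 1) + e \<le> L' * (i + 1)" using j1(2) unfolding L'_def by (simp add: algebra_simps)
      then have "real (L * (j + 1)) + real e \<le> real (L' * (i + 1))" by (metis of_nat_add of_nat_mono)
      then have "sqrt (t k) < real (L' * (i + 1))" using ks e[OF kI] by linarith
      then show "k \<in> block I t L' i" using lo kI block_iff_sqrt[of t k I L' i] s0 by blast
    qed
    have "\<gamma> * real i \<le> \<gamma> * real j" using ij \<gamma> by (intro mult_left_mono) auto
    also have "\<dots> \<le> real (card (block I s L j))" using i ij by (intro dense) auto
    also have "\<dots> \<le> real (card (block I t L' i))"
      by (intro of_nat_mono card_mono sub card_block_le(1)[OF Mt])
    finally show ?thesis .
  qed
  moreover have "L' \<ge> 1" using L by (simp add: L'_def)
  ultimately show ?thesis unfolding sqrt_dense_def using \<gamma> by blast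
qed

lemma omega_sqrt:
  assumes "s \<ge> 0"
  shows "sqrt 8 * sqrt s \<le> omega s" "omega s \<le> sqrt 8 * sqrt s + 2"
proof -
  show "sqrt 8 * sqrt s \<le> omega s" unfolding omega_def by (simp add: real_sqrt_mult[symmetric])
  have "omega s \<le> sqrt (8 * s) + sqrt 4" unfolding omega_def using assms by (intro sqrt_add_le_add_sqrt) auto
  then show "omega s \<le> sqrt 8 * sqrt s + 2" by (simp add: real_sqrt_mult)
qed

lemma omega_diff_imp_sqrt_diff:
  assumes "s \<ge> 0" "t \<ge> 0" "\<bar>omega t - omega s\<bar> \<le> B"
  shows "\<bar>sqrt t - sqrt s\<bar> \<le> B + 2"
proof -
  have "\<bar>sqrt 8 * sqrt t - sqrt 8 * sqrt s\<bar> \<le> B + 2"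
    using omega_sqrt[OF assms(1)] omega_sqrt[OF assms(2)] assms(3) by linarith
  moreover have "sqrt 8 * sqrt t - sqrt 8 * sqrt s = sqrt 8 * (sqrt t - sqrt s)" by (simp add: right_diff_distrib)
  ultimately have "sqrt 8 * \<bar>sqrt t - sqrt s\<bar> \<le> B + 2" by (simp add: abs_mult)
  moreover have "1 * \<bar>sqrt t - sqrt s\<bar> \<le> sqrt 8 * \<bar>sqrt t - sqrt s\<bar>" by (intro mult_right_mono) auto
  ultimately have "1 * \<bar>sqrt t - sqrt s\<bar> \<le> B + 2" by (rule order_trans[rotated])
  then show ?thesis by simp
qed

lemma omega_diff_le:
  assumes "s \<ge> 0" "t \<ge> 0" "\<bar>t - s\<bar> \<le> D * sqrt (1 + s)"
  shows "\<bar>omega t - omega s\<bar> \<le> 4 * D"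
proof -
  have os: "omega s \<ge> 2 * sqrt (1 + s)"
  proof -
    have "2 * sqrt (1 + s) = sqrt (4 * (1 + s))" by (simp only: real_sqrt_mult real_sqrt_four)
    also have "\<dots> \<le> omega s" unfolding omega_def using assms(1) by (intro real_sqrt_le_mono) simp
    finally show ?thesis .
  qed
  have ot: "omega t \<ge> 0" using assms(2) by (simp add: omega_def)
  have p: "sqrt (1 + s) > 0" using assms(1) by simp
  have "(omega t)\<^sup>2 = 8 * t + 4" "(omega s)\<^sup>2 = 8 * s + 4" using assms by (auto simp: omega_def)
  then have "(omega t - omega s) * (omega t + omega s) = 8 * (t - s)" by (simp add: power2_eq_square algebra_simps)
  then have "\<bar>omega t - omega s\<bar> * \<bar>omega t + omega s\<bar> = 8 * \<bar>t - s\<bar>"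
    by (metis abs_mult abs_numeral)
  then have eq: "\<bar>omega t - omega s\<bar> * (omega t + omega s) = 8 * \<bar>t - s\<bar>" using os ot p by simp
  have "\<bar>omega t - omega s\<bar> * (2 * sqrt (1 + s)) \<le> \<bar>omega t - omega s\<bar> * (omega t + omega s)"
    using os ot by (intro mult_left_mono) auto
  also have "\<dots> \<le> 8 * (D * sqrt (1 + s))" unfolding eq using assms(3) by simp
  also have "\<dots> = 4 * D * (2 * sqrt (1 + s))" by simp
  finally have "\<bar>omega t - omega s\<bar> * (2 * sqrt (1 + s)) \<le> 4 * D * (2 * sqrt (1 + s))" .
  then show ?thesis by (rule mult_right_le_imp_le) (use p in simp)
qed

text \<open>Both frame properties are equivalent to the density condition, which is insensitive to bounded
  displacements of \<open>\<omega>\<close>.\<close>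

theorem frame_iff_of_omega_close:
  assumes a: "a > 0" and s: "temporal_multiseq I s" "bounded_cell_mult I s"
    and t: "temporal_multiseq I t" "bounded_cell_mult I t"
    and close: "\<And>k. k \<in> I \<Longrightarrow> \<bar>omega (t k) - omega (s k)\<bar> \<le> B"
  shows "hframe (model_space a) I (\<lambda>k. comp_shift_power a (s k) (kzero a)) \<longleftrightarrow>
         hframe (model_space a) I (\<lambda>k. comp_shift_power a (t k) (kzero a))"
proof -
  obtain M where M: "cell_mult I s M" using bounded_cell_mult_imp[OF s] by blast
  obtain M' where M': "cell_mult I t M'" using bounded_cell_mult_imp[OF t] by blast
  have E: "\<bar>sqrt (t k) - sqrt (s k)\<bar> \<le> B + 2" if "k \<in> I" for k
    using s(1) t(1) close[OF that] that by (intro omega_diff_imp_sqrt_diff) (auto simp: temporal_multiseq_def)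
  then have E': "\<bar>sqrt (s k) - sqrt (t k)\<bar> \<le> B + 2" if "k \<in> I" for k
    using that by (simp add: abs_minus_commute)
  have "sqrt_dense I s \<longleftrightarrow> sqrt_dense I t"
    using sqrt_dense_perturb[OF M' M E] sqrt_dense_perturb[OF M M' E'] by blast
  moreover have "lower_frame a I s \<longleftrightarrow> sqrt_dense I s"
    using lower_frame_imp_dense[OF a M] dense_imp_lower_frame[OF a M] by blast
  moreover have "lower_frame a I t \<longleftrightarrow> sqrt_dense I t"
    using lower_frame_imp_dense[OF a M'] dense_imp_lower_frame[OF a M'] by blast
  ultimately show ?thesis using hframe_iff_lower_frame[OF a M] hframe_iff_lower_frame[OF a M'] by simp
qed

theorem corollary7p3:
  fixes a :: real and I :: "'i set" and s t :: "'i \<Rightarrow> real"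
  assumes "a > 0"
    and "temporal_multiseq I s" and "temporal_multiseq I t"
    and "bounded_cell_mult I s" and "bounded_cell_mult I t"
  shows "(bdd_above ((\<lambda>k. \<bar>omega (t k) - omega (s k)\<bar>) ` I) \<longrightarrow>
           (hframe (model_space a) I (\<lambda>k. comp_shift_power a (s k) (kzero a)) \<longleftrightarrow>
            hframe (model_space a) I (\<lambda>k. comp_shift_power a (t k) (kzero a)))) \<and>
         ((\<exists>D\<ge>0. \<forall>k\<in>I. \<bar>t k - s k\<bar> \<le> D * sqrt (1 + s k)) \<longrightarrow>
           (hframe (model_space a) I (\<lambda>k. comp_shift_power a (s k) (kzero a)) \<longleftrightarrow>
            hframe (model_space a) I (\<lambda>k. comp_shift_power a (t k) (kzero a))))"
proof (intro conjI impI)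
  assume "bdd_above ((\<lambda>k. \<bar>omega (t k) - omega (s k)\<bar>) ` I)"
  then obtain B where "\<And>k. k \<in> I \<Longrightarrow> \<bar>omega (t k) - omega (s k)\<bar> \<le> B"
    by (auto simp: bdd_above_def)
  then show "hframe (model_space a) I (\<lambda>k. comp_shift_power a (s k) (kzero a)) \<longleftrightarrow>
      hframe (model_space a) I (\<lambda>k. comp_shift_power a (t k) (kzero a))"
    by (rule frame_iff_of_omega_close[OF assms(1,2,4,3,5)])
next
  assume "\<exists>D\<ge>0. \<forall>k\<in>I. \<bar>t k - s k\<bar> \<le> D * sqrt (1 + s k)"
  then obtain D where D: "\<And>k. k \<in> I \<Longrightarrow> \<bar>t k - s k\<bar> \<le> D * sqrt (1 + s k)" by blast
  have "\<bar>omega (t k) - omega (s k)\<bar> \<le> 4 * D" if "k \<in> I" for k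
    using assms(2,3) D[OF that] that by (intro omega_diff_le) (auto simp: temporal_multiseq_def)
  then show "hframe (model_space a) I (\<lambda>k. comp_shift_power a (s k) (kzero a)) \<longleftrightarrow>
      hframe (model_space a) I (\<lambda>k. comp_shift_power a (t k) (kzero a))"
    by (rule frame_iff_of_omega_close[OF assms(1,2,4,3,5)])
qed

end
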